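(* Let $\mathcal E$ be a quantum channel (completely positive trace-preserving linear map) on an $n$-qubit system, and let each of the ensembles $\mathcal U_{\rm in}$ and $\mathcal U_{\rm out}$ be either $\mathcal U_{\rm P}^{\otimes n}$ (random local Pauli) or $\mathcal U_{\rm C}$ (random global Clifford), not necessarily the same (four cases). Let $O_1,\dots,O_M$ be a collection of $M$ operators and $\rho_1,\dots,\rho_L$ be a collection of $L$ other operators. Given $\epsilon,\delta\in[0,1]$, let $$K = 2\log(2ML/\delta),\qquad N=\frac{34}{\epsilon^2}\,4^n \max_{\substack{1\le j\le M\\ 1\le \ell\le L}} f_{\mathcal U_{\rm in}}(\rho_\ell)\, f_{\mathcal U_{\rm out}}(O_j),$$ where $$f_{\mathcal U}(O)=\begin{cases}4^{\mathrm{supp}(O)}\|O\|^2 & \text{if } \mathcal U=\mathcal U_{\rm P}^{\otimes n},\\ \|\mathcal S(O)\| & \text{if } \mathcal U=\mathcal U_{\rm C},\end{cases}$$ $$\mathcal S(O)=2\left\{[2\,\mathrm{Tr}(O)^2+\mathrm{Tr}(O^2)]\,\mathbb I+2\,\mathrm{Tr}(O)\,O+2\,O^2\right\},$$ $\|\cdot\|$ denotes the operator (spectral) norm, and $\mathrm{supp}(O)$ is the number of qubits $O$ acts nontrivially on. Then a collection of $m=NK$ process shadows of $\mathcal E$ is sufficient to ensure that, with probability at least $1-\delta$, the median of means $\tilde o_j(\rho_k,N,K)$ is a good estimate of $\mathrm{Tr}[\mathcal E(\rho_k)O_j]$, i.e. $$\left|\mathrm{Tr}[\mathcal E(\rho_k)O_j]-\tilde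 o_j(\rho_k,N,K)\right|\le \epsilon$$ for all $1\le j\le M$ and $1\le k\le L$.
   Context: $\mathbb I$ is the identity; $\{|b\rangle : b\in\{0,1\}^n\}$ is the computational basis of the $n$ qubits; the transpose ${}^T$ is taken in the computational basis. Ensembles. $\mathcal U_{\rm C}$ is the ensemble of random global $n$-qubit Clifford circuits. $\mathcal U_{\rm P}^{\otimes n}$ is the ensemble of independent, uniformly random single-qubit Pauli rotations, so that each qubit is rotated to the eigenbasis of a uniformly random Pauli operator $X$, $Y$ or $Z$; $\mathcal U_{\rm P}$ is its single-qubit version. Inverse measurement maps. For an ensemble $\mathcal U$ of unitaries, $\mathcal M_{\mathcal U}(A)=\mathbb E_{U\sim\mathcal U}\sum_{b}\mathrm{Tr}[U^\dagger|b\rangle\langle b|U A]\;U^\dagger|b\rangle\langle b|U$. Then $\mathcal M^{-1}_{\mathcal U_{\rm C}}(A)=(2^n+1)A-\mathrm{Tr}(A)\mathbb I$, and $\mathcal M^{-1}_{\mathcal U_{\rm P}^{\otimes n}}=(\mathcal M^{-1}_{\mathcal U_{\rm P}})^{\otimes n}$, where $\mathcal M^{-1}_{\mathcal U_{\rm P}}(A)=3A-\mathrm{Tr}(A)\mathbb I$ on a single qubit. For the product ensemble, $\mathcal M^{-1}_{\mathcal U_{\rm in}\otimes\mathcal U_{\rm out}}=\mathcal M^{-1}_{\mathcal U_{\rm in}}\otimes\mathcal M^{-1}_{\mathcal U_{\rm out}}$. Choi state. With the unnormalized maximally entangled state $|\omega\rangle=\sum_a|a\rangle_A\otimes|a\rangle_B$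 on two copies $A,B$ of the system, $\eta=(\mathcal I_A\otimes\mathcal E_B)[|\omega\rangle\langle\omega|]$. It is a density matrix up to the normalization factor $2^n$ (its trace), and $\mathcal E(\rho)=\mathrm{Tr}_A[(\rho^T\otimes\mathbb I_B)\,\eta]$. Process shadow. Draw $b_{\rm in}\in\{0,1\}^n$ uniformly at random and prepare $|b_{\rm in}\rangle$; apply $U_{\rm in}$ drawn at random from $\mathcal U_{\rm in}$; apply the channel $\mathcal E$; apply $U_{\rm out}$ drawn at random from $\mathcal U_{\rm out}$; measure in the computational basis to obtain $b_{\rm out}$. Put $|z\rangle=U_{\rm in}^T|b_{\rm in}\rangle\otimes U_{\rm out}^\dagger|b_{\rm out}\rangle$. The single-shot shadow is $\hat\zeta=\mathcal M^{-1}_{\mathcal U_{\rm in}\otimes\mathcal U_{\rm out}}(|z\rangle\langle z|)$, which is used as a single-shot estimator of the Choi state $\eta$. Repeating the procedure $m$ times gives a collection of $m$ shadows $\hat\zeta_1,\dots,\hat\zeta_m$. Median-of-means estimator. For $\rho$ and $O_j$, each shadow gives the single-shot estimator $\mathrm{Tr}[\hat\zeta\,(\rho^T\otimes O_j)]$ of $\mathrm{Tr}[\mathcal E(\rho)O_j]$. The estimator $\tilde o_j(\rho,N,K)$ is computed by dividing the collection of $m=NK$ single-shot estimators into $K$ subsets, each of size $N$, and taking the median of the means of the subsets.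
   Formalization: The operators O_j and ρ_ℓ are taken Hermitian, ε and δ positive, N and K rounded up; the single-shot estimator carries a factor 2^n, and the prepared input state is U_in^†|b_in⟩ instead of U_in|b_in⟩, since the claim is false or undefined as literally stated. *)

theory Defs
  imports "HOL-Analysis.Analysis" "HOL-Probability.Probability"
begin

text \<open>
  Qubits are labelled by a finite type \<open>'q\<close>, so \<open>n = CARD('q)\<close> and the computational basis is
  indexed by the bit strings \<open>'q \<Rightarrow> bool\<close>. Operators are complex matrices in that basis; operators on
  two copies of the system are indexed by pairs of bit strings.
\<close>

section \<open>Operators\<close>

type_synonym 'a op = "((complex, 'a) vec, 'a) vec"

definition cscale :: "complex \<Rightarrow> 'a::finite op \<Rightarrow> 'a op" where
  "cscale c A = (\<chi> i j. c * A $ i $ j)"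

definition cadj :: "'a::finite op \<Rightarrow> 'a op" where
  "cadj A = (\<chi> i j. cnj (A $ j $ i))"

definition hermitian :: "'a::finite op \<Rightarrow> bool" where
  "hermitian A \<longleftrightarrow> cadj A = A"

definition unitary :: "'a::finite op \<Rightarrow> bool" where
  "unitary U \<longleftrightarrow> U ** cadj U = mat 1 \<and> cadj U ** U = mat 1"

definition ket :: "'a::finite \<Rightarrow> (complex, 'a) vec" where
  "ket b = axis b 1"

definition ketbra :: "(complex, 'a::finite) vec \<Rightarrow> 'a op" where
  "ketbra v = (\<chi> i j. v $ i * cnj (v $ j))"

definition opnorm :: "'a::finite op \<Rightarrow> real" where
  "opnorm A = onorm ((*v) A)"

definition vtensor ::
    "(complex, 'a::finite) vec \<Rightarrow> (complex, 'b::finite) vec \<Rightarrow> (complex, 'a \<times> 'b) vec" where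
  "vtensor v w = (\<chi> p. v $ fst p * w $ snd p)"

definition optensor :: "'a::finite op \<Rightarrow> 'b::finite op \<Rightarrow> ('a \<times> 'b) op" where
  "optensor A B = (\<chi> p r. A $ fst p $ fst r * B $ snd p $ snd r)"

definition qubit_tensor :: "('q::finite \<Rightarrow> bool op) \<Rightarrow> ('q \<Rightarrow> bool) op" where
  "qubit_tensor s = (\<chi> a b. \<Prod>q\<in>UNIV. s q $ a q $ b q)"

text \<open>
  \<open>O\<close> acts trivially on qubit \<open>q\<close> if it factors as the identity on \<open>q\<close> times an operator \<open>B\<close> on the
  remaining qubits; the bit strings of the remaining qubits are represented by setting bit \<open>q\<close> to
  \<open>False\<close>.
\<close>

definition acts_trivially_on :: "'q::finite \<Rightarrow> ('q \<Rightarrow> bool) op \<Rightarrow> bool" where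
  "acts_trivially_on q A \<longleftrightarrow>
     (\<exists>B :: ('q \<Rightarrow> bool) op. \<forall>a b.
        A $ a $ b = (if a q = b q then B $ a(q := False) $ b(q := False) else 0))"

definition supp_size :: "('q::finite \<Rightarrow> bool) op \<Rightarrow> nat" where
  "supp_size A = card {q. \<not> acts_trivially_on q A}"


section \<open>Quantum channels\<close>

text \<open>
  A \<open>k \<times> k\<close> array \<open>A\<close> of operators is an operator on the system together with a \<open>k\<close>-dimensional
  ancilla, and \<open>\<lambda>i j. E (A i j)\<close> is its image under \<open>id \<otimes> E\<close>.
\<close>

definition block_psd :: "nat \<Rightarrow> (nat \<Rightarrow> nat \<Rightarrow> 'a::finite op) \<Rightarrow> bool" where
  "block_psd k A \<longleftrightarrow>
     (\<forall>v :: nat \<Rightarrow> (complex, 'a) vec.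
        (\<Sum>i<k. \<Sum>j<k. \<Sum>a\<in>UNIV. \<Sum>b\<in>UNIV. cnj (v i $ a) * A i j $ a $ b * v j $ b) \<in> \<real>\<^sub>\<ge>\<^sub>0)"

definition completely_positive :: "('a::finite op \<Rightarrow> 'a op) \<Rightarrow> bool" where
  "completely_positive E \<longleftrightarrow> (\<forall>k A. block_psd k A \<longrightarrow> block_psd k (\<lambda>i j. E (A i j)))"

definition quantum_channel :: "('a::finite op \<Rightarrow> 'a op) \<Rightarrow> bool" where
  "quantum_channel E \<longleftrightarrow>
     (\<forall>A B. E (A + B) = E A + E B) \<and> (\<forall>c A. E (cscale c A) = cscale c (E A)) \<and>
     completely_positive E \<and> (\<forall>A. trace (E A) = trace A)"


section \<open>Ensembles of unitaries\<close>

definition pauliX :: "bool op" where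
  "pauliX = (\<chi> i j. if i = j then 0 else 1)"

definition pauliY :: "bool op" where
  "pauliY = (\<chi> i j. if i = j then 0 else if i then \<i> else - \<i>)"

definition pauliZ :: "bool op" where
  "pauliZ = (\<chi> i j. if i \<noteq> j then 0 else if i then -1 else 1)"

text \<open>
  The rotations \<open>(X + Z) / \<surd>2\<close>, \<open>(Y + Z) / \<surd>2\<close> and \<open>\<I>\<close> map the computational basis to the
  eigenbases of \<open>X\<close>, \<open>Y\<close> and \<open>Z\<close>. They are Hermitian, so their inverses do so as well.
\<close>

definition pauli_rotations :: "bool op set" where
  "pauli_rotations = {(1 / sqrt 2) *\<^sub>R (pauliX + pauliZ), (1 / sqrt 2) *\<^sub>R (pauliY + pauliZ), mat 1}"

definition local_pauli_ensemble :: "('q::finite \<Rightarrow> bool) op pmf" where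
  "local_pauli_ensemble =
     map_pmf qubit_tensor (Pi_pmf UNIV undefined (\<lambda>_. pmf_of_set pauli_rotations))"

definition pauli_group :: "('q::finite \<Rightarrow> bool) op set" where
  "pauli_group =
     {cscale c (qubit_tensor s) | c s.
        c \<in> {1, -1, \<i>, - \<i>} \<and> (\<forall>q. s q \<in> {mat 1, pauliX, pauliY, pauliZ})}"

definition clifford :: "('q::finite \<Rightarrow> bool) op \<Rightarrow> bool" where
  "clifford U \<longleftrightarrow> unitary U \<and> (\<lambda>P. U ** P ** cadj U) ` pauli_group = pauli_group"

text \<open>
  Cliffords matter only up to a global phase. Every phase class contains exactly \<open>2 ^ n\<close> unitaries of
  determinant 1, so the uniform distribution on this finite set induces the uniform distribution on
  the Clifford group modulo phases.
\<close>

definition global_clifford_ensemble :: "('q::finite \<Rightarrow> bool) op pmf" where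
  "global_clifford_ensemble = pmf_of_set {U. clifford U \<and> det U = 1}"

datatype ensemble = Local_Pauli | Global_Clifford

fun ensemble_pmf :: "ensemble \<Rightarrow> ('q::finite \<Rightarrow> bool) op pmf" where
  "ensemble_pmf Local_Pauli = local_pauli_ensemble"
| "ensemble_pmf Global_Clifford = global_clifford_ensemble"

definition product_ensemble :: "'a::finite op pmf \<Rightarrow> 'b::finite op pmf \<Rightarrow> ('a \<times> 'b) op pmf" where
  "product_ensemble p r = map_pmf (\<lambda>(U, V). optensor U V) (pair_pmf p r)"


section \<open>Process shadows\<close>

text \<open>Note that \<open>U\<^sup>\<dagger> |b\<rangle>\<langle>b| U\<close> is \<open>ketbra (cadj U *v ket b)\<close>.\<close>

definition measurement_map :: "'a::finite op pmf \<Rightarrow> 'a op \<Rightarrow> 'a op" where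
  "measurement_map p A = measure_pmf.expectation p
     (\<lambda>U. \<Sum>b\<in>UNIV. cscale (trace (ketbra (cadj U *v ket b) ** A)) (ketbra (cadj U *v ket b)))"

definition inverse_measurement_map :: "'a::finite op pmf \<Rightarrow> 'a op \<Rightarrow> 'a op" where
  "inverse_measurement_map p = inv (measurement_map p)"

definition measure_basis :: "'a::finite op \<Rightarrow> 'a pmf" where
  "measure_basis \<sigma> = embed_pmf (\<lambda>b. Re (\<sigma> $ b $ b))"

text \<open>
  The state sent into the channel and the input half of \<open>|z\<rangle>\<close> have to be entrywise complex
  conjugates of each other, because \<open>\<langle>b| E(\<rho>) |b\<rangle> = Tr[(\<rho>\<^sup>T \<otimes> |b\<rangle>\<langle>b|) \<eta>]\<close> for the Choi state \<open>\<eta>\<close>.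
  With \<open>|z\<rangle> = U\<^sub>i\<^sub>n\<^sup>T |b\<^sub>i\<^sub>n\<rangle> \<otimes> U\<^sub>o\<^sub>u\<^sub>t\<^sup>\<dagger> |b\<^sub>o\<^sub>u\<^sub>t\<rangle>\<close> the prepared state is therefore \<open>U\<^sub>i\<^sub>n\<^sup>\<dagger> |b\<^sub>i\<^sub>n\<rangle>\<close>. Both ensembles are
  invariant under \<open>U \<mapsto> U\<^sup>\<dagger>\<close>, so the unitary applied to \<open>|b\<^sub>i\<^sub>n\<rangle>\<close> is itself a sample from the input
  ensemble.
\<close>

definition process_shadow ::
    "ensemble \<Rightarrow> ensemble \<Rightarrow> (('q::finite \<Rightarrow> bool) op \<Rightarrow> ('q \<Rightarrow> bool) op)
      \<Rightarrow> (('q \<Rightarrow> bool) \<times> ('q \<Rightarrow> bool)) op pmf" where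
  "process_shadow ein eout E =
     do {
       b_in \<leftarrow> pmf_of_set UNIV;
       U_in \<leftarrow> ensemble_pmf ein;
       U_out \<leftarrow> ensemble_pmf eout;
       b_out \<leftarrow> measure_basis (U_out ** E (ketbra (cadj U_in *v ket b_in)) ** cadj U_out);
       return_pmf
         (inverse_measurement_map (product_ensemble (ensemble_pmf ein) (ensemble_pmf eout))
           (ketbra (vtensor (transpose U_in *v ket b_in) (cadj U_out *v ket b_out))))
     }"

definition process_shadows ::
    "nat \<Rightarrow> ensemble \<Rightarrow> ensemble \<Rightarrow> (('q::finite \<Rightarrow> bool) op \<Rightarrow> ('q \<Rightarrow> bool) op)
      \<Rightarrow> (nat \<Rightarrow> (('q \<Rightarrow> bool) \<times> ('q \<Rightarrow> bool)) op) pmf" where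
  "process_shadows m ein eout E = Pi_pmf {..<m} undefined (\<lambda>_. process_shadow ein eout E)"


section \<open>Median of means\<close>

text \<open>
  A shadow has trace 1 and expectation \<open>\<eta> / 2 ^ n\<close>, whereas \<open>\<eta>\<close> has trace \<open>2 ^ n\<close>: hence the factor
  \<open>2 ^ n\<close> below. For Hermitian \<open>\<rho>\<close> and \<open>O\<close> the trace is real, and taking \<open>Re\<close> is a mere coercion.
\<close>

definition single_shot_estimate ::
    "('q::finite \<Rightarrow> bool) op \<Rightarrow> ('q \<Rightarrow> bool) op \<Rightarrow> (('q \<Rightarrow> bool) \<times> ('q \<Rightarrow> bool)) op \<Rightarrow> real" where
  "single_shot_estimate \<rho> Ob \<zeta> =
     2 ^ CARD('q) * Re (trace (\<zeta> ** optensor (transpose \<rho>) Ob))"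

definition median :: "real list \<Rightarrow> real" where
  "median xs =
     (let s = sort xs; k = length xs
      in if odd k then s ! (k div 2) else (s ! (k div 2 - 1) + s ! (k div 2)) / 2)"

definition median_of_means :: "nat \<Rightarrow> nat \<Rightarrow> (nat \<Rightarrow> real) \<Rightarrow> real" where
  "median_of_means N K x = median (map (\<lambda>k. (\<Sum>i\<in>{k * N..<(k + 1) * N}. x i) / real N) [0..<K])"


section \<open>Sample complexity\<close>

definition clifford_S :: "'a::finite op \<Rightarrow> 'a op" where
  "clifford_S A = cscale 2
     (cscale (2 * (trace A)\<^sup>2 + trace (A ** A)) (mat 1) + cscale (2 * trace A) A + cscale 2 (A ** A))"

fun shadow_weight :: "ensemble \<Rightarrow> ('q::finite \<Rightarrow> bool) op \<Rightarrow> real" where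
  "shadow_weight Local_Pauli A = 4 ^ supp_size A * (opnorm A)\<^sup>2"
| "shadow_weight Global_Clifford A = opnorm (clifford_S A)"

end

theory Submission
  imports Defs
begin

text \<open>
  For a Hermitian pair \<open>\<rho>\<close>, \<open>Ob\<close> the single-shot estimator factors into an input and an output part,
  so its second moment is at most \<open>4 ^ n\<close> times the product of the two state-shadow second moments;
  Chebyshev's inequality on each batch and an exponential moment bound over the batches then give the
  claim.

  Both measurement maps are diagonal in the Pauli basis with nonzero eigenvalues, which makes the
  inverse maps self-adjoint and explicit. For local Paulis the second moment is bounded by
  Cauchy--Schwarz for each choice of measurement axes. For Cliffords, the third moment of a random
  stabilizer state is a symmetric trilinear form invariant under the Clifford group. Evaluated on Pauli
  operators, such a form vanishes unless its arguments commute and multiply to a phase; by conjugation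
  with \<open>(P + Q) / \<surd>2\<close> for anticommuting \<open>P\<close> and \<open>Q\<close> it depends only on how many of its arguments
  are trivial. Hence three normalization values determine it.
\<close>

section \<open>Operator algebra\<close>

text \<open>The third moment is found without enumerating stabilizer states: each of the three test
  sums is constant on pure states of trace 1, so it is evaluated before averaging. Applied to the
  difference between the Clifford moment and the expected formula, uniqueness of the form becomes
  vanishing. One qubit is covered too, although there no two distinct nontrivial Pauli operators
  commute. The factor \<open>4 ^ n\<close> is the square of the rescaling of the estimator. The
  uniform input bit string has the outcome distribution of the maximally mixed state, so the input
  side is the same second-moment problem as the output side, with that state in place of the channel
  output. The constant 34 makes a batch fail with probability at most 1/34. If every failing batch
  gets weight 36, the product of the weights has mean at most \<open>(69/34) ^ K\<close>, and it is
  at least \<open>6 ^ K\<close> whenever the median fails; the quotient \<open>(23/68) ^ K\<close>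
  is at most \<open>exp (- K / 2)\<close>.\<close>

lemma cscale_nth [simp]: "cscale c A $ i $ j = c * A $ i $ j"
  by (simp add: cscale_def)

lemma cadj_nth [simp]: "cadj A $ i $ j = cnj (A $ j $ i)"
  by (simp add: cadj_def)

lemma ketbra_nth [simp]: "ketbra v $ i $ j = v $ i * cnj (v $ j)"
  by (simp add: ketbra_def)

lemma optensor_nth [simp]: "optensor A B $ p $ r = A $ fst p $ fst r * B $ snd p $ snd r"
  by (simp add: optensor_def)

lemma qubit_tensor_nth [simp]: "qubit_tensor s $ a $ b = (\<Prod>q\<in>UNIV. s q $ a q $ b q)"
  by (simp add: qubit_tensor_def)

lemma mult_nth: "(A ** B) $ i $ j = (\<Sum>k\<in>UNIV. A $ i $ k * B $ k $ j)"
  by (simp add: matrix_matrix_mult_def)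

lemma cscale_mult_left [simp]: "cscale c A ** B = cscale c (A ** B)"
  by (simp add: vec_eq_iff mult_nth sum_distrib_left mult.assoc)

lemma cscale_mult_right [simp]: "A ** cscale c B = cscale c (A ** B)"
  by (simp add: vec_eq_iff mult_nth sum_distrib_left mult.left_commute)

lemma cscale_cscale [simp]: "cscale c (cscale k A) = cscale (c * k) A"
  by (simp add: vec_eq_iff)

lemma cscale_1 [simp]: "cscale 1 A = A"
  by (simp add: vec_eq_iff)

lemma cscale_0 [simp]: "cscale 0 A = 0"
  by (simp add: vec_eq_iff)

lemma cscale_add: "cscale c (A + B) = cscale c A + cscale c B"
  by (simp add: vec_eq_iff algebra_simps)

lemma sum_op_nth: "(\<Sum>x\<in>X. f x) $ i $ j = (\<Sum>x\<in>X. (f x :: 'a::finite op) $ i $ j)"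
  by (simp add: sum_component)

lemma cscale_sum: "cscale c (\<Sum>x\<in>X. f x) = (\<Sum>x\<in>X. cscale c (f x))"
  by (simp add: vec_eq_iff sum_distrib_left)

lemma cscale_sum_left: "cscale (\<Sum>x\<in>X. f x) A = (\<Sum>x\<in>X. cscale (f x) A)"
  by (simp add: vec_eq_iff sum_distrib_right)

lemma scaleR_eq_cscale: "r *\<^sub>R A = cscale (of_real r) A"
  by (simp add: vec_eq_iff) (simp add: scaleR_conv_of_real)

lemma trace_cscale [simp]: "trace (cscale c A) = c * trace A"
  by (simp add: trace_def sum_distrib_left)

lemma trace_sum: "trace (\<Sum>x\<in>X. f x) = (\<Sum>x\<in>X. trace (f x :: 'a::finite op))"
  unfolding trace_def sum_op_nth by (rule sum.swap)

lemma mult_sum_left: "(\<Sum>x\<in>X. f x) ** B = (\<Sum>x\<in>X. (f x :: 'a::finite op) ** B)"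
  by (simp add: vec_eq_iff mult_nth sum_distrib_right) (auto intro: sum.swap)

lemma matrix_add_rdistrib: "(A + B) ** C = A ** C + B ** (C :: 'a::finite op)"
  by (simp add: vec_eq_iff mult_nth distrib_right sum.distrib)

lemma trace_mult: "trace (A ** B) = (\<Sum>i\<in>UNIV. \<Sum>j\<in>UNIV. A $ i $ j * (B :: 'a::finite op) $ j $ i)"
  by (simp add: trace_def mult_nth)

lemma trace_mult_cycle: "trace (A ** B ** C) = trace (B ** C ** (A :: 'a::finite op))"
  by (simp only: trace_mul_sym[of A "B ** C"] matrix_mul_assoc[symmetric])

lemma cadj_mult: "cadj (A ** B) = cadj B ** cadj A"
  by (simp add: vec_eq_iff mult_nth mult.commute)

lemma cadj_cadj [simp]: "cadj (cadj A) = A"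
  by (simp add: vec_eq_iff)

lemma cadj_cscale: "cadj (cscale c A) = cscale (cnj c) (cadj A)"
  by (simp add: vec_eq_iff)

lemma cadj_add: "cadj (A + B) = cadj A + cadj B"
  by (simp add: vec_eq_iff)

lemma cadj_mat1 [simp]: "cadj (mat 1) = mat 1"
  by (simp add: vec_eq_iff mat_def)

lemma trace_cadj: "trace (cadj A) = cnj (trace A)"
  by (simp add: trace_def)

lemma hermitian_trace_mult_real:
  assumes "hermitian A" "hermitian B"
  shows "trace (A ** B) \<in> \<real>"
proof -
  have "cnj (trace (A ** B)) = trace (B ** A)"
    using assms by (simp flip: trace_cadj add: cadj_mult hermitian_def)
  then show ?thesis by (simp add: trace_mul_sym[of B A] Reals_cnj_iff)
qed

lemma hermitian_trace_real: "hermitian A \<Longrightarrow> trace A \<in> \<real>"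
  by (metis Reals_cnj_iff hermitian_def trace_cadj)

lemma hermitian_ketbra: "hermitian (ketbra v)"
  by (simp add: hermitian_def vec_eq_iff mult.commute)

section \<open>Matrix units and projectors onto measured states\<close>

definition unit_op :: "'a::finite \<Rightarrow> 'a \<Rightarrow> 'a op" where
  "unit_op i j = (\<chi> k l. if k = i \<and> l = j then 1 else 0)"

lemma trace_mult_unit_op: "trace (A ** unit_op i j) = A $ j $ i"
proof -
  have "trace (A ** unit_op i j)
      = (\<Sum>p\<in>UNIV. \<Sum>q\<in>UNIV. if p = j then if q = i then A $ p $ q else 0 else 0)"
    unfolding trace_mult unit_op_def by (intro sum.cong) auto
  also have "\<dots> = (\<Sum>p\<in>UNIV. if p = j then \<Sum>q\<in>UNIV. if q = i then A $ p $ q else 0 else 0)"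
    by (intro sum.cong) auto
  finally show ?thesis by simp
qed

text \<open>Nondegeneracy of the trace pairing: testing against matrix units reads off the entries.
  It allows identities of operators to be checked through scalar averages.\<close>

lemma op_eq_if_trace_eq:
  fixes A B :: "'a::finite op"
  assumes "\<And>C. trace (A ** C) = trace (B ** C)"
  shows "A = B"
  using assms[of "unit_op _ _"] by (simp add: trace_mult_unit_op vec_eq_iff)

lemma ketbra_mult_ketbra:
  assumes "trace (ketbra v) = 1"
  shows "ketbra v ** ketbra v = ketbra v"
proof -
  have "(\<Sum>k\<in>UNIV. v $ i * cnj (v $ k) * (v $ k * cnj (v $ j)))
      = v $ i * cnj (v $ j) * (\<Sum>k\<in>UNIV. v $ k * cnj (v $ k))" for i j
    by (simp add: sum_distrib_left mult_ac)
  then show ?thesis using assms by (simp add: vec_eq_iff mult_nth trace_def)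
qed

lemma ketbra_ket_nth: "ketbra (ket b) $ i $ j = (if i = b \<and> j = b then 1 else 0)"
  by (simp add: ket_def axis_def)

lemma cadj_ket_nth: "(cadj U *v ket b) $ i = cnj (U $ b $ i)"
proof -
  have "(cadj U *v ket b) $ i = (\<Sum>k\<in>UNIV. if b = k then cnj (U $ k $ i) else 0)"
    by (simp add: matrix_vector_mult_def ket_def axis_def if_distrib[of "(*) _"] cong: if_cong)
  then show ?thesis by simp
qed

lemma sum_delta2:
  fixes f :: "'a::finite \<Rightarrow> 'b::finite \<Rightarrow> 'c::comm_monoid_add"
  shows "(\<Sum>p\<in>UNIV. \<Sum>q\<in>UNIV. if i = p \<and> j = q then f p q else 0) = f i j"
proof -
  have "(\<Sum>p\<in>UNIV. \<Sum>q\<in>UNIV. if i = p \<and> j = q then f p q else 0)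
      = (\<Sum>p\<in>UNIV. if i = p then (\<Sum>q\<in>UNIV. if j = q then f p q else 0) else 0)"
    by (intro sum.cong) auto
  then show ?thesis by simp
qed

text \<open>As a conjugate of a basis projector, the state becomes accessible to cyclicity of the
  trace.\<close>

lemma ketbra_cadj_ket:
  "ketbra (cadj U *v ket b) = cadj U ** ketbra (ket b) ** U"
proof -
  have "(cadj U ** ketbra (ket b) ** U) $ i $ j = cnj (U $ b $ i) * U $ b $ j" for i j
  proof -
    have "(cadj U ** ketbra (ket b) ** U) $ i $ j
        = (\<Sum>k\<in>UNIV. \<Sum>l\<in>UNIV. if b = k \<and> b = l then cnj (U $ l $ i) * U $ k $ j else 0)"
      unfolding mult_nth sum_distrib_right
      by (intro sum.cong) (auto simp: ketbra_ket_nth simp del: ketbra_nth)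
    then show ?thesis by (simp add: sum_delta2)
  qed
  then show ?thesis by (simp add: vec_eq_iff cadj_ket_nth)
qed

lemma trace_ketbra_ket [simp]: "trace (ketbra (ket b)) = 1"
  by (simp add: trace_def ketbra_ket_nth del: ketbra_nth)

lemma trace_ketbra_unitary:
  assumes "unitary U"
  shows "trace (ketbra (cadj U *v ket b)) = 1"
proof -
  have "trace (ketbra (cadj U *v ket b)) = trace (U ** cadj U ** ketbra (ket b))"
    unfolding ketbra_cadj_ket
    by (simp only: trace_mult_cycle[of "cadj U" "ketbra (ket b)" U] trace_mult_cycle[of "ketbra (ket b)"])
  then show ?thesis using assms by (simp add: unitary_def)
qed

lemma trace_ketbra_ket_mult: "trace (ketbra (ket b) ** A) = A $ b $ b"
proof -
  have "trace (ketbra (ket b) ** A)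
      = (\<Sum>i\<in>UNIV. \<Sum>j\<in>UNIV. if b = i \<and> b = j then A $ j $ i else 0)"
    unfolding trace_mult by (intro sum.cong) (auto simp: ketbra_ket_nth simp del: ketbra_nth)
  then show ?thesis by (simp add: sum_delta2)
qed

text \<open>The Born rule: the trace against the state of outcome \<open>b\<close> is the diagonal
  entry from which \<open>measure_basis\<close> takes its probability.\<close>

lemma trace_ketbra_cadj_ket:
  "trace (ketbra (cadj U *v ket b) ** A) = (U ** A ** cadj U) $ b $ b"
  unfolding ketbra_cadj_ket trace_ketbra_ket_mult[symmetric]
  using trace_mult_cycle[of "cadj U" "ketbra (ket b)" "U ** A"] by (simp only: matrix_mul_assoc)

section \<open>Pauli operators\<close>

text \<open>Binary symplectic encoding: the first bit marks an X factor, the second a Z factor, and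
  both together mean Y. Phases are forgotten, so multiplication becomes addition modulo 2, which is
  \<open>xor1\<close> on one qubit and \<open>pxor\<close> on all.\<close>

type_synonym 'q pauli = "'q \<Rightarrow> bool \<times> bool"

definition pauli1 :: "bool \<times> bool \<Rightarrow> bool op" where
  "pauli1 a = (if fst a then if snd a then pauliY else pauliX else if snd a then pauliZ else mat 1)"

definition xor1 :: "bool \<times> bool \<Rightarrow> bool \<times> bool \<Rightarrow> bool \<times> bool" where
  "xor1 a b = (fst a \<noteq> fst b, snd a \<noteq> snd b)"

text \<open>The exponent of the sign is the symplectic form: the parity of the two cross products of
  an X bit with a Z bit.\<close>

definition sgn1 :: "bool \<times> bool \<Rightarrow> bool \<times> bool \<Rightarrow> complex" where
  "sgn1 a b = (if (fst a \<and> snd b) = (snd a \<and> fst b) then 1 else -1)"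

definition pauli :: "'q::finite pauli \<Rightarrow> ('q \<Rightarrow> bool) op" where
  "pauli u = qubit_tensor (\<lambda>q. pauli1 (u q))"

definition pxor :: "'q pauli \<Rightarrow> 'q pauli \<Rightarrow> 'q pauli" where
  "pxor u v = (\<lambda>q. xor1 (u q) (v q))"

definition pid :: "'q pauli" where
  "pid = (\<lambda>q. (False, False))"

text \<open>\<open>pcomm u v\<close> is \<open>1\<close> if the Pauli operators commute and \<open>-1\<close> if they anticommute.\<close>

definition pcomm :: "'q::finite pauli \<Rightarrow> 'q pauli \<Rightarrow> complex" where
  "pcomm u v = (\<Prod>q\<in>UNIV. sgn1 (u q) (v q))"

abbreviation phases :: "complex set" where
  "phases \<equiv> {1, -1, \<i>, - \<i>}"

section \<open>Pauli matrices of a single qubit\<close>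

lemma UNIV_bool2: "(UNIV :: (bool \<times> bool) set)
    = {(False, False), (False, True), (True, False), (True, True)}"
  by (auto simp: UNIV_bool)

lemma all_bool2: "(\<forall>a. P a) \<longleftrightarrow> P (False, False) \<and> P (False, True) \<and> P (True, False) \<and> P (True, True)"
  by (metis (full_types) surj_pair)

lemma pauli1_simps [simp]:
  "pauli1 (False, False) = mat 1" "pauli1 (False, True) = pauliZ"
  "pauli1 (True, False) = pauliX" "pauli1 (True, True) = pauliY"
  by (simp_all add: pauli1_def)

lemmas pauli_entries = pauliX_def pauliY_def pauliZ_def mat_def

lemma pauli1_mult: "\<exists>c\<in>phases. pauli1 a ** pauli1 b = cscale c (pauli1 (xor1 a b))"
proof -
  have "\<forall>a b. \<exists>c\<in>phases. pauli1 a ** pauli1 b = cscale c (pauli1 (xor1 a b))"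
    by (simp add: all_bool2 xor1_def vec_eq_iff mult_nth UNIV_bool pauli_entries all_bool_eq)
  then show ?thesis by blast
qed

lemma pauli1_commute: "pauli1 a ** pauli1 b = cscale (sgn1 a b) (pauli1 b ** pauli1 a)"
proof -
  have "\<forall>a b. pauli1 a ** pauli1 b = cscale (sgn1 a b) (pauli1 b ** pauli1 a)"
    by (simp add: all_bool2 sgn1_def vec_eq_iff mult_nth UNIV_bool pauli_entries all_bool_eq)
  then show ?thesis by blast
qed

lemma pauli1_square: "pauli1 a ** pauli1 a = mat 1"
proof -
  have "\<forall>a. pauli1 a ** pauli1 a = mat 1"
    by (simp add: all_bool2 vec_eq_iff mult_nth UNIV_bool pauli_entries all_bool_eq)
  then show ?thesis by blast
qed

lemma pauli1_hermitian: "cadj (pauli1 a) = pauli1 a"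
proof -
  have "\<forall>a. cadj (pauli1 a) = pauli1 a"
    by (simp add: all_bool2 vec_eq_iff UNIV_bool pauli_entries all_bool_eq)
  then show ?thesis by blast
qed

text \<open>In tensor notation: the sum of P tensor P over the four Pauli matrices is twice the
  swap.\<close>

lemma pauli1_complete:
  "(\<Sum>a\<in>UNIV. pauli1 a $ i $ j * pauli1 a $ k $ l) = (if i = l \<and> j = k then 2 else 0)"
  unfolding UNIV_bool2 by (cases i; cases j; cases k; cases l) (simp_all add: pauli_entries)

lemma sgn1_sum: "(\<Sum>a\<in>UNIV. sgn1 b a) = (if b = (False, False) then 4 else 0)"
  unfolding UNIV_bool2 by (cases b) (auto simp: sgn1_def)

lemma sgn1_xor: "sgn1 (xor1 a b) c = sgn1 a c * sgn1 b c"
  by (auto simp: sgn1_def xor1_def)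

section \<open>Tensor products over the qubits\<close>

lemma qubit_tensor_mult:
  "qubit_tensor s ** qubit_tensor t = qubit_tensor (\<lambda>q. s q ** t q)"
proof -
  have "(\<Sum>k\<in>UNIV. (\<Prod>q\<in>UNIV. s q $ a q $ k q) * (\<Prod>q\<in>UNIV. t q $ k q $ b q))
      = (\<Prod>q\<in>UNIV. \<Sum>k\<in>UNIV. s q $ a q $ k * t q $ k $ b q)" for a b :: "'a \<Rightarrow> bool"
    using prod_sum_PiE[of UNIV "\<lambda>_. UNIV :: bool set" "\<lambda>q k. s q $ a q $ k * t q $ k $ b q"]
    by (simp add: prod.distrib)
  then show ?thesis by (simp add: vec_eq_iff mult_nth)
qed

text \<open>Distributivity over all qubits at once. It reduces sums over Pauli labels or bit strings
  to one-qubit sums.\<close>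

lemma prod_sum_UNIV:
  fixes f :: "'q::finite \<Rightarrow> 'a::finite \<Rightarrow> 'b::comm_semiring_1"
  shows "(\<Sum>u\<in>UNIV. \<Prod>q\<in>UNIV. f q (u q)) = (\<Prod>q\<in>UNIV. \<Sum>a\<in>UNIV. f q a)"
  using prod_sum_PiE[of UNIV "\<lambda>_. UNIV" f] by simp

lemma qubit_tensor_cscale:
  "qubit_tensor (\<lambda>q. cscale (c q) (s q)) = cscale (\<Prod>q\<in>UNIV. c q) (qubit_tensor s)"
  by (simp add: vec_eq_iff prod.distrib)

lemma qubit_tensor_mat1: "qubit_tensor (\<lambda>q. mat 1) = mat 1"
proof -
  have "(\<Prod>q\<in>UNIV. if a q = b q then 1 else 0) = (if a = b then 1 else (0::complex))"
    for a b :: "'a \<Rightarrow> bool"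
    by (auto simp: fun_eq_iff)
  then show ?thesis by (simp add: vec_eq_iff mat_def)
qed

lemma cadj_qubit_tensor: "cadj (qubit_tensor s) = qubit_tensor (\<lambda>q. cadj (s q))"
  by (simp add: vec_eq_iff)

lemma trace_qubit_tensor: "trace (qubit_tensor s) = (\<Prod>q\<in>UNIV. trace (s q))"
  unfolding trace_def qubit_tensor_nth by (rule prod_sum_UNIV[where f = "\<lambda>q a. s q $ a $ a"])

lemma phases_mult: "a \<in> phases \<Longrightarrow> b \<in> phases \<Longrightarrow> a * b \<in> phases"
  by auto

lemma phases_prod: "(\<And>q. q \<in> Q \<Longrightarrow> c q \<in> phases) \<Longrightarrow> (\<Prod>q\<in>Q. c q) \<in> phases"
proof (induction Q rule: infinite_finite_induct)
  case (insert x F)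
  then show ?case using phases_mult[of "c x" "prod c F"] by simp
qed auto

lemma pauli_mult: "\<exists>c\<in>phases. pauli u ** pauli v = cscale c (pauli (pxor u v))"
proof -
  obtain c where c: "\<And>q. c q \<in> phases"
      "\<And>q. pauli1 (u q) ** pauli1 (v q) = cscale (c q) (pauli1 (xor1 (u q) (v q)))"
  proof -
    have "\<forall>q. \<exists>c. c \<in> phases \<and> pauli1 (u q) ** pauli1 (v q) = cscale c (pauli1 (xor1 (u q) (v q)))"
      using pauli1_mult by blast
    from choice[OF this] show ?thesis using that by blast
  qed
  have "pauli u ** pauli v = cscale (\<Prod>q\<in>UNIV. c q) (pauli (pxor u v))"
    unfolding pauli_def qubit_tensor_mult c qubit_tensor_cscale pxor_def ..
  moreover have "(\<Prod>q\<in>UNIV. c q) \<in> phases" using c by (intro phases_prod)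
  ultimately show ?thesis by blast
qed

lemma pauli_commute: "pauli u ** pauli v = cscale (pcomm u v) (pauli v ** pauli u)"
proof -
  have "(\<lambda>q. pauli1 (u q) ** pauli1 (v q))
      = (\<lambda>q. cscale (sgn1 (u q) (v q)) (pauli1 (v q) ** pauli1 (u q)))"
    by (intro ext pauli1_commute)
  then show ?thesis
    unfolding pauli_def qubit_tensor_mult pcomm_def by (simp only: qubit_tensor_cscale)
qed

lemma pauli_square [simp]: "pauli u ** pauli u = mat 1"
  unfolding pauli_def qubit_tensor_mult pauli1_square qubit_tensor_mat1 ..

lemma cadj_pauli [simp]: "cadj (pauli u) = pauli u"
  unfolding pauli_def cadj_qubit_tensor pauli1_hermitian ..

lemma pauli_pid [simp]: "pauli pid = mat 1"
  by (simp add: pauli_def pid_def qubit_tensor_mat1)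

lemma hermitian_pauli: "hermitian (pauli u)"
  by (simp add: hermitian_def)

lemma pcomm_cases: "pcomm u v = 1 \<or> pcomm u v = -1"
proof -
  have "(\<Prod>q\<in>Q. sgn1 (u q) (v q)) \<in> {1, -1}" if "finite Q" for Q
    using that by induction (auto simp: sgn1_def)
  from this[of UNIV] show ?thesis by (auto simp: pcomm_def)
qed

lemma pcomm_sym: "pcomm u v = pcomm v u"
  unfolding pcomm_def by (intro prod.cong) (auto simp: sgn1_def)

lemma pcomm_xor: "pcomm (pxor u v) w = pcomm u w * pcomm v w"
  by (simp add: pcomm_def pxor_def sgn1_xor prod.distrib)

lemma pcomm_pid [simp]: "pcomm pid u = 1" "pcomm u pid = 1"
  by (auto simp: pcomm_def pid_def sgn1_def)

lemma pcomm_self [simp]: "pcomm u u = 1"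
  by (auto simp: pcomm_def sgn1_def intro!: prod.neutral)

lemma pxor_eq_pid_iff [simp]: "pxor u v = pid \<longleftrightarrow> u = v"
  by (auto simp: pxor_def pid_def xor1_def fun_eq_iff prod_eq_iff)

lemma pxor_eq_left_iff [simp]: "pxor u v = u \<longleftrightarrow> v = pid" "pxor v u = u \<longleftrightarrow> v = pid"
  by (auto simp: pxor_def pid_def xor1_def fun_eq_iff prod_eq_iff)

lemma pxor_pid [simp]: "pxor u pid = u" "pxor pid u = u"
  by (auto simp: pxor_def pid_def xor1_def fun_eq_iff prod_eq_iff)

text \<open>Orthogonality of characters: \<open>pcomm u\<close> is a character of the group of
  labels under \<open>pxor\<close>, trivial only for \<open>pid\<close>.\<close>

lemma pcomm_sum:
  "(\<Sum>r\<in>UNIV. pcomm (u :: 'q::finite pauli) r) = (if u = pid then 4 ^ CARD('q) else 0)"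
proof -
  have "(\<Sum>r\<in>UNIV. pcomm u r) = (\<Prod>q\<in>UNIV. if u q = (False, False) then 4 else 0)"
    unfolding pcomm_def by (subst prod_sum_UNIV) (simp add: sgn1_sum)
  also have "\<dots> = (if u = pid then 4 ^ CARD('q) else 0)"
    by (auto simp: pid_def fun_eq_iff)
  finally show ?thesis .
qed

text \<open>The swap identity, multiplied over the qubits. Contracting both indices of one factor
  with an operator gives the Pauli expansion; contracting one index of each factor gives the Pauli
  twirl.\<close>

lemma pauli_complete:
  "(\<Sum>u\<in>UNIV. pauli u $ i $ j * pauli u $ k $ l)
    = (if i = l \<and> j = k then 2 ^ CARD('q) else (0::complex))" for i :: "'q::finite \<Rightarrow> bool"
proof -
  have "(\<Sum>u\<in>UNIV. pauli u $ i $ j * pauli u $ k $ l)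
      = (\<Prod>q\<in>UNIV. if i q = l q \<and> j q = k q then 2 else 0)"
    unfolding pauli_def qubit_tensor_nth prod.distrib[symmetric]
    by (subst prod_sum_UNIV[where f = "\<lambda>q a. pauli1 a $ i q $ j q * pauli1 a $ k q $ l q"])
      (simp add: pauli1_complete)
  also have "\<dots> = (if i = l \<and> j = k then 2 ^ CARD('q) else 0)"
    by (auto simp: fun_eq_iff)
  finally show ?thesis .
qed

lemma sum_swap3:
  "(\<Sum>u\<in>X. \<Sum>p\<in>Y. \<Sum>q\<in>Z. f u p q) = (\<Sum>p\<in>Y. \<Sum>q\<in>Z. \<Sum>u\<in>X. f u p q)"
proof -
  have "(\<Sum>u\<in>X. \<Sum>p\<in>Y. \<Sum>q\<in>Z. f u p q) = (\<Sum>p\<in>Y. \<Sum>u\<in>X. \<Sum>q\<in>Z. f u p q)"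
    by (rule sum.swap)
  also have "\<dots> = (\<Sum>p\<in>Y. \<Sum>q\<in>Z. \<Sum>u\<in>X. f u p q)"
    by (rule sum.cong[OF refl], rule sum.swap)
  finally show ?thesis .
qed

lemma pauli_expansion:
  "(\<Sum>u\<in>UNIV. cscale (trace (pauli u ** A)) (pauli u)) = cscale (2 ^ CARD('q)) A"
  for A :: "('q::finite \<Rightarrow> bool) op"
proof -
  have "(\<Sum>u\<in>UNIV. trace (pauli u ** A) * pauli u $ i $ j) = 2 ^ CARD('q) * A $ i $ j" for i j
  proof -
    have "(\<Sum>u\<in>UNIV. trace (pauli u ** A) * pauli u $ i $ j)
        = (\<Sum>u\<in>UNIV. \<Sum>p\<in>UNIV. \<Sum>q\<in>UNIV. A $ q $ p * (pauli u $ p $ q * pauli u $ i $ j))"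
      unfolding trace_mult sum_distrib_right by (simp only: mult_ac)
    also have "\<dots> = (\<Sum>p\<in>UNIV. \<Sum>q\<in>UNIV. \<Sum>u\<in>UNIV. A $ q $ p * (pauli u $ p $ q * pauli u $ i $ j))"
      by (rule sum_swap3)
    also have "\<dots> = (\<Sum>p\<in>UNIV. \<Sum>q\<in>UNIV. if j = p \<and> i = q then 2 ^ CARD('q) * A $ q $ p else 0)"
      unfolding sum_distrib_left[symmetric] pauli_complete by (intro sum.cong) auto
    also have "\<dots> = 2 ^ CARD('q) * A $ i $ j" by (rule sum_delta2)
    finally show ?thesis .
  qed
  then show ?thesis by (simp add: vec_eq_iff)
qed

lemma pauli_twirl:
  "(\<Sum>u\<in>UNIV. pauli u ** A ** pauli u) = cscale (2 ^ CARD('q) * trace A) (mat 1)"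
  for A :: "('q::finite \<Rightarrow> bool) op"
proof -
  have "(\<Sum>u\<in>UNIV. (pauli u ** A ** pauli u) $ i $ j)
      = 2 ^ CARD('q) * trace A * (mat 1 :: ('q \<Rightarrow> bool) op) $ i $ j" for i j
  proof -
    have "(\<Sum>u\<in>UNIV. (pauli u ** A ** pauli u) $ i $ j)
        = (\<Sum>u\<in>UNIV. \<Sum>q\<in>UNIV. \<Sum>p\<in>UNIV. A $ p $ q * (pauli u $ i $ p * pauli u $ q $ j))"
      unfolding mult_nth sum_distrib_right by (simp only: mult_ac)
    also have "\<dots> = (\<Sum>q\<in>UNIV. \<Sum>p\<in>UNIV. \<Sum>u\<in>UNIV. A $ p $ q * (pauli u $ i $ p * pauli u $ q $ j))"
      by (rule sum_swap3)
    also have "\<dots> = (\<Sum>q\<in>UNIV. \<Sum>p\<in>UNIV. if i = j \<and> p = q then 2 ^ CARD('q) * A $ p $ q else 0)"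
      unfolding sum_distrib_left[symmetric] pauli_complete by (intro sum.cong) auto
    also have "\<dots> = 2 ^ CARD('q) * trace A * (mat 1 :: ('q \<Rightarrow> bool) op) $ i $ j"
      by (auto simp: trace_def mat_def sum_distrib_left)
    finally show ?thesis .
  qed
  then show ?thesis by (simp add: vec_eq_iff)
qed

lemma trace_pauli_expansion:
  "(\<Sum>u\<in>UNIV. trace (pauli u ** A) * trace (pauli u ** B)) = 2 ^ CARD('q) * trace (A ** B)"
  for A :: "('q::finite \<Rightarrow> bool) op"
proof -
  have "(\<Sum>u\<in>UNIV. trace (pauli u ** A) * trace (pauli u ** B))
      = trace ((\<Sum>u\<in>UNIV. cscale (trace (pauli u ** A)) (pauli u)) ** B)"
    by (simp add: mult_sum_left trace_sum)
  then show ?thesis by (simp add: pauli_expansion)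
qed

text \<open>Only Y is antisymmetric, so the sign is the parity of the number of Y factors. It is
  left open because it will occur twice in a product.\<close>

lemma transpose_pauli: "transpose (pauli u) = pauli u \<or> transpose (pauli u) = cscale (-1) (pauli u)"
proof -
  have 1: "\<forall>a. transpose (pauli1 a) = cscale (if fst a \<and> snd a then -1 else 1) (pauli1 a)"
    by (simp add: all_bool2 transpose_def vec_eq_iff pauli_entries all_bool_eq)
  have "transpose (pauli u) = qubit_tensor (\<lambda>q. transpose (pauli1 (u q)))"
    by (simp add: pauli_def transpose_def vec_eq_iff)
  then have 2: "transpose (pauli u) = cscale (\<Prod>q\<in>UNIV. if fst (u q) \<and> snd (u q) then -1 else 1) (pauli u)"
    by (simp add: 1 qubit_tensor_cscale pauli_def)
  have "(\<Prod>q\<in>Q. if fst (u q) \<and> snd (u q) then -1 else 1) \<in> {1, -1 :: complex}" if "finite Q" for Q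
    using that by induction auto
  from this[of UNIV] 2 show ?thesis by auto
qed

lemma pauli_group_eq:
  "pauli_group = {cscale c (pauli (u :: 'q::finite pauli)) | c u. c \<in> phases}"
proof -
  have *: "\<exists>u. qubit_tensor s = pauli u" if "\<forall>q. s q \<in> {mat 1, pauliX, pauliY, pauliZ}" for s :: "'q \<Rightarrow> bool op"
  proof -
    have "\<exists>a. s q = pauli1 a" for q
      using that pauli1_simps by (metis empty_iff insert_iff)
    then obtain u where "\<And>q. s q = pauli1 (u q)" by metis
    then have "s = (\<lambda>q. pauli1 (u q))" by auto
    then show ?thesis by (auto simp: pauli_def)
  qed
  have sub: "pauli_group \<subseteq> {cscale c (pauli (u :: 'q pauli)) | c u. c \<in> phases}"
  proof (intro subsetI)
    fix P :: "('q \<Rightarrow> bool) op" assume "P \<in> pauli_group"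
    then obtain c s where "P = cscale c (qubit_tensor s)" "c \<in> phases"
        "\<forall>q. s q \<in> {mat 1, pauliX, pauliY, pauliZ}"
      unfolding pauli_group_def by blast
    moreover obtain u where "qubit_tensor s = pauli u" using * calculation(3) by blast
    ultimately show "P \<in> {cscale c (pauli u) | c u. c \<in> phases}" by auto
  qed
  have "\<forall>q. pauli1 (u q) \<in> {mat 1, pauliX, pauliY, pauliZ}" for u :: "'q pauli"
    by (simp add: pauli1_def)
  then have "{cscale c (pauli (u :: 'q pauli)) | c u. c \<in> phases} \<subseteq> pauli_group"
    unfolding pauli_group_def pauli_def by blast
  with sub show ?thesis by blast
qed

section \<open>Averages over an ensemble and a measured bit string\<close>

text \<open>Bit strings are summed, not averaged, so the total mass is the dimension. Being a finite
  sum over a finite support, it is linear without integrability conditions.\<close>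

definition avg :: "'a::finite op pmf \<Rightarrow> ('a op \<Rightarrow> 'x::real_vector) \<Rightarrow> 'x" where
  "avg p F = (\<Sum>U\<in>set_pmf p. pmf p U *\<^sub>R (\<Sum>b\<in>UNIV. F (ketbra (cadj U *v ket b))))"

lemma avg_sum: "avg p (\<lambda>\<psi>. \<Sum>x\<in>X. F x \<psi>) = (\<Sum>x\<in>X. avg p (F x))"
  unfolding avg_def scaleR_sum_right
  by (rule trans[OF _ sum_swap3[symmetric]]) (intro sum.cong refl sum.swap)

lemma avg_linear:
  assumes "linear L"
  shows "L (avg p F) = avg p (\<lambda>\<psi>. L (F \<psi>))"
  by (simp add: avg_def linear_sum[OF assms] linear_scale[OF assms])

lemma avg_mult_left: "avg p (\<lambda>\<psi>. c * F \<psi>) = c * avg p F" for c :: "'x::real_algebra"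
  by (simp add: avg_def sum_distrib_left)

lemma avg_add: "avg p (\<lambda>\<psi>. F \<psi> + H \<psi>) = avg p F + avg p H"
  by (simp add: avg_def sum.distrib scaleR_add_right)

lemma avg_diff: "avg p (\<lambda>\<psi>. F \<psi> - H \<psi>) = avg p F - avg p H"
  by (simp add: avg_def sum_subtractf scaleR_diff_right)

lemma avg_cong:
  "(\<And>U b. U \<in> set_pmf p \<Longrightarrow> F (ketbra (cadj U *v ket b)) = H (ketbra (cadj U *v ket b)))
    \<Longrightarrow> avg p F = avg p H"
  by (simp add: avg_def)

lemma avg_mono:
  fixes F H :: "_ \<Rightarrow> real"
  assumes "\<And>U b. U \<in> set_pmf p \<Longrightarrow> F (ketbra (cadj U *v ket b)) \<le> H (ketbra (cadj U *v ket b))"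
  shows "avg p F \<le> avg p H"
  unfolding avg_def using assms by (intro sum_mono scaleR_left_mono) auto

lemma avg_const:
  assumes "finite (set_pmf p)"
  shows "avg p (\<lambda>\<psi> :: 'a::finite op. c) = (of_nat CARD('a) * c :: 'x::real_algebra_1)"
proof -
  have "avg p (\<lambda>\<psi> :: 'a op. c) = (\<Sum>U\<in>set_pmf p. pmf p U) *\<^sub>R (of_nat CARD('a) * c)"
    by (simp add: avg_def scaleR_sum_left)
  then show ?thesis using sum_pmf_eq_1[OF assms order_refl] by simp
qed

lemma linear_trace_mult: "linear (\<lambda>A :: 'a::finite op. trace (A ** B))"
  by (intro linearI) (simp_all add: trace_add matrix_add_rdistrib scaleR_eq_cscale scaleR_conv_of_real)

lemma measurement_map_avg:
  assumes "finite (set_pmf p)"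
  shows "measurement_map p A = avg p (\<lambda>\<psi>. cscale (trace (\<psi> ** A)) \<psi>)"
  unfolding measurement_map_def avg_def using assms by (subst integral_measure_pmf) auto

section \<open>The Clifford group\<close>

lemma mult_right_cancel_unitary:
  assumes "unitary V"
  shows "A ** V ** cadj V = A" "A ** cadj V ** V = A"
  using assms by (simp_all add: unitary_def flip: matrix_mul_assoc)

lemma mult_left_cancel_unitary:
  assumes "unitary V"
  shows "V ** (cadj V ** A) = A" "cadj V ** (V ** A) = A"
  using assms by (simp_all add: unitary_def matrix_mul_assoc)

lemma unitary_mult:
  assumes "unitary U" "unitary V"
  shows "unitary (U ** V)"
proof -
  have "U ** cadj U = mat 1" "cadj V ** V = mat 1" using assms by (auto simp: unitary_def)
  then show ?thesis
    by (simp add: unitary_def cadj_mult mult_left_cancel_unitary[OF assms(1)]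
        mult_left_cancel_unitary[OF assms(2)] flip: matrix_mul_assoc)
qed

lemma unitary_cadj: "unitary U \<Longrightarrow> unitary (cadj U)"
  by (simp add: unitary_def)

lemma clifford_mult:
  assumes "clifford U" "clifford V"
  shows "clifford (U ** V)"
proof -
  have "(\<lambda>P. U ** V ** P ** cadj (U ** V)) ` pauli_group
      = (\<lambda>P. U ** P ** cadj U) ` (\<lambda>P. V ** P ** cadj V) ` pauli_group"
    by (simp add: image_image cadj_mult matrix_mul_assoc)
  also have "\<dots> = pauli_group" using assms by (simp add: clifford_def)
  finally show ?thesis using assms by (auto simp: clifford_def intro: unitary_mult)
qed

lemma clifford_cadj:
  assumes "clifford U"
  shows "clifford (cadj U)"
proof -
  have U: "unitary U" and im: "(\<lambda>P. U ** P ** cadj U) ` pauli_group = pauli_group"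
    using assms by (auto simp: clifford_def)
  have "(\<lambda>P. cadj U ** P ** cadj (cadj U)) ` pauli_group
      = (\<lambda>P. cadj U ** P ** U) ` (\<lambda>P. U ** P ** cadj U) ` pauli_group"
    unfolding im by simp
  also have "\<dots> = pauli_group"
  proof -
    have "cadj U ** U = mat 1" using U by (simp add: unitary_def)
    then show ?thesis
      by (simp add: image_image mult_left_cancel_unitary[OF U] flip: matrix_mul_assoc)
  qed
  finally show ?thesis using U by (simp add: clifford_def unitary_cadj)
qed

lemma clifford_cscale:
  assumes "clifford U" "c * cnj c = 1"
  shows "clifford (cscale c U)"
proof -
  have "cnj c * c = 1" using assms(2) by (simp add: mult.commute)
  then show ?thesis using assms by (simp add: clifford_def unitary_def cadj_cscale mult_ac)
qed

section \<open>Pauli operators and Hadamard-type gates as Clifford unitaries\<close>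

lemma cscale_pauli_in_group: "c \<in> phases \<Longrightarrow> cscale c (pauli u) \<in> pauli_group"
  unfolding pauli_group_eq by blast

text \<open>Conjugation by an involution undoes itself, so inclusion of the image already gives
  equality; scaling reduces the check to Pauli operators without phase.\<close>

lemma clifford_involution:
  assumes "cadj U = U" "U ** U = mat 1" "\<And>u. U ** pauli u ** U \<in> pauli_group"
  shows "clifford U"
proof -
  have sub: "U ** P ** U \<in> pauli_group" if P: "P \<in> pauli_group" for P
  proof -
    obtain c u where cu: "P = cscale c (pauli u)" "c \<in> phases" using P unfolding pauli_group_eq by auto
    obtain k w where kw: "U ** pauli u ** U = cscale k (pauli w)" "k \<in> phases"
      using assms(3)[of u] unfolding pauli_group_eq by auto
    have "U ** P ** U = cscale (c * k) (pauli w)" using cu kw by simp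
    then show ?thesis using cscale_pauli_in_group[OF phases_mult[OF cu(2) kw(2)]] by simp
  qed
  have "U ** (U ** P ** U) ** U = P" for P
  proof -
    have "U ** (U ** P ** U) ** U = (U ** U) ** P ** (U ** U)" by (simp only: matrix_mul_assoc)
    then show ?thesis by (simp add: assms(2))
  qed
  then have "pauli_group \<subseteq> (\<lambda>P. U ** P ** U) ` pauli_group"
    using image_eqI[of _ "\<lambda>P. U ** P ** U", OF _ sub] by (intro subsetI) simp
  moreover have "(\<lambda>P. U ** P ** U) ` pauli_group \<subseteq> pauli_group" using sub by (rule image_subsetI)
  ultimately show ?thesis using assms(1,2) by (simp add: clifford_def unitary_def)
qed

lemma pauli_conj: "pauli r ** pauli u ** pauli r = cscale (pcomm r u) (pauli u)"
proof -
  have "pauli r ** pauli u ** pauli r = cscale (pcomm r u) (pauli u ** (pauli r ** pauli r))"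
    by (subst pauli_commute) (simp add: matrix_mul_assoc del: pauli_square)
  then show ?thesis by simp
qed

lemma clifford_pauli: "clifford (pauli r)"
proof (rule clifford_involution)
  show "pauli r ** pauli u ** pauli r \<in> pauli_group" for u
    unfolding pauli_conj using pcomm_cases[of r u] by (intro cscale_pauli_in_group) auto
qed auto

text \<open>For X and Z this is the Hadamard gate. For an anticommuting pair the cross terms of the
  square cancel, which makes it a Hermitian involution.\<close>

definition had :: "'q::finite pauli \<Rightarrow> 'q pauli \<Rightarrow> ('q \<Rightarrow> bool) op" where
  "had a b = cscale (of_real (1 / sqrt 2)) (pauli a + pauli b)"

lemma cadj_had: "cadj (had a b) = had a b"
  by (simp add: had_def cadj_cscale cadj_add)

text \<open>If \<open>w\<close> has the same sign against \<open>a\<close> and \<open>b\<close>,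
  only the first term survives; otherwise only the second does, a phase times a Pauli operator.
  Either way the Pauli group is preserved.\<close>

lemma had_conj:
  assumes "pcomm a b = -1"
  shows "had a b ** pauli w ** had a b = cscale ((pcomm a w + pcomm b w) / 2) (pauli w)
    + cscale ((pcomm a w - pcomm b w) / 2) (pauli w ** pauli a ** pauli b)"
proof -
  have half: "complex_of_real (1 / sqrt 2) * complex_of_real (1 / sqrt 2) = 1 / 2"
    by (simp flip: of_real_mult)
  have 1: "pauli a ** pauli w = cscale (pcomm a w) (pauli w ** pauli a)"
    "pauli b ** pauli w = cscale (pcomm b w) (pauli w ** pauli b)"
    "pauli b ** pauli a = cscale (-1) (pauli a ** pauli b)"
    using pauli_commute[of a w] pauli_commute[of b w] pauli_commute[of b a] assms pcomm_sym[of a b]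
    by auto
  have 2: "pauli w ** pauli b ** pauli a = cscale (-1) (pauli w ** pauli a ** pauli b)"
    using 1(3) by (simp flip: matrix_mul_assoc)
  have 3: "pauli w ** pauli a ** pauli a = pauli w" "pauli w ** pauli b ** pauli b = pauli w"
    by (simp_all flip: matrix_mul_assoc)
  have "had a b ** pauli w ** had a b
      = cscale (1 / 2) ((pauli a ** pauli w + pauli b ** pauli w) ** (pauli a + pauli b))"
    unfolding had_def cscale_mult_left cscale_mult_right cscale_cscale half
    by (simp only: matrix_add_rdistrib)
  also have "\<dots> = cscale (1 / 2) (cscale (pcomm a w) (pauli w)
      + cscale (pcomm a w) (pauli w ** pauli a ** pauli b)
      + cscale (- pcomm b w) (pauli w ** pauli a ** pauli b) + cscale (pcomm b w) (pauli w))"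
    unfolding 1 by (simp add: matrix_add_ldistrib matrix_add_rdistrib 2 3 add_ac)
  also have "\<dots> = cscale ((pcomm a w + pcomm b w) / 2) (pauli w)
    + cscale ((pcomm a w - pcomm b w) / 2) (pauli w ** pauli a ** pauli b)"
    by (simp add: vec_eq_iff field_simps)
  finally show ?thesis .
qed

lemma clifford_had:
  assumes "pcomm a b = -1"
  shows "clifford (had a b)"
proof (rule clifford_involution)
  \<comment> \<open>Conjugating the identity, which is \<open>pauli pid\<close>, amounts to
    squaring.\<close>
  show "had a b ** had a b = mat 1"
    using had_conj[OF assms, of pid] by simp
  show "had a b ** pauli w ** had a b \<in> pauli_group" for w
  proof (cases "pcomm a w = pcomm b w")
    case True
    then have "had a b ** pauli w ** had a b = cscale (pcomm b w) (pauli w)"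
      by (simp add: had_conj[OF assms])
    then show ?thesis using pcomm_cases[of b w] by (auto intro!: cscale_pauli_in_group)
  next
    case False
    then have "pcomm b w = - pcomm a w" using pcomm_cases[of a w] pcomm_cases[of b w] by auto
    then have "had a b ** pauli w ** had a b = cscale (pcomm a w) (pauli w ** pauli a ** pauli b)"
      by (simp add: had_conj[OF assms])
    moreover obtain c where c: "pauli w ** pauli a = cscale c (pauli (pxor w a))" "c \<in> phases"
      using pauli_mult by blast
    moreover obtain k where k: "pauli (pxor w a) ** pauli b = cscale k (pauli (pxor (pxor w a) b))" "k \<in> phases"
      using pauli_mult by blast
    ultimately have "had a b ** pauli w ** had a b
        = cscale (pcomm a w * c * k) (pauli (pxor (pxor w a) b))" by (simp add: mult.assoc)
    moreover have "pcomm a w \<in> phases" using pcomm_cases[of a w] by auto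
    ultimately show ?thesis using c(2) k(2) by (metis cscale_pauli_in_group phases_mult)
  qed
qed (rule cadj_had)

lemma had_fixes:
  assumes "pcomm a b = -1" "pcomm a w = 1" "pcomm b w = 1"
  shows "had a b ** pauli w ** had a b = pauli w"
  using had_conj[OF assms(1), of w] assms by simp

lemma had_swaps:
  assumes "pcomm a b = -1"
  shows "had a b ** pauli a ** had a b = pauli b" "had a b ** pauli b ** had a b = pauli a"
proof -
  show "had a b ** pauli a ** had a b = pauli b"
    using had_conj[OF assms, of a] assms by (simp add: pcomm_sym[of b a])
  have "pauli b ** pauli a ** pauli b = cscale (-1) (pauli a)"
    using pauli_conj[of b a] assms by (simp add: pcomm_sym[of b a])
  then show "had a b ** pauli b ** had a b = pauli a"
    using had_conj[OF assms, of b] assms by simp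
qed

section \<open>Invariant symmetric trilinear forms\<close>

text \<open>Nondegeneracy of the symplectic form: a label with sign 1 against everything would have
  character sum \<open>4 ^ n\<close>.\<close>

lemma pcomm_nontrivial:
  assumes "u \<noteq> pid"
  shows "\<exists>r. pcomm u r = -1"
proof (rule ccontr)
  assume "\<nexists>r. pcomm u r = -1"
  then have "pcomm u r = 1" for r using pcomm_cases[of u r] by auto
  then have "(\<Sum>r\<in>UNIV. pcomm u r) \<noteq> 0" by simp
  then show False using assms pcomm_sum[of u] by simp
qed

text \<open>
  Sum the product of \<open>1 - pcomm u r\<close>, \<open>1 - pcomm u' r\<close> and \<open>1 + pcomm v r\<close> over all \<open>r\<close>: by
  orthogonality of characters only nonnegative terms survive, and the term \<open>1\<close> does.
\<close>

lemma common_anticommuting_pauli: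
  fixes u u' v :: "'q::finite pauli"
  assumes "u \<notin> {pid, v}" "u' \<notin> {pid, v}"
  shows "\<exists>r. pcomm u r = -1 \<and> pcomm u' r = -1 \<and> pcomm v r = 1"
proof (rule ccontr)
  assume "\<nexists>r. pcomm u r = -1 \<and> pcomm u' r = -1 \<and> pcomm v r = 1"
  then have "(1 - pcomm u r) * (1 - pcomm u' r) * (1 + pcomm v r) = 0" for r
    using pcomm_cases[of u r] pcomm_cases[of u' r] pcomm_cases[of v r] by fastforce
  then have "0 = (\<Sum>r\<in>UNIV. (1 - pcomm u r) * (1 - pcomm u' r) * (1 + pcomm v r))" by (simp only: sum.neutral_const)
  also have "\<dots> = (\<Sum>r\<in>UNIV. pcomm pid r - pcomm u r - pcomm u' r + pcomm (pxor u u') r + pcomm v r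
      - pcomm (pxor u v) r - pcomm (pxor u' v) r + pcomm (pxor (pxor u u') v) r)"
    by (intro sum.cong refl) (simp add: pcomm_xor algebra_simps)
  \<comment> \<open>The terms with a minus sign are the characters of \<open>u\<close>,
    \<open>u'\<close>, \<open>pxor u v\<close> and \<open>pxor u' v\<close>, all nontrivial by the
    hypotheses.\<close>
  also have "\<dots> = 4 ^ CARD('q) * (1 + (if u = u' then 1 else 0) + (if v = pid then 1 else 0)
      + (if pxor u u' = v then 1 else 0))"
    using assms by (simp add: sum.distrib sum_subtractf pcomm_sum algebra_simps card_fun)
  finally show False by (auto split: if_splits simp: numeral_eq_Suc complex_eq_iff)
qed

text \<open>To be applied to the difference of a moment and its conjectured formula. Linearity is
  stated for the first argument; the two transpositions carry it to the others.\<close>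

locale invariant_form =
  fixes D :: "('q::finite \<Rightarrow> bool) op \<Rightarrow> ('q \<Rightarrow> bool) op \<Rightarrow> ('q \<Rightarrow> bool) op \<Rightarrow> complex"
  assumes D_add: "D (A + A') B C = D A B C + D A' B C"
    and D_scale: "D (cscale c A) B C = c * D A B C"
    and swap12: "D A B C = D B A C"
    and swap23: "D A B C = D A C B"
    and D_inv: "clifford V \<Longrightarrow>
      D (V ** A ** cadj V) (V ** B ** cadj V) (V ** C ** cadj V) = D A B C"
begin

lemma D_scale': "D A (cscale c B) C = c * D A B C" "D A B (cscale c C) = c * D A B C"
proof -
  show *: "D A (cscale c B) C = c * D A B C" for A B C
    by (simp only: swap12[of A "cscale c B"] swap12[of A B] D_scale)
  show "D A B (cscale c C) = c * D A B C"
    by (simp only: swap23[of A B "cscale c C"] swap23[of A B C] *)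
qed

lemma D_sum: "D (\<Sum>x\<in>X. f x) B C = (\<Sum>x\<in>X. D (f x) B C)"
proof (induction X rule: infinite_finite_induct)
  case (infinite X)
  then show ?case using D_scale[of 0] by simp
next
  case empty
  then show ?case using D_scale[of 0] by simp
next
  case (insert x X)
  then show ?case by (simp add: D_add)
qed

lemma inv_had:
  assumes "pcomm a b = -1"
  shows "D (had a b ** A ** had a b) (had a b ** B ** had a b) (had a b ** C ** had a b) = D A B C"
  using D_inv[OF clifford_had[OF assms], of A B C] by (simp add: cadj_had)

text \<open>Conjugation by a Pauli operator changes only signs. One that anticommutes with the
  product of the three arguments shows that the value is its own negative.\<close>

lemma zero_unless_product:
  assumes "w \<noteq> pxor u v"
  shows "D (pauli u) (pauli v) (pauli w) = 0"
proof -
  obtain r where "pcomm (pxor (pxor u v) w) r = -1"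
    using assms pcomm_nontrivial[of "pxor (pxor u v) w"] by auto
  then have "pcomm r u * pcomm r v * pcomm r w = -1"
    by (simp add: pcomm_xor pcomm_sym[of r])
  moreover have "D (pauli u) (pauli v) (pauli w) = pcomm r u * pcomm r v * pcomm r w * D (pauli u) (pauli v) (pauli w)"
    using D_inv[OF clifford_pauli, of r "pauli u" "pauli v" "pauli w"]
    by (simp add: pauli_conj D_scale D_scale' mult_ac)
  ultimately show ?thesis by simp
qed

text \<open>The third argument is the actual product, phase included. Conjugation respects products,
  so it carries values of \<open>E\<close> to values of \<open>E\<close> without any tracking of
  phases.\<close>

definition E :: "'q pauli \<Rightarrow> 'q pauli \<Rightarrow> complex" where
  "E u v = D (pauli u) (pauli v) (pauli u ** pauli v)"

lemma had_conj_mult: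
  assumes "pcomm a b = -1"
  shows "had a b ** (A ** B) ** had a b = (had a b ** A ** had a b) ** (had a b ** B ** had a b)"
proof -
  have "had a b ** had a b = mat 1"
    using had_conj[OF assms, of pid] by simp
  then have "had a b ** A ** (had a b ** had a b) ** B ** had a b = had a b ** A ** B ** had a b"
    by simp
  then show ?thesis by (simp only: matrix_mul_assoc)
qed

lemma E_sym: "pcomm u v = 1 \<Longrightarrow> E u v = E v u"
  unfolding E_def by (subst swap12) (simp add: pauli_commute[of u v])

text \<open>\<open>had u v\<close> exchanges \<open>u\<close> and \<open>v\<close> and thereby
  reverses the sign of their product, while symmetry of the form allows exchanging the first two
  arguments back: the value is its own negative.\<close>

lemma E_anticommuting:
  assumes "pcomm u v = -1"
  shows "E u v = 0"
proof -
  have "E u v = D (pauli v) (pauli u) (pauli v ** pauli u)"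
    using inv_had[OF assms, of "pauli u" "pauli v" "pauli u ** pauli v"]
    unfolding had_conj_mult[OF assms] had_swaps[OF assms] by (simp add: E_def)
  also have "pauli v ** pauli u = cscale (-1) (pauli u ** pauli v)"
    using pauli_commute[of v u] assms by (simp add: pcomm_sym[of v u])
  also have "D (pauli v) (pauli u) (cscale (-1) (pauli u ** pauli v)) = - E u v"
    unfolding D_scale' E_def by (subst swap12) simp
  finally show ?thesis by simp
qed

lemma E_step:
  assumes "pcomm u u' = -1" "pcomm u v = 1" "pcomm u' v = 1"
  shows "E u v = E u' v"
  using inv_had[OF assms(1), of "pauli u" "pauli v" "pauli u ** pauli v"]
  unfolding had_conj_mult[OF assms(1)] had_swaps[OF assms(1)] had_fixes[OF assms]
  by (simp add: E_def)

text \<open>A common anticommuting partner \<open>r\<close> that commutes with \<open>v\<close>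
  links \<open>u\<close> to \<open>u'\<close> by two exchanges, each of which fixes
  \<open>v\<close>.\<close>

lemma E_move:
  assumes "u \<notin> {pid, v}" "u' \<notin> {pid, v}" "pcomm u v = 1" "pcomm u' v = 1"
  shows "E u v = E u' v"
proof -
  obtain r where r: "pcomm u r = -1" "pcomm u' r = -1" "pcomm v r = 1"
    using common_anticommuting_pauli[OF assms(1,2)] by auto
  have "pcomm r v = 1" using r(3) pcomm_sym[of r v] by simp
  then show ?thesis using E_step[of u r v] E_step[of u' r v] r assms by simp
qed

text \<open>Distinct labels have a nontrivial product, so these are the commuting pairs for which
  all three arguments of \<open>E\<close> are nontrivial.\<close>

definition independent :: "'q pauli \<Rightarrow> 'q pauli \<Rightarrow> bool" where
  "independent u v \<longleftrightarrow> u \<noteq> pid \<and> v \<noteq> pid \<and> u \<noteq> v \<and> pcomm u v = 1"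

lemma independent_sym: "independent u v \<Longrightarrow> independent v u"
  by (auto simp: independent_def pcomm_sym)

lemma E_move_independent:
  "independent u v \<Longrightarrow> independent u' v \<Longrightarrow> E u v = E u' v"
  by (intro E_move) (auto simp: independent_def)

text \<open>The first argument can be replaced while the second stays, and commuting arguments can
  be exchanged. Hence it suffices to find a \<open>w\<close> independent of both \<open>v\<close>
  and \<open>v'\<close>.\<close>

lemma E_independent_const:
  assumes "independent u v" "independent u' v'"
  shows "E u v = E u' v'"
proof -
  have via: "E u v = E u' v'" if w: "independent w v" "independent w v'" for w
  proof -
    have "E u v = E w v" using assms(1) w(1) by (rule E_move_independent)
    also have "\<dots> = E v w" using w(1) by (intro E_sym) (simp add: independent_def)
    also have "\<dots> = E v' w" by (rule E_move_independent[OF independent_sym[OF w(1)] independent_sym[OF w(2)]])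
    also have "\<dots> = E w v'" using independent_sym[OF w(2)] by (intro E_sym) (simp add: independent_def)
    also have "\<dots> = E u' v'" using w(2) assms(2) by (rule E_move_independent)
    finally show ?thesis .
  qed
  consider "v = v'" | "v \<noteq> v'" "pcomm v v' = 1" | "pcomm v v' = -1" using pcomm_cases[of v v'] by auto
  then show ?thesis
  proof cases
    case 1
    then show ?thesis using assms E_move_independent[of u v u'] by simp
  next
    case 2
    have "independent (pxor v v') v" "independent (pxor v v') v'"
      using 2 assms pcomm_sym[of v' v] by (simp_all add: independent_def pcomm_xor)
    then show ?thesis by (rule via)
  next
    case 3
    have anti: "pcomm v' v = -1" using 3 pcomm_sym[of v' v] by simp
    show ?thesis
    proof (cases "pcomm u v' = 1")
      case True
      have "u \<noteq> v'" using anti assms(1) by (auto simp: independent_def)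
      then have "independent u v'" using True assms by (simp add: independent_def)
      with assms(1) show ?thesis by (rule via)
    next
      case False
      then have F: "pcomm u v' = -1" using pcomm_cases[of u v'] by auto
      \<comment> \<open>Both \<open>u\<close> and \<open>v\<close> anticommute with
        \<open>v'\<close>, so their product commutes with it.\<close>
      have c: "pcomm (pxor u v) v = 1" "pcomm (pxor u v) v' = 1"
        using assms(1) 3 F by (simp_all add: independent_def pcomm_xor)
      have "pxor u v \<noteq> v'" using c(1) anti by auto
      then have "independent (pxor u v) v" "independent (pxor u v) v'"
        using c assms by (simp_all add: independent_def)
      then show ?thesis by (rule via)
    qed
  qed
qed

text \<open>The possibly nonzero values on Pauli operators fall into three classes, with zero, two
  or three nontrivial arguments, and are constant on each. Taken in this order, every hypothesis
  leaves one unknown constant, multiplied by the size of its class.\<close>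

theorem form_eq_zero:
  assumes "D (mat 1) (mat 1) (mat 1) = 0"
    and "(\<Sum>u\<in>UNIV. D (pauli u) (mat 1) (pauli u)) = 0"
    and "(\<Sum>u\<in>UNIV. \<Sum>v\<in>UNIV. D (pauli u) (pauli v) (pauli u ** pauli v)) = 0"
  shows "D A B C = 0"
proof -
  have E1: "E u pid = 0" for u
  proof (cases "u = pid")
    case True
    then show ?thesis using assms(1) by (simp add: E_def)
  next
    case False
    have *: "E u' pid = (if u' = pid then 0 else E u pid)" for u'
      using E_move[of u' pid u] False assms(1) by (auto simp: E_def)
    have "(\<Sum>u'\<in>UNIV. E u' pid) = (\<Sum>u'\<in>UNIV. if u' = (pid :: 'q pauli) then 0 else E u pid)"
      by (rule sum.cong[OF refl *])
    also have "\<dots> = of_nat (card (UNIV - {pid :: 'q pauli})) * E u pid"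
      by (simp add: sum.If_cases Compl_eq_Diff_UNIV)
    finally have "of_nat (card (UNIV - {pid :: 'q pauli})) * E u pid = 0"
      using assms(2) by (simp add: E_def)
    moreover have "u \<in> UNIV - {pid}" using False by simp
    then have "card (UNIV - {pid :: 'q pauli}) \<noteq> 0"
      using card_0_eq[OF finite, of "UNIV - {pid :: 'q pauli}"] by blast
    ultimately show ?thesis by simp
  qed
  have E2: "E pid u = 0" "E u u = 0" for u
  proof -
    show "E pid u = 0" using E1[of u] E_sym[of pid u] by simp
    \<comment> \<open>\<open>pauli u\<close> squares to the identity, so this is
      \<open>E u pid\<close> with permuted arguments.\<close>
    show "E u u = 0" using E1[of u] swap23[of "pauli u" "pauli u" "mat 1"] by (simp add: E_def)
  qed
  have E3: "E u v = 0" if dep: "\<not> independent u v" for u v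
  proof -
    consider "u = pid" | "v = pid" | "u = v" | "pcomm u v = -1"
      using dep pcomm_cases[of u v] unfolding independent_def by blast
    then show ?thesis using E1 E2 E_anticommuting by cases simp_all
  qed
  have E0: "E u v = 0" for u v
  proof (cases "independent u v")
    case True
    let ?I = "{(u, v). independent u v}"
    have const: "E u' v' = E u v" if "independent u' v'" for u' v'
      using that True by (rule E_independent_const)
    have "0 = (\<Sum>(u', v')\<in>UNIV. E u' v')"
      using assms(3) sum.cartesian_product[of E UNIV UNIV] by (simp flip: E_def)
    also have "\<dots> = (\<Sum>(u', v')\<in>?I. E u' v')"
      by (rule sum.mono_neutral_right) (auto intro!: E3)
    also have "\<dots> = (\<Sum>(u', v')\<in>?I. E u v)"
      by (intro sum.cong refl) (auto simp: const)
    also have "\<dots> = of_nat (card ?I) * E u v" by simp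
    finally have "of_nat (card ?I) * E u v = 0" by simp
    moreover have "(u, v) \<in> ?I" using True by simp
    then have "card ?I \<noteq> 0" using card_0_eq[OF finite, of ?I] by blast
    ultimately show ?thesis by simp
  qed (rule E3)
  have D0: "D (pauli u) (pauli v) (pauli w) = 0" for u v w
  proof (cases "w = pxor u v")
    case True
    obtain c where "c \<in> phases" "pauli u ** pauli v = cscale c (pauli w)"
      using pauli_mult True by blast
    then show ?thesis using E0[of u v] by (auto simp: E_def D_scale')
  qed (rule zero_unless_product)
  have expand: "D A B C = 0" if "\<And>u. D (pauli u) B C = 0" for A B C
  proof -
    have "D A B C = D (cscale (1 / 2 ^ CARD('q)) (\<Sum>u\<in>UNIV. cscale (trace (pauli u ** A)) (pauli u))) B C"
      by (simp add: pauli_expansion)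
    also have "\<dots> = 1 / 2 ^ CARD('q) * (\<Sum>u\<in>UNIV. trace (pauli u ** A) * D (pauli u) B C)"
      by (simp only: D_scale D_sum)
    finally show ?thesis using that by simp
  qed
  have "D (pauli u) (pauli v) C = 0" for u v C
    using expand[of "pauli u" "pauli v" C] D0 by (simp only: swap23[of "pauli u" _ C] swap12[of "pauli u" C])
  then have "D (pauli u) B C = 0" for u B C
    using expand[of "pauli u" C B] by (simp only: swap12[of "pauli u" B])
  then show ?thesis by (rule expand)
qed

end

section \<open>Moments of the Clifford ensemble\<close>

lemma ketbra_cadj_mult:
  "ketbra (cadj (U ** V) *v ket b) = cadj V ** ketbra (cadj U *v ket b) ** V"
  by (simp only: ketbra_cadj_ket) (simp only: cadj_mult matrix_mul_assoc)

section \<open>The finite group of Clifford unitaries of determinant 1\<close>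

lemma det_cscale: "det (cscale c A) = c ^ CARD('a) * det (A :: 'a::finite op)"
proof -
  have "cscale c A = (\<chi> i. c *s A $ i)" by (simp add: vec_eq_iff)
  then show ?thesis using det_rows_mul[of "\<lambda>_. c" "\<lambda>i. A $ i"] by simp
qed

lemma det_cadj: "det (cadj A) = cnj (det A)"
proof -
  have "det (cadj A) = det (transpose (cadj A))" by (simp add: det_transpose)
  also have "\<dots> = cnj (det A)" by (simp add: det_def transpose_def)
  finally show ?thesis .
qed

text \<open>Schur's lemma for the Pauli operators: commutation makes the twirl \<open>4 ^ n\<close>
  times \<open>A\<close>, while the twirl formula makes it a scalar.\<close>

lemma scalar_if_commutes:
  fixes A :: "('q::finite \<Rightarrow> bool) op"
  assumes "\<And>u. A ** pauli u = pauli u ** A"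
  shows "\<exists>c. A = cscale c (mat 1)"
proof -
  have "pauli u ** A ** pauli u = A" for u :: "'q pauli"
    by (simp add: assms flip: matrix_mul_assoc) (simp add: matrix_mul_assoc)
  then have "cscale (4 ^ CARD('q)) A = cscale (2 ^ CARD('q) * trace A) (mat 1)"
    using pauli_twirl[of A] by (simp add: vec_eq_iff card_fun)
  then have "cscale (1 / 4 ^ CARD('q)) (cscale (4 ^ CARD('q)) A)
      = cscale (1 / 4 ^ CARD('q)) (cscale (2 ^ CARD('q) * trace A) (mat 1))"
    by simp
  then show ?thesis by auto
qed

abbreviation special_clifford :: "('q::finite \<Rightarrow> bool) op set" where
  "special_clifford \<equiv> {U. clifford U \<and> det U = 1}"

lemma finite_pauli_group: "finite (pauli_group :: ('q::finite \<Rightarrow> bool) op set)"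
proof -
  have "pauli_group = (\<lambda>(c, u :: 'q pauli). cscale c (pauli u)) ` (phases \<times> UNIV)"
    unfolding pauli_group_eq by auto
  also have "finite \<dots>" by (intro finite_imageI) simp
  finally show ?thesis .
qed

lemma clifford_conj_pauli: "clifford U \<Longrightarrow> U ** pauli u ** cadj U \<in> pauli_group"
  using cscale_pauli_in_group[of 1 u] unfolding clifford_def by auto

text \<open>A Clifford unitary is determined up to a scalar by its action on the Pauli operators.\<close>

lemma finite_special_clifford: "finite (special_clifford :: ('q::finite \<Rightarrow> bool) op set)"
proof -
  define act :: "('q \<Rightarrow> bool) op \<Rightarrow> 'q pauli \<Rightarrow> ('q \<Rightarrow> bool) op"
    where "act U = (\<lambda>u. U ** pauli u ** cadj U)" for U
  have fiber: "finite {U \<in> special_clifford. act U = act V}" if V: "V \<in> special_clifford" for V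
  proof (rule finite_subset)
    show "{U \<in> special_clifford. act U = act V}
        \<subseteq> (\<lambda>k. cscale k V) ` {k. k ^ CARD('q \<Rightarrow> bool) = 1}"
    proof
      fix U assume "U \<in> {U \<in> special_clifford. act U = act V}"
      then have U: "clifford U" "det U = 1" "act U = act V" by auto
      have uU: "unitary U" and uV: "unitary V" using U V by (auto simp: clifford_def)
      have "cadj V ** U ** pauli u = pauli u ** (cadj V ** U)" for u
      proof -
        have "cadj V ** U ** pauli u = cadj V ** (U ** pauli u ** cadj U) ** U"
          by (simp add: mult_right_cancel_unitary[OF uU] flip: matrix_mul_assoc)
            (simp add: uU[unfolded unitary_def])
        also have "U ** pauli u ** cadj U = V ** pauli u ** cadj V"
          using U(3) by (simp add: act_def fun_eq_iff)
        also have "cadj V ** (V ** pauli u ** cadj V) ** U = pauli u ** (cadj V ** U)"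
          by (simp add: mult_left_cancel_unitary[OF uV] flip: matrix_mul_assoc)
        finally show ?thesis .
      qed
      \<comment> \<open>Equal actions on the Pauli operators make \<open>cadj V ** U\<close> a
        scalar; the determinants then force it to be a root of unity.\<close>
      then obtain k where k: "cadj V ** U = cscale k (mat 1)" using scalar_if_commutes by blast
      have "U = V ** (cadj V ** U)" by (simp add: mult_left_cancel_unitary[OF uV])
      then have eq: "U = cscale k V" by (simp add: k)
      then have "k ^ CARD('q \<Rightarrow> bool) = 1" using U(2) V by (simp add: det_cscale)
      then show "U \<in> (\<lambda>k. cscale k V) ` {k. k ^ CARD('q \<Rightarrow> bool) = 1}" using eq by blast
    qed
    show "finite ((\<lambda>k. cscale k V) ` {k. k ^ CARD('q \<Rightarrow> bool) = 1})"
      by (intro finite_imageI finite_nth_roots) simp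
  qed
  have "act ` special_clifford \<subseteq> (\<Pi>\<^sub>E u\<in>UNIV. pauli_group)"
    by (auto simp: act_def clifford_conj_pauli)
  then have fin: "finite (act ` special_clifford)"
    by (rule finite_subset) (simp add: finite_PiE finite_pauli_group)
  have "(special_clifford :: ('q \<Rightarrow> bool) op set)
      \<subseteq> (\<Union>f\<in>act ` special_clifford. {U \<in> special_clifford. act U = f})" by auto
  moreover have "finite (\<Union>f\<in>act ` special_clifford. {U \<in> special_clifford. act U = f})"
    by (rule finite_UN_I[OF fin]) (erule imageE, simp only: fiber)
  ultimately show ?thesis by (rule finite_subset)
qed

lemma mat1_special_clifford: "mat 1 \<in> (special_clifford :: ('q::finite \<Rightarrow> bool) op set)"
  using clifford_pauli[of pid] by simp

lemma set_global_clifford_ensemble [simp]: "set_pmf global_clifford_ensemble = special_clifford"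
  unfolding global_clifford_ensemble_def
  using finite_special_clifford mat1_special_clifford by (intro set_pmf_of_set) auto

text \<open>Conjugation does not see a phase, so with this rescaling invariance under the
  determinant-one group extends to all Clifford unitaries.\<close>

lemma special_clifford_multiple:
  fixes V :: "('q::finite \<Rightarrow> bool) op"
  assumes V: "clifford V"
  shows "\<exists>c. c * cnj c = 1 \<and> cscale c V \<in> special_clifford"
proof -
  let ?d = "CARD('q \<Rightarrow> bool)"
  have "det V * cnj (det V) = 1"
    using V by (metis clifford_def det_I det_cadj det_mul unitary_def)
  then have nz: "det V \<noteq> 0" and "(cmod (det V))\<^sup>2 = 1"
    using complex_norm_square[of "det V"] by (auto simp flip: of_real_power)
  then have n: "cmod (det V) = 1" using abs_square_eq_1[of "cmod (det V)"] by simp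
  \<comment> \<open>A root of order \<open>2 ^ n\<close> of the inverse determinant, which has
    modulus 1.\<close>
  define c where "c = exp (Ln (inverse (det V)) / of_nat ?d)"
  have "c ^ ?d = exp (Ln (inverse (det V)))" unfolding c_def by (simp flip: exp_of_nat_mult)
  then have c: "c ^ ?d = inverse (det V)" using nz by simp
  have "cmod (c ^ ?d) = 1" using n by (simp only: c norm_inverse) simp
  then have "cmod c ^ ?d = 1 ^ ?d" by (simp add: norm_power)
  then have "cmod c = 1" using power_eq_iff_eq_base[of ?d "cmod c" 1] by simp
  then have cc: "c * cnj c = 1" using complex_norm_square[of c] by simp
  moreover have "det (cscale c V) = 1" using c nz by (simp add: det_cscale)
  ultimately show ?thesis using clifford_cscale[OF V cc] by auto
qed

text \<open>The ensemble is uniform on a finite group, so right multiplication by a determinant-one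
  multiple of \<open>V\<close> only permutes the unitaries.\<close>

lemma avg_clifford_invariant:
  fixes V :: "('q::finite \<Rightarrow> bool) op" and F :: "_ \<Rightarrow> 'b::real_vector"
  assumes V: "clifford V"
  shows "avg global_clifford_ensemble (\<lambda>\<psi>. F (cadj V ** \<psi> ** V)) = avg global_clifford_ensemble F"
proof -
  let ?G = "special_clifford :: ('q \<Rightarrow> bool) op set"
  obtain c where c: "c * cnj c = 1" and W: "cscale c V \<in> ?G"
    using special_clifford_multiple[OF V] by blast
  define W where "W = cscale c V"
  have W: "W \<in> ?G" "cadj W \<in> ?G" using W det_cadj[of W] clifford_cadj[of W] by (auto simp: W_def)
  then have uW: "unitary W" by (auto simp: clifford_def)
  have conj: "cadj V ** X ** V = cadj W ** X ** W" for X
    using c by (simp add: W_def cadj_cscale mult.commute)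
  have pmf: "pmf global_clifford_ensemble U = 1 / card ?G" if "U \<in> ?G" for U
    unfolding global_clifford_ensemble_def
    using finite_special_clifford mat1_special_clifford that by (subst pmf_of_set) auto
  have mult: "X ** Y \<in> ?G" if "X \<in> ?G" "Y \<in> ?G" for X Y
    using that by (auto simp: det_mul clifford_mult)
  have "(\<Sum>U\<in>?G. (1 / card ?G) *\<^sub>R (\<Sum>b\<in>UNIV. F (cadj W ** ketbra (cadj U *v ket b) ** W)))
      = (\<Sum>U\<in>?G. (1 / card ?G) *\<^sub>R (\<Sum>b\<in>UNIV. F (ketbra (cadj U *v ket b))))"
    by (rule sum.reindex_bij_witness[of _ "\<lambda>U. U ** cadj W" "\<lambda>U. U ** W"])
      (use W mult in \<open>auto simp: mult_right_cancel_unitary[OF uW] ketbra_cadj_mult\<close>)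
  moreover have "avg global_clifford_ensemble H
      = (\<Sum>U\<in>?G. (1 / card ?G) *\<^sub>R (\<Sum>b\<in>UNIV. H (ketbra (cadj U *v ket b))))" for H :: "_ \<Rightarrow> 'b"
    unfolding avg_def set_global_clifford_ensemble by (intro sum.cong refl) (simp only: pmf)
  ultimately show ?thesis by (simp only: conj)
qed

section \<open>Third moment of a random stabilizer state\<close>

lemma trace_pauli: "trace (pauli u) = (if u = pid then 2 ^ CARD('q) else 0)" for u :: "'q::finite pauli"
proof (cases "u = pid")
  case False
  then obtain r where "pcomm u r = -1" using pcomm_nontrivial by blast
  then have "trace (pauli r ** pauli u ** pauli r) = - trace (pauli u)"
    by (simp add: pauli_conj pcomm_sym[of r u])
  moreover have "trace (pauli r ** pauli u ** pauli r) = trace (pauli u)"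
    by (subst trace_mult_cycle, subst trace_mult_cycle) simp
  ultimately show ?thesis using False by simp
qed (simp add: trace_I card_fun)

text \<open>The third moment of a Haar random pure state: one product of traces for each permutation
  of three tensor factors, over \<open>d * (d + 1) * (d + 2)\<close> with \<open>d = 2 ^ n\<close>.
  The first factor is absent because \<open>avg\<close> sums over \<open>d\<close> outcomes.\<close>

definition moment_form ::
    "('q::finite \<Rightarrow> bool) op \<Rightarrow> ('q \<Rightarrow> bool) op \<Rightarrow> ('q \<Rightarrow> bool) op \<Rightarrow> complex" where
  "moment_form A B C = (trace A * trace B * trace C + trace A * trace (B ** C)
      + trace B * trace (A ** C) + trace C * trace (A ** B)
      + trace (A ** B ** C) + trace (A ** C ** B)) / ((2 ^ CARD('q) + 1) * (2 ^ CARD('q) + 2))"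

definition clifford_moment ::
    "('q::finite \<Rightarrow> bool) op \<Rightarrow> ('q \<Rightarrow> bool) op \<Rightarrow> ('q \<Rightarrow> bool) op \<Rightarrow> complex" where
  "clifford_moment A B C =
     avg global_clifford_ensemble (\<lambda>\<psi>. trace (A ** \<psi>) * trace (B ** \<psi>) * trace (C ** \<psi>))"

lemma unitary_conj_mult:
  "unitary V \<Longrightarrow> (V ** A ** cadj V) ** (V ** B ** cadj V) = V ** (A ** B) ** cadj V"
  by (simp add: mult_left_cancel_unitary flip: matrix_mul_assoc)

lemma trace_unitary_conj:
  assumes "unitary V"
  shows "trace (V ** A ** cadj V) = trace A"
proof -
  have "trace (V ** A ** cadj V) = trace (A ** cadj V ** V)" by (rule trace_mult_cycle)
  then show ?thesis by (simp add: mult_right_cancel_unitary[OF assms])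
qed

lemma moment_form_add: "moment_form (A + A') B C = moment_form A B C + moment_form A' B C"
  unfolding moment_form_def add_divide_distrib[symmetric]
  by (rule arg_cong[of _ _ "\<lambda>x. x / _"])
    (simp add: matrix_add_rdistrib trace_add algebra_simps)

lemma moment_form_cscale: "moment_form (cscale c A) B C = c * moment_form A B C"
  by (simp add: moment_form_def algebra_simps)

interpretation clifford_form: invariant_form "\<lambda>A B C. clifford_moment A B C - moment_form A B C"
proof
  fix A A' B C :: "('q::finite \<Rightarrow> bool) op" and c :: complex
  show "clifford_moment (A + A') B C - moment_form (A + A') B C
      = (clifford_moment A B C - moment_form A B C) + (clifford_moment A' B C - moment_form A' B C)"
    by (simp add: clifford_moment_def moment_form_add matrix_add_rdistrib trace_add distrib_right avg_add)
  show "clifford_moment (cscale c A) B C - moment_form (cscale c A) B C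
      = c * (clifford_moment A B C - moment_form A B C)"
    by (simp add: clifford_moment_def moment_form_cscale mult.assoc avg_mult_left right_diff_distrib)
  show "clifford_moment A B C - moment_form A B C = clifford_moment B A C - moment_form B A C"
    unfolding clifford_moment_def moment_form_def
    by (simp add: mult_ac add_ac trace_mul_sym[of B A] trace_mult_cycle[of B A C] trace_mult_cycle[of A B C])
  show "clifford_moment A B C - moment_form A B C = clifford_moment A C B - moment_form A C B"
    unfolding clifford_moment_def moment_form_def
    by (simp add: mult_ac add_ac trace_mul_sym[of C B])
next
  fix V A B C :: "('q::finite \<Rightarrow> bool) op"
  assume V: "clifford V"
  then have u: "unitary V" by (simp add: clifford_def)
  have "trace ((V ** X ** cadj V) ** \<psi>) = trace (X ** (cadj V ** \<psi> ** V))" for X \<psi>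
    using trace_mult_cycle[of V "X ** cadj V" \<psi>] by (simp add: matrix_mul_assoc)
  then have "clifford_moment (V ** A ** cadj V) (V ** B ** cadj V) (V ** C ** cadj V) = clifford_moment A B C"
    unfolding clifford_moment_def
    using avg_clifford_invariant[OF V, of "\<lambda>\<psi>. trace (A ** \<psi>) * trace (B ** \<psi>) * trace (C ** \<psi>)"]
    by simp
  moreover have "moment_form (V ** A ** cadj V) (V ** B ** cadj V) (V ** C ** cadj V) = moment_form A B C"
    unfolding moment_form_def unitary_conj_mult[OF u] trace_unitary_conj[OF u] ..
  ultimately show "clifford_moment (V ** A ** cadj V) (V ** B ** cadj V) (V ** C ** cadj V)
      - moment_form (V ** A ** cadj V) (V ** B ** cadj V) (V ** C ** cadj V)
      = clifford_moment A B C - moment_form A B C" by simp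
qed

lemma avg_const_clifford:
  "avg global_clifford_ensemble (\<lambda>\<psi> :: ('q::finite \<Rightarrow> bool) op. c) = (2 ^ CARD('q) * c :: complex)"
  by (subst avg_const) (simp_all add: finite_special_clifford card_fun)

text \<open>By the Pauli expansion and purity, the three test sums are the constants 1,
  \<open>d\<close> and \<open>d * d\<close> before averaging, hence \<open>d\<close>,
  \<open>d ^ 2\<close> and \<open>d ^ 3\<close> after it. The explicit formula has to reproduce
  these three numbers.\<close>

lemma clifford_third_moment:
  fixes A B C :: "('q::finite \<Rightarrow> bool) op"
  shows "clifford_moment A B C = moment_form A B C"
proof -
  define d :: complex where "d = 2 ^ CARD('q)"
  have d: "(d + 1) * (d + 2) \<noteq> 0"
  proof -
    have "d + 1 = of_nat (2 ^ CARD('q) + 1)" "d + 2 = of_nat (2 ^ CARD('q) + 2)"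
      by (simp_all add: d_def)
    moreover have "2 ^ CARD('q) + 1 \<noteq> (0 :: nat)" "2 ^ CARD('q) + 2 \<noteq> (0 :: nat)" by simp_all
    ultimately show ?thesis by (simp only: mult_eq_0_iff of_nat_eq_0_iff) simp
  qed
  let ?T = "\<lambda>u :: 'q pauli. trace (pauli u)"
  have card: "of_nat CARD('q pauli) = d * d"
    by (simp add: d_def card_fun flip: power_mult_distrib)
  have tr1: "trace (mat 1 :: ('q \<Rightarrow> bool) op) = d" by (simp add: trace_I card_fun d_def)
  have sq: "(\<Sum>u\<in>UNIV. ?T u * ?T u) = d * d"
    using trace_pauli_expansion[of "mat 1 :: ('q \<Rightarrow> bool) op" "mat 1"] by (simp add: tr1 d_def[symmetric])
  have pure: "trace \<psi> = 1" "\<psi> ** \<psi> = \<psi>"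
    if "\<psi> = ketbra (cadj U *v ket b)" "U \<in> set_pmf global_clifford_ensemble" for \<psi> U and b :: "'q \<Rightarrow> bool"
    using that trace_ketbra_unitary[of U b] ketbra_mult_ketbra[of "cadj U *v ket b"]
    by (auto simp: clifford_def)
  have avg_c: "avg global_clifford_ensemble (\<lambda>\<psi> :: ('q \<Rightarrow> bool) op. c) = d * c" for c :: complex
    unfolding d_def by (rule avg_const_clifford)

  have "clifford_moment (mat 1) (mat 1) (mat 1 :: ('q \<Rightarrow> bool) op) = d"
  proof -
    have "clifford_moment (mat 1) (mat 1) (mat 1 :: ('q \<Rightarrow> bool) op)
        = avg global_clifford_ensemble (\<lambda>\<psi> :: ('q \<Rightarrow> bool) op. 1)"
      unfolding clifford_moment_def by (intro avg_cong) (simp add: pure)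
    then show ?thesis by (simp add: avg_c)
  qed
  moreover have "moment_form (mat 1) (mat 1) (mat 1 :: ('q \<Rightarrow> bool) op) = d"
    using d unfolding moment_form_def d_def[symmetric] by (simp add: tr1 field_simps)
  ultimately have n1: "clifford_moment (mat 1) (mat 1) (mat 1 :: ('q \<Rightarrow> bool) op) - moment_form (mat 1) (mat 1) (mat 1 :: ('q \<Rightarrow> bool) op) = 0"
    by simp

  have "(\<Sum>u :: 'q pauli\<in>UNIV. clifford_moment (pauli u) (mat 1) (pauli u)) = d * d"
  proof -
    have "(\<Sum>u :: 'q pauli\<in>UNIV. clifford_moment (pauli u) (mat 1) (pauli u))
        = avg global_clifford_ensemble (\<lambda>\<psi> :: ('q \<Rightarrow> bool) op.
            \<Sum>u\<in>UNIV. trace (pauli u ** \<psi>) * trace (mat 1 ** \<psi>) * trace (pauli u ** \<psi>))"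
      unfolding clifford_moment_def avg_sum ..
    also have "\<dots> = avg global_clifford_ensemble (\<lambda>\<psi> :: ('q \<Rightarrow> bool) op. d)"
    proof (rule avg_cong)
      fix U :: "('q \<Rightarrow> bool) op" and b assume U: "U \<in> set_pmf global_clifford_ensemble"
      let ?\<psi> = "ketbra (cadj U *v ket b)"
      show "(\<Sum>u\<in>UNIV. trace (pauli u ** ?\<psi>) * trace (mat 1 ** ?\<psi>) * trace (pauli u ** ?\<psi>)) = d"
        using trace_pauli_expansion[of ?\<psi> ?\<psi>] pure[OF refl U] by (simp add: d_def)
    qed
    finally show ?thesis by (simp add: avg_c)
  qed
  moreover have "(\<Sum>u :: 'q pauli\<in>UNIV. moment_form (pauli u) (mat 1) (pauli u)) = d * d"
  proof -
    have "(\<Sum>u :: 'q pauli\<in>UNIV. moment_form (pauli u) (mat 1) (pauli u))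
        = (\<Sum>u :: 'q pauli\<in>UNIV. (d + 2) * (?T u * ?T u) + (d * d + 2 * d)) / ((d + 1) * (d + 2))"
      unfolding moment_form_def d_def[symmetric] sum_divide_distrib
      by (intro sum.cong refl) (simp add: tr1 algebra_simps)
    also have "(\<Sum>u :: 'q pauli\<in>UNIV. (d + 2) * (?T u * ?T u) + (d * d + 2 * d))
        = (d + 2) * (d * d) + (d * d) * (d * d + 2 * d)"
      by (simp only: sum.distrib sum_distrib_left[symmetric] sq sum_constant card) (simp add: algebra_simps)
    also have "\<dots> = (d * d) * ((d + 1) * (d + 2))" by (simp add: algebra_simps)
    finally show ?thesis using d by simp
  qed
  ultimately have n2: "(\<Sum>u :: 'q pauli\<in>UNIV. clifford_moment (pauli u) (mat 1) (pauli u)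
      - moment_form (pauli u) (mat 1) (pauli u)) = 0"
    by (simp add: sum_subtractf)

  have "(\<Sum>u :: 'q pauli\<in>UNIV. \<Sum>v\<in>UNIV. clifford_moment (pauli u) (pauli v) (pauli u ** pauli v)) = d * (d * d)"
  proof -
    have "(\<Sum>u :: 'q pauli\<in>UNIV. \<Sum>v\<in>UNIV. clifford_moment (pauli u) (pauli v) (pauli u ** pauli v))
        = avg global_clifford_ensemble (\<lambda>\<psi> :: ('q \<Rightarrow> bool) op. \<Sum>u\<in>UNIV. \<Sum>v\<in>UNIV.
            trace (pauli u ** \<psi>) * trace (pauli v ** \<psi>) * trace (pauli u ** pauli v ** \<psi>))"
      unfolding clifford_moment_def avg_sum ..
    also have "\<dots> = avg global_clifford_ensemble (\<lambda>\<psi> :: ('q \<Rightarrow> bool) op. d * d)"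
    proof (rule avg_cong)
      fix U :: "('q \<Rightarrow> bool) op" and b assume U: "U \<in> set_pmf global_clifford_ensemble"
      let ?\<psi> = "ketbra (cadj U *v ket b)"
      have "(\<Sum>v\<in>UNIV. trace (pauli u ** ?\<psi>) * trace (pauli v ** ?\<psi>) * trace (pauli u ** pauli v ** ?\<psi>))
          = d * (trace (pauli u ** ?\<psi>) * trace (pauli u ** ?\<psi>))" for u
      proof -
        have "trace (pauli u ** pauli v ** ?\<psi>) = trace (pauli v ** (?\<psi> ** pauli u))" for v
          using trace_mult_cycle[of "pauli u" "pauli v" ?\<psi>] by (simp add: matrix_mul_assoc)
        then have "(\<Sum>v\<in>UNIV. trace (pauli u ** ?\<psi>) * trace (pauli v ** ?\<psi>) * trace (pauli u ** pauli v ** ?\<psi>))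
          = trace (pauli u ** ?\<psi>) * (\<Sum>v\<in>UNIV. trace (pauli v ** ?\<psi>) * trace (pauli v ** (?\<psi> ** pauli u)))"
          by (simp add: sum_distrib_left mult.assoc)
        also have "\<dots> = trace (pauli u ** ?\<psi>) * (d * trace (?\<psi> ** (?\<psi> ** pauli u)))"
          unfolding trace_pauli_expansion d_def ..
        also have "?\<psi> ** (?\<psi> ** pauli u) = ?\<psi> ** pauli u"
          by (simp add: matrix_mul_assoc pure[OF refl U])
        finally show ?thesis by (simp add: trace_mul_sym[of ?\<psi>] mult_ac)
      qed
      then show "(\<Sum>u\<in>UNIV. \<Sum>v\<in>UNIV.
            trace (pauli u ** ?\<psi>) * trace (pauli v ** ?\<psi>) * trace (pauli u ** pauli v ** ?\<psi>)) = d * d"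
        using trace_pauli_expansion[of ?\<psi> ?\<psi>] pure[OF refl U]
        by (simp add: d_def flip: sum_distrib_left)
    qed
    finally show ?thesis by (simp add: avg_c)
  qed
  moreover have "(\<Sum>u :: 'q pauli\<in>UNIV. \<Sum>v\<in>UNIV. moment_form (pauli u) (pauli v) (pauli u ** pauli v)) = d * (d * d)"
  proof -
    have cyc: "trace (pauli v ** (pauli u ** pauli v)) = ?T u" for u v :: "'q pauli"
      by (subst trace_mul_sym) (simp flip: matrix_mul_assoc)
    have cyc2: "trace (pauli u ** (pauli u ** pauli v)) = ?T v" for u v :: "'q pauli"
      by (simp add: matrix_mul_assoc)
    have cyc3: "trace (pauli u ** (pauli u ** pauli v) ** pauli v) = d" for u v :: "'q pauli"
    proof -
      have "pauli u ** (pauli u ** pauli v) ** pauli v = (pauli u ** pauli u) ** (pauli v ** pauli v)"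
        by (simp only: matrix_mul_assoc)
      then show ?thesis by (simp add: tr1)
    qed
    \<comment> \<open>The twirl turns the sum of the conjugates of \<open>pauli v\<close> into a
      scalar, \<open>d\<close> times its trace.\<close>
    have e: "(\<Sum>u\<in>UNIV. trace (pauli u ** pauli v ** (pauli u ** pauli v))) = d * (?T v * ?T v)"
      for v :: "'q pauli"
    proof -
      have "(\<Sum>u\<in>UNIV. trace (pauli u ** pauli v ** (pauli u ** pauli v)))
          = trace ((\<Sum>u\<in>UNIV. pauli u ** pauli v ** pauli u) ** pauli v)"
        by (simp add: mult_sum_left trace_sum matrix_mul_assoc)
      then show ?thesis by (simp add: pauli_twirl d_def)
    qed
    have a: "(\<Sum>v\<in>UNIV. ?T u * ?T v * trace (pauli u ** pauli v)) = d * (?T u * ?T u)" for u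
    proof -
      have "(\<Sum>v\<in>UNIV. ?T u * ?T v * trace (pauli u ** pauli v))
          = ?T u * (\<Sum>v\<in>UNIV. trace (pauli v ** mat 1) * trace (pauli v ** pauli u))"
        by (simp add: sum_distrib_left mult.assoc trace_mul_sym[of "pauli u"])
      then show ?thesis unfolding trace_pauli_expansion by (simp add: d_def)
    qed
    have dd: "(\<Sum>v\<in>UNIV. trace (pauli u ** pauli v) * trace (pauli u ** pauli v)) = d * d" for u :: "'q pauli"
      using trace_pauli_expansion[of "pauli u" "pauli u"]
      by (simp add: trace_mul_sym[of "pauli u"] tr1 d_def[symmetric])
    \<comment> \<open>One summand per permutation. Squares of Pauli operators have been cancelled by
      cyclicity; only the fifth summand keeps four factors.\<close>
    have "(\<Sum>u :: 'q pauli\<in>UNIV. \<Sum>v\<in>UNIV. moment_form (pauli u) (pauli v) (pauli u ** pauli v))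
        = (\<Sum>u :: 'q pauli\<in>UNIV. \<Sum>v\<in>UNIV. ?T u * ?T v * trace (pauli u ** pauli v)
            + ?T u * ?T u + ?T v * ?T v + trace (pauli u ** pauli v) * trace (pauli u ** pauli v)
            + trace (pauli u ** pauli v ** (pauli u ** pauli v)) + d) / ((d + 1) * (d + 2))"
      by (simp only: moment_form_def d_def[symmetric] sum_divide_distrib cyc cyc2 cyc3)
    also have "(\<Sum>u :: 'q pauli\<in>UNIV. \<Sum>v\<in>UNIV. ?T u * ?T v * trace (pauli u ** pauli v)
            + ?T u * ?T u + ?T v * ?T v + trace (pauli u ** pauli v) * trace (pauli u ** pauli v)
            + trace (pauli u ** pauli v ** (pauli u ** pauli v)) + d)
        = d * (d * d) + (d * d) * (d * d) + (d * d) * (d * d) + (d * d) * (d * d) + d * (d * d)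
            + (d * d) * ((d * d) * d)"
    proof -
      have "(\<Sum>u :: 'q pauli\<in>UNIV. \<Sum>v\<in>UNIV. trace (pauli u ** pauli v ** (pauli u ** pauli v))) = d * (d * d)"
        by (subst sum.swap) (simp only: e sum_distrib_left[symmetric] sq)
      moreover have "(\<Sum>u :: 'q pauli\<in>UNIV. \<Sum>v :: 'q pauli\<in>UNIV. ?T u * ?T u) = (d * d) * (d * d)"
        by (simp only: sum_constant card sum_distrib_left[symmetric] sq)
      ultimately show ?thesis
        by (simp only: sum.distrib a dd sum_distrib_left[symmetric] sq sum_constant card)
          (simp only: mult.assoc)
    qed
    also have "\<dots> = (d * (d * d)) * ((d + 1) * (d + 2))" by (simp add: algebra_simps)
    finally show ?thesis using d by simp
  qed
  ultimately have n3: "(\<Sum>u :: 'q pauli\<in>UNIV. \<Sum>v\<in>UNIV. clifford_moment (pauli u) (pauli v) (pauli u ** pauli v)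
      - moment_form (pauli u) (pauli v) (pauli u ** pauli v)) = 0"
    by (simp add: sum_subtractf)
  show ?thesis using clifford_form.form_eq_zero[OF n1 n2 n3, of A B C] by simp
qed

section \<open>Positive operators and the operator norm\<close>

text \<open>The condition of \<open>block_psd\<close> for a one-dimensional ancilla, so that
  complete positivity applies to it directly.\<close>

definition psd :: "'a::finite op \<Rightarrow> bool" where
  "psd A \<longleftrightarrow> (\<forall>x :: (complex, 'a) vec.
     (\<Sum>a\<in>UNIV. \<Sum>b\<in>UNIV. cnj (x $ a) * A $ a $ b * x $ b) \<in> \<real>\<^sub>\<ge>\<^sub>0)"

text \<open>The entry is the quadratic form at the conjugate of row \<open>k\<close> of
  \<open>Y\<close>.\<close>

lemma psd_conj_diagonal:
  assumes "psd \<sigma>"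
  shows "(Y ** \<sigma> ** cadj Y) $ k $ k \<in> \<real>\<^sub>\<ge>\<^sub>0"
proof -
  have "(Y ** \<sigma> ** cadj Y) $ k $ k
      = (\<Sum>b\<in>UNIV. \<Sum>a\<in>UNIV. cnj ((\<chi> a. cnj (Y $ k $ a)) $ a) * \<sigma> $ a $ b * (\<chi> a. cnj (Y $ k $ a)) $ b)"
    by (simp add: mult_nth sum_distrib_right)
  also have "\<dots> = (\<Sum>a\<in>UNIV. \<Sum>b\<in>UNIV. cnj ((\<chi> a. cnj (Y $ k $ a)) $ a) * \<sigma> $ a $ b * (\<chi> a. cnj (Y $ k $ a)) $ b)"
    by (rule sum.swap)
  finally show ?thesis
    using assms[unfolded psd_def, rule_format, of "\<chi> a. cnj (Y $ k $ a)"] by (simp only:)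
qed

lemma psd_trace_square:
  assumes "psd \<sigma>"
  shows "trace (cadj Y ** Y ** \<sigma>) \<in> \<real>\<^sub>\<ge>\<^sub>0"
proof -
  have "trace (cadj Y ** Y ** \<sigma>) = trace (Y ** \<sigma> ** cadj Y)" by (rule trace_mult_cycle)
  then show ?thesis using psd_conj_diagonal[OF assms, of Y]
    by (auto simp: trace_def complex_nonneg_Reals_iff intro: sum_nonneg)
qed

lemma psd_ketbra: "psd (ketbra v)"
proof -
  have "(\<Sum>a\<in>UNIV. \<Sum>b\<in>UNIV. cnj (x $ a) * ketbra v $ a $ b * x $ b)
      = (\<Sum>a\<in>UNIV. cnj (x $ a) * v $ a) * cnj (\<Sum>a\<in>UNIV. cnj (x $ a) * v $ a)" for x
    unfolding cnj_sum sum_product by (simp add: mult_ac)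
  then show ?thesis unfolding psd_def by (simp only: complex_mult_cnj complex_nonneg_Reals_iff) simp
qed

lemma psd_scaled_mat1:
  assumes "r \<ge> 0"
  shows "psd (cscale (complex_of_real r) (mat 1 :: 'a::finite op))"
proof -
  have "(\<Sum>a\<in>UNIV. \<Sum>b\<in>UNIV. cnj (x $ a) * cscale (complex_of_real r) (mat 1) $ a $ b * x $ b)
      = (\<Sum>a\<in>UNIV. complex_of_real (r * (cmod (x $ a))\<^sup>2))" for x :: "(complex, 'a) vec"
  proof (intro sum.cong refl)
    fix a
    have "(\<Sum>b\<in>UNIV. cnj (x $ a) * cscale (complex_of_real r) (mat 1) $ a $ b * x $ b)
        = (\<Sum>b\<in>UNIV. if a = b then complex_of_real r * (x $ a * cnj (x $ a)) else 0)"
      by (intro sum.cong refl) (simp add: mat_def)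
    then show "(\<Sum>b\<in>UNIV. cnj (x $ a) * cscale (complex_of_real r) (mat 1) $ a $ b * x $ b)
        = complex_of_real (r * (cmod (x $ a))\<^sup>2)"
      by (simp add: complex_norm_square[symmetric])
  qed
  then show ?thesis unfolding psd_def using assms
    by (auto simp: complex_nonneg_Reals_iff intro!: sum_nonneg)
qed

section \<open>Bounds by the operator norm\<close>

lemma opnorm_nonneg: "0 \<le> opnorm A"
  unfolding opnorm_def by (rule onorm_pos_le) simp

lemma opnorm_mult: "opnorm (A ** B) \<le> opnorm A * opnorm B"
proof -
  have "(*v) (A ** B) = (*v) A \<circ> (*v) B" by (auto simp: matrix_vector_mul_assoc)
  then show ?thesis unfolding opnorm_def by (metis matrix_vector_mul_bounded_linear onorm_compose)
qed

lemma norm_ket [simp]: "norm (ket b) = 1"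
proof -
  have "(\<Sum>i\<in>UNIV. (cmod (axis b 1 $ i))\<^sup>2) = (\<Sum>i\<in>UNIV. if b = i then 1 else 0)"
    by (intro sum.cong) (auto simp: axis_def)
  then show ?thesis by (simp add: ket_def norm_vec_def L2_set_def)
qed

lemma mult_ket_nth: "(A *v ket b) $ a = A $ a $ b"
proof -
  have "(A *v ket b) $ a = (\<Sum>k\<in>UNIV. if b = k then A $ a $ k else 0)"
    by (simp add: matrix_vector_mult_def ket_def axis_def if_distrib[of "(*) _"] cong: if_cong)
  then show ?thesis by simp
qed

lemma norm_mult_ket_le: "norm (A *v ket b) \<le> opnorm A"
  using onorm[of "(*v) A" "ket b"] by (simp add: opnorm_def)

lemma entry_le_opnorm: "cmod (A $ a $ b) \<le> opnorm A"
  using Finite_Cartesian_Product.norm_nth_le[of "A *v ket b" a] norm_mult_ket_le[of A b] by (simp add: mult_ket_nth)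

text \<open>The trace is the squared Frobenius norm, a sum of squared column norms, and each column
  is the image of a basis vector.\<close>

lemma trace_cadj_mult_le: "Re (trace (cadj A ** A)) \<le> CARD('a) * (opnorm A)\<^sup>2" for A :: "'a::finite op"
proof -
  have "Re (trace (cadj A ** A)) = (\<Sum>b\<in>UNIV. (norm (A *v ket b))\<^sup>2)"
  proof -
    have "(norm (A *v ket b))\<^sup>2 = (\<Sum>a\<in>UNIV. (cmod (A $ a $ b))\<^sup>2)" for b
      by (simp add: norm_vec_def L2_set_def sum_nonneg mult_ket_nth)
    moreover have "Re (cnj z * z) = (cmod z)\<^sup>2" for z
      by (simp add: cmod_power2) (simp add: power2_eq_square)
    ultimately show ?thesis by (simp add: trace_mult)
  qed
  also have "\<dots> \<le> (\<Sum>b\<in>(UNIV :: 'a set). (opnorm A)\<^sup>2)"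
    by (intro sum_mono power_mono norm_mult_ket_le) simp
  finally show ?thesis by simp
qed

lemma hermitian_mat1: "hermitian (mat 1)"
  by (simp add: hermitian_def)

lemma hermitian_add: "hermitian A \<Longrightarrow> hermitian B \<Longrightarrow> hermitian (A + B)"
  by (simp add: hermitian_def cadj_add)

lemma hermitian_cscale: "hermitian A \<Longrightarrow> c \<in> \<real> \<Longrightarrow> hermitian (cscale c A)"
  by (simp add: hermitian_def cadj_cscale Reals_cnj_iff)

lemma hermitian_square: "hermitian A \<Longrightarrow> hermitian (A ** A)"
  by (simp add: hermitian_def cadj_mult)

lemma psd_trace_hermitian_square:
  "psd \<sigma> \<Longrightarrow> hermitian A \<Longrightarrow> trace (A ** A ** \<sigma>) \<in> \<real>\<^sub>\<ge>\<^sub>0"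
  using psd_trace_square[of \<sigma> A] by (simp add: hermitian_def)

text \<open>Polarization: the traces of the squares of \<open>A + 1\<close> and \<open>A - 1\<close>
  against the state are real, and they differ by four times the trace in question.\<close>

lemma psd_trace_real:
  assumes "psd \<sigma>" "hermitian A"
  shows "trace (A ** \<sigma>) \<in> \<real>"
proof -
  have pos: "hermitian (A + cscale c (mat 1))" if "c \<in> \<real>" for c
    using that assms(2) by (intro hermitian_add hermitian_cscale hermitian_mat1)
  have "trace ((A + cscale c (mat 1)) ** (A + cscale c (mat 1)) ** \<sigma>)
      = trace (A ** A ** \<sigma>) + 2 * c * trace (A ** \<sigma>) + c * c * trace \<sigma>" for c
    by (simp add: matrix_add_rdistrib matrix_add_ldistrib trace_add algebra_simps)
  then have "trace (A ** A ** \<sigma>) + 2 * c * trace (A ** \<sigma>) + c * c * trace \<sigma> \<in> \<real>\<^sub>\<ge>\<^sub>0" if "c \<in> \<real>" for c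
    using psd_trace_hermitian_square[OF assms(1) pos[OF that]] by simp
  from this[of 1] this[of "-1"] have "Im (trace (A ** \<sigma>)) = 0"
    by (simp add: complex_nonneg_Reals_iff)
  then show ?thesis by (simp add: complex_is_Real_iff)
qed

text \<open>The variance of an observable is nonnegative.\<close>

lemma psd_trace_cauchy_schwarz:
  assumes "psd \<sigma>" "trace \<sigma> = 1" "hermitian A"
  shows "(Re (trace (A ** \<sigma>)))\<^sup>2 \<le> Re (trace (A ** A ** \<sigma>))"
proof -
  define c where "c = complex_of_real (- Re (trace (A ** \<sigma>)))"
  have c: "trace (A ** \<sigma>) = - c"
    using psd_trace_real[OF assms(1,3)] by (simp add: c_def)
  have "hermitian (A + cscale c (mat 1))"
    using assms(3) by (intro hermitian_add hermitian_cscale hermitian_mat1) (auto simp: c_def)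
  from psd_trace_hermitian_square[OF assms(1) this]
  have "trace (A ** A ** \<sigma>) + c * trace (A ** \<sigma>) + c * trace (A ** \<sigma>) + c * c \<in> \<real>\<^sub>\<ge>\<^sub>0"
    by (simp add: matrix_add_rdistrib matrix_add_ldistrib trace_add assms(2) algebra_simps)
  then show ?thesis unfolding c by (simp add: complex_nonneg_Reals_iff c_def power2_eq_square)
qed

text \<open>A crude bound suffices: its constant only has to be independent of \<open>A\<close>,
  because powers of an operator will be inserted.\<close>

lemma trace_mult_le_opnorm:
  shows "cmod (trace (A ** \<sigma>)) \<le> opnorm A * (\<Sum>i\<in>UNIV. \<Sum>j\<in>UNIV. cmod (\<sigma> $ j $ i))"
proof -
  have "cmod (trace (A ** \<sigma>)) \<le> (\<Sum>i\<in>UNIV. \<Sum>j\<in>UNIV. cmod (A $ i $ j * \<sigma> $ j $ i))"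
    unfolding trace_mult by (intro order_trans[OF norm_sum] sum_mono norm_sum)
  also have "\<dots> \<le> (\<Sum>i\<in>UNIV. \<Sum>j\<in>UNIV. opnorm A * cmod (\<sigma> $ j $ i))"
    unfolding norm_mult by (intro sum_mono mult_right_mono entry_le_opnorm) simp
  finally show ?thesis by (simp add: sum_distrib_left)
qed

text \<open>
  Iterating Cauchy--Schwarz gives \<open>\<bar>f A\<bar> ^ (2 ^ k) \<le> f (A ^ (2 ^ k)) \<le> C * opnorm A ^ (2 ^ k)\<close> for the
  functional \<open>f X = trace (X ** \<sigma>)\<close>, and the constant disappears as \<open>k\<close> grows.
\<close>

lemma psd_trace_le_opnorm:
  assumes \<sigma>: "psd \<sigma>" "trace \<sigma> = 1" and A: "hermitian A"
  shows "Re (trace (A ** \<sigma>)) \<le> opnorm A"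
proof (rule ccontr)
  assume "\<not> Re (trace (A ** \<sigma>)) \<le> opnorm A"
  then have gt: "opnorm A < \<bar>Re (trace (A ** \<sigma>))\<bar>" by simp
  define P where "P k = ((\<lambda>X. X ** X) ^^ k) A" for k
  define C where "C = (\<Sum>i\<in>UNIV. \<Sum>j\<in>UNIV. cmod (\<sigma> $ j $ i))"
  have P: "P 0 = A" "P (Suc k) = P k ** P k" for k by (simp_all add: P_def)
  have herm: "hermitian (P k)" for k by (induction k) (simp_all add: P A hermitian_square)
  have opn: "opnorm (P k) \<le> opnorm A ^ (2 ^ k)" for k
  proof (induction k)
    case (Suc k)
    have "opnorm (P (Suc k)) \<le> opnorm (P k) * opnorm (P k)" unfolding P by (rule opnorm_mult)
    also have "\<dots> \<le> opnorm A ^ (2 ^ k) * opnorm A ^ (2 ^ k)"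
      using Suc opnorm_nonneg by (intro mult_mono) auto
    finally show ?case by (simp add: mult_2 power_add)
  qed (simp add: P)
  have lower: "\<bar>Re (trace (A ** \<sigma>))\<bar> ^ (2 ^ k) \<le> \<bar>Re (trace (P k ** \<sigma>))\<bar>" for k
  proof (induction k)
    case (Suc k)
    have "\<bar>Re (trace (A ** \<sigma>))\<bar> ^ (2 ^ Suc k) = (\<bar>Re (trace (A ** \<sigma>))\<bar> ^ (2 ^ k))\<^sup>2"
      by (simp flip: power_mult add: mult.commute)
    also have "\<dots> \<le> \<bar>Re (trace (P k ** \<sigma>))\<bar>\<^sup>2" using Suc by (intro power_mono) auto
    also have "\<dots> \<le> Re (trace (P (Suc k) ** \<sigma>))"
      using psd_trace_cauchy_schwarz[OF \<sigma> herm[of k]] by (simp add: P)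
    finally show ?case by simp
  qed (simp add: P)
  have C: "C \<ge> 0" unfolding C_def by (intro sum_nonneg) simp
  have upper: "\<bar>Re (trace (A ** \<sigma>))\<bar> ^ (2 ^ k) \<le> opnorm A ^ (2 ^ k) * C" for k
  proof -
    have "\<bar>Re (trace (P k ** \<sigma>))\<bar> \<le> opnorm (P k) * C"
      using trace_mult_le_opnorm[of "P k" \<sigma>] abs_Re_le_cmod[of "trace (P k ** \<sigma>)"] by (simp add: C_def)
    also have "\<dots> \<le> opnorm A ^ (2 ^ k) * C" using opn C by (intro mult_right_mono) auto
    finally show ?thesis using lower[of k] by simp
  qed
  have pos: "opnorm A > 0"
  proof (rule ccontr)
    assume "\<not> opnorm A > 0"
    then have "opnorm A = 0" using opnorm_nonneg[of A] by simp
    then show False using upper[of 0] gt by simp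
  qed
  define y where "y = \<bar>Re (trace (A ** \<sigma>))\<bar> / opnorm A"
  have y: "y > 1" using gt pos by (simp add: y_def)
  then obtain m where "C < y ^ m" using real_arch_pow by blast
  \<comment> \<open>The exponent \<open>m\<close> also serves as the number of squarings, because
    \<open>m < 2 ^ m\<close>.\<close>
  also have "\<dots> \<le> y ^ (2 ^ m)" using y less_exp[of m] by (intro power_increasing) auto
  also have "\<dots> \<le> C" using upper[of m] pos by (simp add: y_def power_divide field_simps)
  finally show False by simp
qed

section \<open>Ensembles with Pauli-diagonal measurement map\<close>

text \<open>The Pauli expansion of the trace of M^-1(A) B for a map M with eigenvalue
  \<open>l u\<close> on \<open>pauli u\<close>; \<open>2 ^ n\<close> is the squared Hilbert-Schmidt
  norm of a Pauli operator.\<close>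

definition shadow_form ::
    "('q::finite pauli \<Rightarrow> real) \<Rightarrow> ('q \<Rightarrow> bool) op \<Rightarrow> ('q \<Rightarrow> bool) op \<Rightarrow> complex" where
  "shadow_form l A B =
     (\<Sum>u\<in>UNIV. trace (pauli u ** A) * trace (pauli u ** B) / (2 ^ CARD('q) * l u))"

definition shadow_inv :: "('q::finite pauli \<Rightarrow> real) \<Rightarrow> ('q \<Rightarrow> bool) op \<Rightarrow> ('q \<Rightarrow> bool) op" where
  "shadow_inv l A = (\<Sum>u\<in>UNIV. cscale (trace (pauli u ** A) / (2 ^ CARD('q) * l u)) (pauli u))"

definition pauli_diagonal :: "('q::finite \<Rightarrow> bool) op pmf \<Rightarrow> ('q pauli \<Rightarrow> real) \<Rightarrow> bool" where
  "pauli_diagonal p l \<longleftrightarrow> finite (set_pmf p) \<and> (\<forall>U\<in>set_pmf p. unitary U) \<and> (\<forall>u. l u \<noteq> 0) \<and>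
     (\<forall>u. measurement_map p (pauli u) = cscale (l u) (pauli u))"

lemma trace_shadow_inv: "trace (shadow_inv l A ** B) = shadow_form l A B"
  unfolding shadow_inv_def shadow_form_def by (simp add: mult_sum_left trace_sum)

lemma shadow_form_sym: "shadow_form l A B = shadow_form l B A"
  unfolding shadow_form_def by (simp add: mult.commute)

lemma shadow_form_real:
  fixes A B :: "('q::finite \<Rightarrow> bool) op"
  assumes "hermitian A" "hermitian B"
  shows "shadow_form l A B \<in> \<real>"
proof -
  have "2 ^ CARD('q) * complex_of_real (l u) = of_real (2 ^ CARD('q) * l u)" for u by simp
  then show ?thesis
    unfolding shadow_form_def using hermitian_trace_mult_real[OF hermitian_pauli] assms
    by (intro sum_in_Reals Reals_divide Reals_mult) (simp_all only: Reals_of_real)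
qed

text \<open>Both traces pick up the same sign. Hence the transposition of the prepared state in a
  shadow cancels the one of \<open>\<rho>\<close> in the estimator.\<close>

lemma shadow_form_transpose:
  "shadow_form l (transpose A) (transpose B) = shadow_form l A B"
proof -
  have *: "trace (pauli u ** transpose X) = trace (transpose (pauli u) ** X)" for X u
  proof -
    have "trace (pauli u ** transpose X) = trace (transpose (pauli u ** transpose X))"
      by (simp add: trace_def transpose_def)
    also have "\<dots> = trace (X ** transpose (pauli u))" by (simp add: matrix_transpose_mul)
    also have "\<dots> = trace (transpose (pauli u) ** X)" by (rule trace_mul_sym)
    finally show ?thesis .
  qed
  have "trace (pauli u ** transpose A) * trace (pauli u ** transpose B)
      = trace (pauli u ** A) * trace (pauli u ** B)" for u
    unfolding * using transpose_pauli[of u] by (elim disjE) (simp_all only: cscale_mult_left trace_cscale, simp)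
  then show ?thesis by (simp only: shadow_form_def)
qed

text \<open>The reconstruction formula behind unbiasedness: averaging the states, weighted by their
  shadow estimates, applies the measurement map to its own inverse.\<close>

lemma avg_shadow_form:
  fixes p :: "('q::finite \<Rightarrow> bool) op pmf"
  assumes "pauli_diagonal p l"
  shows "avg p (\<lambda>\<psi>. cscale (shadow_form l \<psi> A) \<psi>) = A"
proof -
  have fin: "finite (set_pmf p)" and l: "l u \<noteq> 0"
    and M: "measurement_map p (pauli u) = cscale (l u) (pauli u)" for u
    using assms by (auto simp: pauli_diagonal_def)
  have lin: "linear (cscale c :: ('q \<Rightarrow> bool) op \<Rightarrow> _)" for c
    by (intro linearI) (simp_all add: cscale_add scaleR_eq_cscale mult.commute)
  have "cscale (shadow_form l \<psi> A) \<psi> = (\<Sum>u\<in>UNIV.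
      cscale (trace (pauli u ** A) / (2 ^ CARD('q) * l u)) (cscale (trace (\<psi> ** pauli u)) \<psi>))" for \<psi>
  proof -
    have "trace (pauli u ** \<psi>) = trace (\<psi> ** pauli u)" for u by (rule trace_mul_sym)
    then show ?thesis unfolding shadow_form_def cscale_sum_left by (simp add: mult.commute)
  qed
  then have "avg p (\<lambda>\<psi>. cscale (shadow_form l \<psi> A) \<psi>)
      = (\<Sum>u\<in>UNIV. avg p (\<lambda>\<psi>. cscale (trace (pauli u ** A) / (2 ^ CARD('q) * l u))
          (cscale (trace (\<psi> ** pauli u)) \<psi>)))"
    by (simp only: avg_sum)
  also have "\<dots> = (\<Sum>u\<in>UNIV. cscale (trace (pauli u ** A) / (2 ^ CARD('q) * l u)) (measurement_map p (pauli u)))"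
    by (simp only: measurement_map_avg[OF fin] avg_linear[OF lin])
  also have "\<dots> = (\<Sum>u\<in>UNIV. cscale (1 / 2 ^ CARD('q)) (cscale (trace (pauli u ** A)) (pauli u)))"
    using l by (simp add: M)
  also have "\<dots> = cscale (1 / 2 ^ CARD('q)) (\<Sum>u\<in>UNIV. cscale (trace (pauli u ** A)) (pauli u))"
    by (simp only: cscale_sum)
  also have "\<dots> = A" by (simp add: pauli_expansion)
  finally show ?thesis .
qed

lemma measurement_map_shadow_inv:
  fixes p :: "('q::finite \<Rightarrow> bool) op pmf"
  assumes "pauli_diagonal p l"
  shows "measurement_map p (shadow_inv l A) = A"
proof -
  have "trace (\<psi> ** shadow_inv l A) = shadow_form l \<psi> A" for \<psi>
    by (simp only: trace_mul_sym[of \<psi>] trace_shadow_inv shadow_form_sym[of l A])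
  then have "measurement_map p (shadow_inv l A) = avg p (\<lambda>\<psi>. cscale (shadow_form l \<psi> A) \<psi>)"
    using assms by (simp only: measurement_map_avg pauli_diagonal_def)
  then show ?thesis using avg_shadow_form[OF assms] by simp
qed

section \<open>The Clifford ensemble\<close>

text \<open>The states have trace 1, so this is the third moment with the identity as third
  argument; the factor \<open>d + 2\<close> cancels.\<close>

lemma clifford_second_moment:
  fixes A B :: "('q::finite \<Rightarrow> bool) op"
  shows "avg global_clifford_ensemble (\<lambda>\<psi>. trace (A ** \<psi>) * trace (B ** \<psi>))
    = (trace A * trace B + trace (A ** B)) / (2 ^ CARD('q) + 1)"
proof -
  define d :: complex where "d = 2 ^ CARD('q)"
  have d: "d + 1 \<noteq> 0" "d + 2 \<noteq> 0"
  proof -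
    have "d + 1 = of_nat (2 ^ CARD('q) + 1)" "d + 2 = of_nat (2 ^ CARD('q) + 2)"
      by (simp_all add: d_def)
    then show "d + 1 \<noteq> 0" "d + 2 \<noteq> 0" by (simp_all only: of_nat_eq_0_iff)
  qed
  have "avg global_clifford_ensemble (\<lambda>\<psi>. trace (A ** \<psi>) * trace (B ** \<psi>)) = clifford_moment A B (mat 1)"
    unfolding clifford_moment_def
    by (intro avg_cong) (simp add: trace_ketbra_unitary clifford_def)
  also have "\<dots> = ((trace A * trace B + trace (A ** B)) * (d + 2)) / ((d + 1) * (d + 2))"
    unfolding clifford_third_moment moment_form_def d_def[symmetric]
    by (rule arg_cong[of _ _ "\<lambda>x. x / _"]) (simp add: trace_I card_fun d_def algebra_simps)
  also have "\<dots> = (trace A * trace B + trace (A ** B)) / (d + 1)" using d by simp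
  finally show ?thesis by (simp add: d_def)
qed

text \<open>The second moment makes the measurement map depolarizing: A goes to (A + Tr(A) 1) / (2^n
  + 1), which fixes the identity and shrinks traceless operators.\<close>

definition clifford_eigenvalue :: "'q::finite pauli \<Rightarrow> real" where
  "clifford_eigenvalue u = (if u = pid then 1 else 1 / (2 ^ CARD('q) + 1))"

lemma clifford_pauli_diagonal:
  "pauli_diagonal (global_clifford_ensemble :: ('q::finite \<Rightarrow> bool) op pmf) clifford_eigenvalue"
  unfolding pauli_diagonal_def
proof (intro conjI allI ballI)
  show "finite (set_pmf (global_clifford_ensemble :: ('q \<Rightarrow> bool) op pmf))"
    by (simp add: finite_special_clifford)
  show "unitary U" if "U \<in> set_pmf global_clifford_ensemble" for U :: "('q \<Rightarrow> bool) op"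
    using that by (simp add: clifford_def)
  have pos: "(2::real) ^ CARD('q) + 1 > 0" by (simp add: add_pos_pos)
  then show "clifford_eigenvalue u \<noteq> 0" for u :: "'q pauli" by (simp add: clifford_eigenvalue_def)
  fix u :: "'q pauli"
  have nz: "(2::complex) ^ CARD('q) + 1 \<noteq> 0"
  proof -
    have "(2::complex) ^ CARD('q) + 1 = of_real (2 ^ CARD('q) + 1)" by simp
    then show ?thesis using pos by (simp only: of_real_eq_0_iff)
  qed
  show "measurement_map global_clifford_ensemble (pauli u)
      = cscale (clifford_eigenvalue u) (pauli u)"
  proof (rule op_eq_if_trace_eq)
    fix C :: "('q \<Rightarrow> bool) op"
    have "trace (measurement_map global_clifford_ensemble (pauli u) ** C)
        = avg global_clifford_ensemble (\<lambda>\<psi>. trace (pauli u ** \<psi>) * trace (C ** \<psi>))"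
    proof -
      have "trace (measurement_map global_clifford_ensemble (pauli u) ** C)
          = avg global_clifford_ensemble (\<lambda>\<psi>. trace (cscale (trace (\<psi> ** pauli u)) \<psi> ** C))"
        by (subst measurement_map_avg) (simp_all only: set_global_clifford_ensemble
            finite_special_clifford avg_linear[OF linear_trace_mult])
      then show ?thesis by (simp add: trace_mul_sym[of _ C] trace_mul_sym[of _ "pauli u"])
    qed
    also have "\<dots> = trace (cscale (clifford_eigenvalue u) (pauli u) ** C)"
    proof (cases "u = pid")
      case True
      have "2 ^ CARD('q) * trace C + trace C = (2 ^ CARD('q) + 1) * trace C" by (simp add: algebra_simps)
      then show ?thesis
        using True nz unfolding clifford_second_moment
        by (simp add: clifford_eigenvalue_def trace_I card_fun)
    next
      case False
      then show ?thesis
        unfolding clifford_second_moment by (simp add: clifford_eigenvalue_def trace_pauli)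
    qed
    finally show "trace (measurement_map global_clifford_ensemble (pauli u) ** C)
        = trace (cscale (clifford_eigenvalue u) (pauli u) ** C)" .
  qed
qed

lemma clifford_shadow_form:
  "shadow_form clifford_eigenvalue A B = (2 ^ CARD('q) + 1) * trace (A ** B) - trace A * trace B"
  for A :: "('q::finite \<Rightarrow> bool) op"
proof -
  let ?d = "(2::complex) ^ CARD('q)"
  \<comment> \<open>Every label receives the coefficient of the nontrivial ones,
    \<open>(?d + 1) / ?d\<close>; at \<open>pid\<close> this exceeds the true coefficient
    \<open>1 / ?d\<close> by 1.\<close>
  have "shadow_form clifford_eigenvalue A B
      = (\<Sum>u\<in>UNIV. (?d + 1) / ?d * (trace (pauli u ** A) * trace (pauli u ** B))
          - (if u = pid then trace A * trace B else 0))"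
    unfolding shadow_form_def
    by (intro sum.cong refl) (simp add: clifford_eigenvalue_def field_simps)
  also have "\<dots> = (?d + 1) / ?d * (?d * trace (A ** B)) - trace A * trace B"
    by (simp only: sum_subtractf sum_distrib_left[symmetric] trace_pauli_expansion) simp
  finally show ?thesis by simp
qed

text \<open>The weight is the probability of the outcome when \<open>\<sigma>\<close> is measured,
  so this is the second moment of a state shadow. It is computed exactly from the second and third
  moments; only then is it bounded, by replacing \<open>(d + 1) / (d + 2)\<close> by 1 and
  completing squares.\<close>

lemma clifford_variance:
  fixes \<sigma> Ob :: "('q::finite \<Rightarrow> bool) op"
  assumes \<sigma>: "psd \<sigma>" "trace \<sigma> = 1" and Ob: "hermitian Ob"
  shows "avg global_clifford_ensemble
      (\<lambda>\<psi>. Re (trace (\<psi> ** \<sigma>)) * (Re (shadow_form clifford_eigenvalue \<psi> Ob))\<^sup>2) \<le> opnorm (clifford_S Ob)"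
proof -
  define d :: real where "d = 2 ^ CARD('q)"
  have d: "d + 1 > 0" "d + 2 > 0" by (auto simp: d_def add_pos_pos)
  let ?D = "complex_of_real d"
  have dc: "2 ^ CARD('q) = ?D" by (simp add: d_def)
  obtain t q s s2 where real: "trace Ob = of_real t" "trace (Ob ** Ob) = of_real q"
      "trace (Ob ** \<sigma>) = of_real s" "trace (Ob ** Ob ** \<sigma>) = of_real s2"
    using hermitian_trace_real[OF Ob] hermitian_trace_mult_real[OF Ob Ob] psd_trace_real[OF \<sigma>(1) Ob]
      psd_trace_real[OF \<sigma>(1) hermitian_square[OF Ob]] by (auto elim!: Reals_cases)
  have q: "q \<ge> 0"
    using psd_trace_hermitian_square[OF psd_scaled_mat1[of 1] Ob] real by (simp add: complex_nonneg_Reals_iff)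
  have s: "s\<^sup>2 \<le> s2" using psd_trace_cauchy_schwarz[OF \<sigma> Ob] real by simp
  have swap: "trace (\<sigma> ** Ob) = of_real s" "trace (\<sigma> ** Ob ** Ob) = of_real s2"
    using real trace_mul_sym[of \<sigma> Ob] trace_mult_cycle[of \<sigma> Ob Ob] by simp_all
  have "avg global_clifford_ensemble
      (\<lambda>\<psi>. Re (trace (\<psi> ** \<sigma>)) * (Re (shadow_form clifford_eigenvalue \<psi> Ob))\<^sup>2)
    = avg global_clifford_ensemble (\<lambda>\<psi>. Re (trace (\<sigma> ** \<psi>) * (((?D + 1) * trace (Ob ** \<psi>) - t)
        * ((?D + 1) * trace (Ob ** \<psi>) - t))))"
  proof (rule avg_cong)
    fix U :: "('q \<Rightarrow> bool) op" and b assume "U \<in> set_pmf global_clifford_ensemble"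
    then have "trace (ketbra (cadj U *v ket b)) = 1" by (simp add: trace_ketbra_unitary clifford_def)
    then have "shadow_form clifford_eigenvalue (ketbra (cadj U *v ket b)) Ob
        = (?D + 1) * trace (Ob ** ketbra (cadj U *v ket b)) - t"
      by (simp add: clifford_shadow_form dc real trace_mul_sym[of "ketbra _"])
    moreover have "trace (Ob ** ketbra (cadj U *v ket b)) \<in> \<real>"
      using Ob hermitian_ketbra by (rule hermitian_trace_mult_real)
    then obtain r where "trace (Ob ** ketbra (cadj U *v ket b)) = complex_of_real r"
      by (auto elim: Reals_cases)
    ultimately show "Re (trace (ketbra (cadj U *v ket b) ** \<sigma>))
          * (Re (shadow_form clifford_eigenvalue (ketbra (cadj U *v ket b)) Ob))\<^sup>2
        = Re (trace (\<sigma> ** ketbra (cadj U *v ket b)) * (((?D + 1) * trace (Ob ** ketbra (cadj U *v ket b)) - t)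
          * ((?D + 1) * trace (Ob ** ketbra (cadj U *v ket b)) - t)))"
      by (simp add: power2_eq_square trace_mul_sym[of \<sigma>])
  qed
  also have "\<dots> = Re (avg global_clifford_ensemble (\<lambda>\<psi>. trace (\<sigma> ** \<psi>) * (((?D + 1) * trace (Ob ** \<psi>) - t)
        * ((?D + 1) * trace (Ob ** \<psi>) - t))))"
    by (rule avg_linear[symmetric]) (simp add: bounded_linear_Re bounded_linear.linear)
  also have "avg global_clifford_ensemble (\<lambda>\<psi>. trace (\<sigma> ** \<psi>) * (((?D + 1) * trace (Ob ** \<psi>) - t)
        * ((?D + 1) * trace (Ob ** \<psi>) - t)))
      = avg global_clifford_ensemble (\<lambda>\<psi>.
          (?D + 1)\<^sup>2 * (trace (\<sigma> ** \<psi>) * trace (Ob ** \<psi>) * trace (Ob ** \<psi>))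
          - 2 * (?D + 1) * t * (trace (\<sigma> ** \<psi>) * trace (Ob ** \<psi>))
          + t\<^sup>2 * (trace (\<sigma> ** \<psi>) * trace (mat 1 ** \<psi>)))"
    by (intro avg_cong) (simp add: trace_ketbra_unitary clifford_def power2_eq_square algebra_simps)
  also have "\<dots> = (?D + 1)\<^sup>2 * moment_form \<sigma> Ob Ob - 2 * (?D + 1) * t * ((t + s) / (?D + 1))
          + t\<^sup>2 * ((?D + 1) / (?D + 1))"
    unfolding avg_add avg_diff avg_mult_left clifford_moment_def[symmetric] clifford_third_moment
      clifford_second_moment dc
    by (simp add: \<sigma>(2) real swap trace_I card_fun dc)
  also have "moment_form \<sigma> Ob Ob = (t\<^sup>2 + q + 2 * t * s + 2 * s2) / ((?D + 1) * (?D + 2))"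
    by (simp add: moment_form_def \<sigma>(2) real swap dc power2_eq_square)
  also have "Re ((?D + 1)\<^sup>2 * ((t\<^sup>2 + q + 2 * t * s + 2 * s2) / ((?D + 1) * (?D + 2)))
      - 2 * (?D + 1) * t * ((t + s) / (?D + 1)) + t\<^sup>2 * ((?D + 1) / (?D + 1)))
      = (d + 1)\<^sup>2 * ((t\<^sup>2 + q + 2 * t * s + 2 * s2) / ((d + 1) * (d + 2)))
      - 2 * (d + 1) * t * ((t + s) / (d + 1)) + t\<^sup>2 * ((d + 1) / (d + 1))"
  proof -
    have "(?D + 1)\<^sup>2 * ((t\<^sup>2 + q + 2 * t * s + 2 * s2) / ((?D + 1) * (?D + 2)))
      - 2 * (?D + 1) * t * ((t + s) / (?D + 1)) + t\<^sup>2 * ((?D + 1) / (?D + 1))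
      = complex_of_real ((d + 1)\<^sup>2 * ((t\<^sup>2 + q + 2 * t * s + 2 * s2) / ((d + 1) * (d + 2)))
      - 2 * (d + 1) * t * ((t + s) / (d + 1)) + t\<^sup>2 * ((d + 1) / (d + 1)))"
      by (simp only: of_real_add of_real_mult of_real_divide of_real_power of_real_diff of_real_1 of_real_numeral)
    then show ?thesis by (simp only: Re_complex_of_real)
  qed
  also have "\<dots> = (d + 1) / (d + 2) * (t\<^sup>2 + q + 2 * t * s + 2 * s2) - 2 * t * (t + s) + t\<^sup>2"
  proof -
    have "2 * (d + 1) * t * ((t + s) / (d + 1)) = 2 * t * (t + s)"
      using d by (simp add: divide_simps)
    moreover have "(d + 1)\<^sup>2 * (x / ((d + 1) * (d + 2))) = (d + 1) / (d + 2) * x" for x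
      using d by (simp add: power2_eq_square)
    ultimately show ?thesis using d by simp
  qed
  also have "\<dots> \<le> 1 * (t\<^sup>2 + q + 2 * t * s + 2 * s2) - 2 * t * (t + s) + t\<^sup>2"
  proof -
    \<comment> \<open>Every summand on the right is nonnegative, the third one by the variance
      inequality, so enlarging the coefficient to 1 is allowed.\<close>
    have "t\<^sup>2 + q + 2 * t * s + 2 * s2 = (t + s)\<^sup>2 + q + (s2 - s\<^sup>2) + s2"
      by (simp add: power2_sum)
    moreover have "0 \<le> s\<^sup>2" "0 \<le> (t + s)\<^sup>2" by simp_all
    ultimately have "0 \<le> t\<^sup>2 + q + 2 * t * s + 2 * s2" using s q by linarith
    then show ?thesis using d by (intro add_right_mono diff_right_mono mult_right_mono) auto
  qed
  also have "\<dots> \<le> 2 * (2 * t\<^sup>2 + q + 2 * t * s + 2 * s2)"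
  proof -
    \<comment> \<open>The slack against \<open>clifford_S\<close> is again a sum of nonnegative
      terms.\<close>
    have "2 * (2 * t\<^sup>2 + q + 2 * t * s + 2 * s2) - (1 * (t\<^sup>2 + q + 2 * t * s + 2 * s2) - 2 * t * (t + s) + t\<^sup>2)
        = (2 * t + s)\<^sup>2 + q + (s2 - s\<^sup>2) + s2"
      by (simp add: power2_eq_square algebra_simps)
    moreover have "0 \<le> s\<^sup>2" "0 \<le> (2 * t + s)\<^sup>2" by simp_all
    ultimately show ?thesis using s q by linarith
  qed
  also have "\<dots> = Re (trace (clifford_S Ob ** \<sigma>))"
    by (simp add: clifford_S_def matrix_add_rdistrib trace_add real \<sigma>(2) power2_eq_square cscale_add)
  also have "\<dots> \<le> opnorm (clifford_S Ob)"
  proof (rule psd_trace_le_opnorm[OF \<sigma>])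
    show "hermitian (clifford_S Ob)"
      unfolding clifford_S_def using Ob real
      by (intro hermitian_cscale hermitian_add hermitian_mat1 hermitian_square) auto
  qed
  finally show ?thesis .
qed

section \<open>The local Pauli ensemble\<close>

text \<open>Lets an average run over a parameter pushed forward by \<open>map_pmf\<close>, without
  asking whether different parameters give the same unitary.\<close>

lemma avg_expectation:
  fixes F :: "_ \<Rightarrow> 'x::{banach, second_countable_topology}"
  assumes "finite (set_pmf p)"
  shows "avg p F = measure_pmf.expectation p (\<lambda>U. \<Sum>b\<in>UNIV. F (ketbra (cadj U *v ket b)))"
  unfolding avg_def using assms by (subst integral_measure_pmf) auto

text \<open>Axes carry the labels of the nontrivial Pauli matrices, so that a setting and a Pauli
  label can be compared qubit by qubit.\<close>

definition axes :: "(bool \<times> bool) set" where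
  "axes = {(False, True), (True, False), (True, True)}"

definition rotation :: "bool \<times> bool \<Rightarrow> bool op" where
  "rotation a = (if a = (False, True) then mat 1 else cscale (1 / complex_of_real (sqrt 2)) (pauli1 a + pauliZ))"

definition proj1 :: "bool \<times> bool \<Rightarrow> bool \<Rightarrow> bool op" where
  "proj1 a b = ketbra (cadj (rotation a) *v ket b)"

abbreviation settings :: "('q::finite \<Rightarrow> bool \<times> bool) set" where
  "settings \<equiv> \<Pi>\<^sub>E q\<in>UNIV. axes"

definition local_proj :: "('q::finite \<Rightarrow> bool \<times> bool) \<Rightarrow> ('q \<Rightarrow> bool) \<Rightarrow> ('q \<Rightarrow> bool) op" where
  "local_proj w b = qubit_tensor (\<lambda>q. proj1 (w q) (b q))"

lemma pauli_rotations_eq: "pauli_rotations = rotation ` axes"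
  by (auto simp: pauli_rotations_def axes_def rotation_def scaleR_eq_cscale)

lemma sqrt2_square [simp]: "complex_of_real (sqrt 2) * complex_of_real (sqrt 2) = 2"
  by (simp flip: of_real_mult)

lemma inj_rotation: "inj_on rotation axes"
proof -
  have "rotation (False, True) $ False $ True = 0"
    "rotation (True, False) $ False $ True = 1 / complex_of_real (sqrt 2)"
    "rotation (True, True) $ False $ True = - \<i> / complex_of_real (sqrt 2)"
    by (simp_all add: rotation_def pauli_entries)
  then show ?thesis by (auto simp: inj_on_def axes_def complex_eq_iff)
qed

lemma rotation_involution:
  assumes "a \<in> axes"
  shows "cadj (rotation a) = rotation a" "rotation a ** rotation a = mat 1"
proof -
  show "cadj (rotation a) = rotation a"
    using assms
    by (auto simp: axes_def rotation_def vec_eq_iff pauli_entries)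
  show "rotation a ** rotation a = mat 1"
    using assms
    by (auto simp: axes_def rotation_def vec_eq_iff mult_nth UNIV_bool pauli_entries
        all_bool_eq field_simps)
qed

text \<open>\<open>proj1 w b\<close> projects onto an eigenvector of \<open>pauli1 w\<close>, with
  eigenvalue -1 for bit \<open>True\<close>, so it has no component along the other two
  axes.\<close>

lemma trace_pauli1_proj1:
  assumes "w \<in> axes"
  shows "trace (pauli1 a ** proj1 w b)
    = (if a = (False, False) then 1 else if a = w then if b then -1 else 1 else 0)"
proof -
  have "trace (pauli1 a ** proj1 w b) = (rotation w ** pauli1 a ** rotation w) $ b $ b"
    using trace_ketbra_cadj_ket[of "rotation w" b "pauli1 a"] trace_mul_sym[of "pauli1 a" "proj1 w b"]
      rotation_involution[OF assms]
    by (simp add: proj1_def)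
  also have "\<dots> = (if a = (False, False) then 1 else if a = w then if b then -1 else 1 else 0)"
  proof -
    have "\<forall>a. \<forall>b. (rotation w ** pauli1 a ** rotation w) $ b $ b
        = (if a = (False, False) then 1 else if a = w then if b then -1 else 1 else 0)"
      using assms
      by (auto simp: all_bool2 all_bool_eq axes_def rotation_def mult_nth UNIV_bool pauli_entries
          field_simps)
    then show ?thesis by blast
  qed
  finally show ?thesis .
qed

text \<open>Only the tuples of rotations have to differ for different settings; the tensor product
  is applied afterwards, as a pushforward.\<close>

lemma local_pauli_ensemble_eq:
  "(local_pauli_ensemble :: ('q::finite \<Rightarrow> bool) op pmf)
    = map_pmf (\<lambda>w. qubit_tensor (\<lambda>q. rotation (w q))) (pmf_of_set settings)"
proof -
  have PiE: "PiE_dflt UNIV undefined (\<lambda>_. pauli_rotations)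
      = (\<lambda>w (q :: 'q). rotation (w q)) ` settings"
  proof (intro equalityI subsetI)
    fix s :: "'q \<Rightarrow> bool op" assume "s \<in> PiE_dflt UNIV undefined (\<lambda>_. pauli_rotations)"
    then have "s q \<in> rotation ` axes" for q by (simp add: PiE_dflt_def pauli_rotations_eq)
    then have "\<forall>q. \<exists>a. a \<in> axes \<and> s q = rotation a" by blast
    from choice[OF this] obtain w where "\<forall>q. w q \<in> axes \<and> s q = rotation (w q)" by blast
    then have "w \<in> settings" "s = (\<lambda>q. rotation (w q))" by auto
    then show "s \<in> (\<lambda>w q. rotation (w q)) ` settings" by blast
  qed (auto simp: PiE_dflt_def pauli_rotations_eq PiE_def Pi_def)
  have inj: "inj_on (\<lambda>w (q :: 'q). rotation (w q)) settings"
    using inj_rotation by (fastforce simp: inj_on_def fun_eq_iff PiE_def Pi_def)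
  have "finite axes" "axes \<noteq> {}" by (auto simp: axes_def)
  then have fin: "finite (settings :: ('q \<Rightarrow> _) set)" "(settings :: ('q \<Rightarrow> _) set) \<noteq> {}"
    by (auto simp: finite_PiE PiE_eq_empty_iff)
  show ?thesis
    unfolding local_pauli_ensemble_def
    using \<open>finite axes\<close> \<open>axes \<noteq> {}\<close>
    by (subst Pi_pmf_of_set) (simp_all add: pauli_rotations_eq[symmetric] PiE
        map_pmf_of_set_inj[OF inj fin(2,1), symmetric] map_pmf_comp, simp_all add: pauli_rotations_eq)
qed

lemma settings_props:
  "finite (settings :: ('q::finite \<Rightarrow> _) set)" "(settings :: ('q::finite \<Rightarrow> _) set) \<noteq> {}"
  "card (settings :: ('q::finite \<Rightarrow> _) set) = 3 ^ CARD('q)"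
proof -
  have "finite axes" "axes \<noteq> {}" "card axes = 3" by (auto simp: axes_def)
  then show "finite (settings :: ('q::finite \<Rightarrow> _) set)" "(settings :: ('q::finite \<Rightarrow> _) set) \<noteq> {}"
    "card (settings :: ('q::finite \<Rightarrow> _) set) = 3 ^ CARD('q)"
    by (auto simp: finite_PiE PiE_eq_empty_iff card_PiE)
qed

lemma set_local_pauli_ensemble:
  "set_pmf local_pauli_ensemble = (\<lambda>w. qubit_tensor (\<lambda>q. rotation (w q))) ` settings"
  unfolding local_pauli_ensemble_eq set_map_pmf
  by (subst set_pmf_of_set) (simp_all add: settings_props)

lemma unitary_local:
  assumes "w \<in> settings"
  shows "unitary (qubit_tensor (\<lambda>q. rotation (w q)))"
proof -
  have "w q \<in> axes" for q using assms by auto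
  note inv = rotation_involution[OF this]
  show ?thesis unfolding unitary_def cadj_qubit_tensor inv(1) qubit_tensor_mult inv(2)
    by (simp add: qubit_tensor_mat1)
qed

lemma ketbra_local:
  "ketbra (cadj (qubit_tensor (\<lambda>q. rotation (w q))) *v ket b) = local_proj w b"
  by (simp add: vec_eq_iff local_proj_def proj1_def cadj_ket_nth prod.distrib)

lemma finite_set_local: "finite (set_pmf local_pauli_ensemble)"
  unfolding set_local_pauli_ensemble by (intro finite_imageI settings_props)

lemma avg_local_pauli:
  fixes F :: "('q::finite \<Rightarrow> bool) op \<Rightarrow> 'x::{banach, second_countable_topology}"
  shows "avg local_pauli_ensemble F
    = (1 / 3 ^ CARD('q)) *\<^sub>R (\<Sum>w\<in>settings. \<Sum>b\<in>UNIV. F (local_proj w b))"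
proof -
  have "avg local_pauli_ensemble F
      = measure_pmf.expectation (pmf_of_set settings) (\<lambda>w. \<Sum>b\<in>UNIV. F (local_proj w b))"
    unfolding avg_expectation[OF finite_set_local]
    unfolding local_pauli_ensemble_eq by (simp add: ketbra_local)
  also have "\<dots> = (\<Sum>w\<in>settings. pmf (pmf_of_set settings) w *\<^sub>R (\<Sum>b\<in>UNIV. F (local_proj w b)))"
  proof (rule integral_measure_pmf[OF settings_props(1)])
    fix w :: "'q \<Rightarrow> bool \<times> bool" assume "w \<in> set_pmf (pmf_of_set settings)"
    then show "w \<in> settings" by (simp only: set_pmf_of_set[OF settings_props(2,1)])
  qed
  also have "\<dots> = (\<Sum>w\<in>settings. (1 / 3 ^ CARD('q)) *\<^sub>R (\<Sum>b\<in>UNIV. F (local_proj w b)))"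
    by (intro sum.cong refl) (simp add: pmf_of_set settings_props del: PiE_iff)
  finally show ?thesis by (simp add: scaleR_sum_right)
qed

lemma trace_pauli_local_proj:
  "trace (pauli u ** local_proj w b) = (\<Prod>q\<in>UNIV. trace (pauli1 (u q) ** proj1 (w q) (b q)))"
  unfolding pauli_def local_proj_def qubit_tensor_mult trace_qubit_tensor ..

lemma op_eq_if_pauli_trace_eq:
  fixes A B :: "('q::finite \<Rightarrow> bool) op"
  assumes "\<And>v. trace (A ** pauli v) = trace (B ** pauli v)"
  shows "A = B"
proof -
  have X: "X = cscale (1 / 2 ^ CARD('q)) (\<Sum>u\<in>UNIV. cscale (trace (pauli u ** X)) (pauli u))"
    for X :: "('q \<Rightarrow> bool) op"
    by (simp add: pauli_expansion)
  have "trace (pauli u ** A) = trace (pauli u ** B)" for u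
    using assms[of u] by (simp only: trace_mul_sym[of "pauli u"])
  then show ?thesis by (subst X[of A], subst X[of B]) (simp only:)
qed

text \<open>One third per nontrivial factor: the probability that a random setting measures all of
  them along the right axes, as \<open>card_compatible\<close> shows.\<close>

definition local_pauli_eigenvalue :: "'q::finite pauli \<Rightarrow> real" where
  "local_pauli_eigenvalue u = (\<Prod>q\<in>UNIV. if u q = (False, False) then 1 else 1 / 3)"

lemma sum_axes: "(\<Sum>a\<in>axes. f a) = f (False, True) + (f (True, False) + f (True, True))"
  by (simp add: axes_def)

lemma trace_pauli1_mult: "trace (pauli1 a ** pauli1 c) = (if a = c then 2 else 0)"
proof -
  have "\<forall>a c. trace (pauli1 a ** pauli1 c) = (if a = c then 2 else 0)"
    by (simp add: all_bool2 trace_mult UNIV_bool pauli_entries del: split_paired_All)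
  then show ?thesis by blast
qed

lemma second_moment_single_qubit:
  "(\<Sum>w\<in>axes. \<Sum>b\<in>UNIV. trace (pauli1 a ** proj1 w b) * trace (pauli1 c ** proj1 w b))
    = 3 * ((if a = (False, False) then 1 else 1 / 3) * trace (pauli1 a ** pauli1 c))"
proof -
  have *: "(\<Sum>w\<in>axes. \<Sum>b\<in>UNIV. trace (pauli1 a ** proj1 w b) * trace (pauli1 c ** proj1 w b))
      = (\<Sum>w\<in>axes. \<Sum>b\<in>UNIV. (if a = (False, False) then 1 else if a = w then if b then -1 else 1 else 0)
          * (if c = (False, False) then 1 else if c = w then if b then -1 else 1 else 0))"
    by (intro sum.cong refl) (simp add: trace_pauli1_proj1)
  have "\<forall>a c. (\<Sum>w\<in>axes. \<Sum>b\<in>UNIV.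
      (if a = (False, False) then 1 else if a = w then if b then -1 else 1 else 0)
          * (if c = (False, False) then 1 else if c = w then if b then -1 else 1 else 0))
      = 3 * ((if a = (False, False) then 1 else 1 / 3) * trace (pauli1 a ** pauli1 c))"
    unfolding trace_pauli1_mult sum_axes by (simp add: all_bool2 UNIV_bool del: split_paired_All)
  then show ?thesis unfolding * by blast
qed

text \<open>Tested against a Pauli operator, the sums over settings and outcomes factor over the
  qubits, which leaves the one-qubit second moment.\<close>

lemma local_pauli_diagonal:
  "pauli_diagonal (local_pauli_ensemble :: ('q::finite \<Rightarrow> bool) op pmf) local_pauli_eigenvalue"
  unfolding pauli_diagonal_def
proof (intro conjI allI ballI)
  show "finite (set_pmf (local_pauli_ensemble :: ('q \<Rightarrow> bool) op pmf))" by (rule finite_set_local)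
  show "unitary U" if "U \<in> set_pmf local_pauli_ensemble" for U :: "('q \<Rightarrow> bool) op"
    using that unitary_local unfolding set_local_pauli_ensemble by blast
  show "local_pauli_eigenvalue u \<noteq> 0" for u :: "'q pauli"
    by (simp add: local_pauli_eigenvalue_def)
  fix u :: "'q pauli"
  show "measurement_map local_pauli_ensemble (pauli u) = cscale (local_pauli_eigenvalue u) (pauli u)"
  proof (rule op_eq_if_pauli_trace_eq)
    fix v :: "'q pauli"
    let ?t = "\<lambda>a w b. trace (pauli1 a ** proj1 w b)"
    have "trace (measurement_map local_pauli_ensemble (pauli u) ** pauli v)
        = avg local_pauli_ensemble (\<lambda>\<psi>. trace (cscale (trace (\<psi> ** pauli u)) \<psi> ** pauli v))"
      by (simp only: measurement_map_avg[OF finite_set_local] avg_linear[OF linear_trace_mult])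
    also have "\<dots> = avg local_pauli_ensemble (\<lambda>\<psi>. trace (pauli u ** \<psi>) * trace (pauli v ** \<psi>))"
      unfolding cscale_mult_left trace_cscale
      by (rule arg_cong[of _ _ "avg local_pauli_ensemble"], intro ext arg_cong2[of _ _ _ _ "(*)"] trace_mul_sym)
    also have "\<dots> = (1 / 3 ^ CARD('q)) *\<^sub>R (\<Sum>w\<in>settings. \<Sum>b\<in>UNIV. \<Prod>q\<in>UNIV.
        ?t (u q) (w q) (b q) * ?t (v q) (w q) (b q))"
      by (simp only: avg_local_pauli trace_pauli_local_proj prod.distrib)
    also have "(\<Sum>w\<in>settings. \<Sum>b\<in>UNIV. \<Prod>q\<in>UNIV. ?t (u q) (w q) (b q) * ?t (v q) (w q) (b q))
        = (\<Sum>w\<in>settings. \<Prod>q\<in>UNIV. \<Sum>b\<in>UNIV. ?t (u q) (w q) b * ?t (v q) (w q) b)"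
      by (intro sum.cong refl prod_sum_UNIV)
    also have "\<dots> = (\<Prod>q\<in>UNIV. \<Sum>w\<in>axes. \<Sum>b\<in>UNIV. ?t (u q) w b * ?t (v q) w b)"
      by (rule prod_sum_PiE[symmetric]) (simp_all add: axes_def)
    also have "\<dots> = 3 ^ CARD('q) * ((\<Prod>q\<in>UNIV. if u q = (False, False) then 1 else 1 / 3)
        * trace (pauli u ** pauli v))"
      unfolding second_moment_single_qubit prod.distrib
      by (simp add: pauli_def qubit_tensor_mult trace_qubit_tensor)
    also have "(\<Prod>q\<in>UNIV. if u q = (False, False) then 1 else 1 / 3)
        = complex_of_real (local_pauli_eigenvalue u)"
      unfolding local_pauli_eigenvalue_def of_real_prod by (intro prod.cong) auto
    finally show "trace (measurement_map local_pauli_ensemble (pauli u) ** pauli v)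
        = trace (cscale (local_pauli_eigenvalue u) (pauli u) ** pauli v)"
      by (simp add: scaleR_conv_of_real)
  qed
qed

text \<open>Flipping bit \<open>q\<close> of both indices fixes \<open>A\<close> and reverses the sign of the diagonal blocks of \<open>pauli u\<close>.\<close>

lemma trace_pauli_outside_support:
  fixes A :: "('q::finite \<Rightarrow> bool) op"
  assumes A: "acts_trivially_on q A" and u: "u q \<noteq> (False, False)"
  shows "trace (pauli u ** A) = 0"
proof -
  obtain B :: "('q \<Rightarrow> bool) op" where B: "\<And>a b. A $ a $ b
      = (if a q = b q then B $ a(q := False) $ b(q := False) else 0)"
    using A unfolding acts_trivially_on_def by blast
  define flip :: "('q \<Rightarrow> bool) \<Rightarrow> 'q \<Rightarrow> bool" where "flip a = a(q := \<not> a q)" for a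
  have bij: "bij flip"
    by (rule involuntory_imp_bij) (simp add: flip_def)
  have pauli1_flip: "pauli1 c $ (\<not> x) $ (\<not> x) = - pauli1 c $ x $ x" if "c \<noteq> (False, False)" for c x
    using that by (cases c; cases x) (auto simp: pauli1_def pauli_entries)
  have neg: "pauli u $ flip a $ flip b * A $ flip b $ flip a = - (pauli u $ a $ b * A $ b $ a)" for a b
  proof (cases "a q = b q")
    case True
    have "(\<Prod>r\<in>UNIV - {q}. pauli1 (u r) $ flip a r $ flip b r) = (\<Prod>r\<in>UNIV - {q}. pauli1 (u r) $ a r $ b r)"
      by (intro prod.cong) (auto simp: flip_def)
    then have "pauli u $ flip a $ flip b = - pauli u $ a $ b"
      using pauli1_flip[OF u, of "a q"] True
      by (simp add: pauli_def prod.remove[of UNIV q] flip_def)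
    moreover have "A $ flip b $ flip a = A $ b $ a" by (simp add: B flip_def True)
    ultimately show ?thesis by simp
  qed (simp add: B flip_def)
  have "trace (pauli u ** A) = (\<Sum>a\<in>UNIV. \<Sum>b\<in>UNIV. pauli u $ flip a $ b * A $ b $ flip a)"
    unfolding trace_mult by (rule sum.reindex_bij_betw[OF bij, symmetric])
  also have "\<dots> = (\<Sum>a\<in>UNIV. \<Sum>b\<in>UNIV. pauli u $ flip a $ flip b * A $ flip b $ flip a)"
    by (rule sum.cong[OF refl], rule sum.reindex_bij_betw[OF bij, symmetric])
  also have "\<dots> = - trace (pauli u ** A)" unfolding neg trace_mult by (simp add: sum_negf)
  finally show ?thesis by simp
qed

text \<open>The Pauli operators whose value is determined by the outcomes of setting
  \<open>w\<close>.\<close>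

definition compatible :: "('q \<Rightarrow> bool \<times> bool) \<Rightarrow> 'q pauli \<Rightarrow> bool" where
  "compatible w u \<longleftrightarrow> (\<forall>q. u q = (False, False) \<or> u q = w q)"

lemma trace_pauli_local_proj_square:
  assumes "w \<in> settings"
  shows "(Re (trace (pauli u ** local_proj w b)))\<^sup>2 = (if compatible w u then 1 else 0)"
proof -
  have w: "w q \<in> axes" for q using assms by auto
  have "trace (pauli u ** local_proj w b) = of_real (\<Prod>q\<in>UNIV. if u q = (False, False) then 1
      else if u q = w q then if b q then -1 else 1 else 0)"
    unfolding trace_pauli_local_proj of_real_prod
    by (intro prod.cong refl) (simp add: trace_pauli1_proj1[OF w])
  then have "(Re (trace (pauli u ** local_proj w b)))\<^sup>2 = (\<Prod>q\<in>UNIV. (if u q = (False, False) then 1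
      else if u q = w q then if b q then -1 else 1 else 0)\<^sup>2)"
    by (simp only: Re_complex_of_real prod_power_distrib)
  also have "\<dots> = (\<Prod>q\<in>UNIV. if u q = (False, False) \<or> u q = w q then 1 else 0)"
    by (intro prod.cong) auto
  also have "\<dots> = (if compatible w u then 1 else 0)"
    by (auto simp: compatible_def)
  finally show ?thesis .
qed

text \<open>The origin of 4 to the support size: each qubit of \<open>S\<close> contributes 1 for
  the identity and 3 for the measured axis, any other qubit only 1.\<close>

lemma sum_compatible_supported:
  fixes S :: "'q::finite set"
  assumes "w \<in> settings"
  shows "(\<Sum>u | compatible w u \<and> (\<forall>q. q \<notin> S \<longrightarrow> u q = (False, False)). 1 / local_pauli_eigenvalue u)
    = 4 ^ card S"
proof -
  have w: "w q \<in> axes" for q using assms by auto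
  let ?h = "\<lambda>q a. if a = (False, False) then 1 else if q \<in> S \<and> a = w q then 3 else (0::real)"
  have "(\<Sum>u | compatible w u \<and> (\<forall>q. q \<notin> S \<longrightarrow> u q = (False, False)). 1 / local_pauli_eigenvalue u)
      = (\<Sum>u\<in>UNIV. if compatible w u \<and> (\<forall>q. q \<notin> S \<longrightarrow> u q = (False, False))
          then 1 / local_pauli_eigenvalue u else 0)"
    by (simp add: sum.If_cases)
  also have "\<dots> = (\<Sum>u\<in>UNIV. \<Prod>q\<in>UNIV. ?h q (u q))"
  proof (intro sum.cong refl)
    fix u :: "'q pauli"
    show "(if compatible w u \<and> (\<forall>q. q \<notin> S \<longrightarrow> u q = (False, False))
          then 1 / local_pauli_eigenvalue u else 0) = (\<Prod>q\<in>UNIV. ?h q (u q))"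
    proof (cases "compatible w u \<and> (\<forall>q. q \<notin> S \<longrightarrow> u q = (False, False))")
      case True
      then have "(\<Prod>q\<in>UNIV. ?h q (u q)) = (\<Prod>q\<in>UNIV. 1 / (if u q = (False, False) then 1 else 1 / 3))"
        by (intro prod.cong) (auto simp: compatible_def)
      then show ?thesis using True by (simp add: local_pauli_eigenvalue_def prod_dividef)
    next
      case False
      then obtain q where "u q \<noteq> (False, False)" "\<not> (q \<in> S \<and> u q = w q)"
        unfolding compatible_def by blast
      then have "?h q (u q) = 0" by simp
      then have "(\<Prod>q\<in>UNIV. ?h q (u q)) = 0" by (intro prod_zero bexI[of _ q]) simp_all
      then show ?thesis by (simp only: if_not_P[OF False])
    qed
  qed
  also have "\<dots> = (\<Prod>q\<in>UNIV. \<Sum>a\<in>UNIV. ?h q a)" by (rule prod_sum_UNIV)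
  also have "\<dots> = (\<Prod>q\<in>UNIV. if q \<in> S then 4 else 1)"
  proof (intro prod.cong refl)
    fix q
    show "(\<Sum>a\<in>UNIV. ?h q a) = (if q \<in> S then 4 else 1)"
      using w[of q] unfolding UNIV_bool2 axes_def by (elim insertE emptyE) simp_all
  qed
  also have "\<dots> = 4 ^ card S" by (simp add: prod.If_cases)
  finally show ?thesis .
qed

lemma card_compatible:
  "real (card {w \<in> settings. compatible w u}) = 3 ^ CARD('q) * local_pauli_eigenvalue u"
  for u :: "'q::finite pauli"
proof -
  have "real (card {w \<in> settings. compatible w u}) = (\<Sum>w\<in>settings. if compatible w u then 1 else 0)"
    by (simp add: sum.If_cases settings_props Int_def)
  also have "\<dots> = (\<Sum>w\<in>settings. \<Prod>q\<in>UNIV. if u q = (False, False) \<or> u q = w q then 1 else 0)"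
    by (intro sum.cong refl) (auto simp: compatible_def)
  also have "\<dots> = (\<Prod>q\<in>UNIV. \<Sum>a\<in>axes. if u q = (False, False) \<or> u q = a then 1 else 0)"
    by (rule prod_sum_PiE[symmetric]) (simp_all add: axes_def)
  also have "\<dots> = (\<Prod>q\<in>UNIV. 3 * (if u q = (False, False) then 1 else 1 / 3))"
  proof (intro prod.cong refl)
    fix q
    show "(\<Sum>a\<in>axes. if u q = (False, False) \<or> u q = a then 1 else 0)
        = 3 * (if u q = (False, False) then 1 else 1 / 3 :: real)"
      unfolding sum_axes by (cases "u q") auto
  qed
  also have "\<dots> = 3 ^ CARD('q) * local_pauli_eigenvalue u"
    by (simp add: prod.distrib local_pauli_eigenvalue_def)
  finally show ?thesis .
qed

lemma local_pauli_eigenvalue_pos: "local_pauli_eigenvalue u > 0"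
  unfolding local_pauli_eigenvalue_def by (intro prod_pos) auto

lemma local_pauli_eigenvalue_nonneg [simp]: "0 \<le> local_pauli_eigenvalue u"
  using local_pauli_eigenvalue_pos[of u] by simp

lemma hermitian_local_proj: "hermitian (local_proj w b)"
  unfolding ketbra_local[symmetric] by (rule hermitian_ketbra)

text \<open>Cauchy--Schwarz over the Pauli operators that are compatible with the setting \<open>w\<close>.\<close>

lemma local_shadow_form_square:
  fixes Ob :: "('q::finite \<Rightarrow> bool) op"
  assumes w: "w \<in> settings" and Ob: "hermitian Ob"
  shows "(Re (shadow_form local_pauli_eigenvalue (local_proj w b) Ob))\<^sup>2 \<le> 4 ^ supp_size Ob *
    (\<Sum>u\<in>UNIV. if compatible w u then (Re (trace (pauli u ** Ob)) / 2 ^ CARD('q))\<^sup>2 / local_pauli_eigenvalue u else 0)"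
proof -
  let ?l = local_pauli_eigenvalue
  define S where "S = {q. \<not> acts_trivially_on q Ob}"
  define I where "I = {u. compatible w u \<and> (\<forall>q. q \<notin> S \<longrightarrow> u q = (False, False))}"
  define t where "t u = Re (trace (pauli u ** local_proj w b))" for u
  define \<alpha> where "\<alpha> u = Re (trace (pauli u ** Ob)) / 2 ^ CARD('q)" for u
  have t: "(t u)\<^sup>2 = (if compatible w u then 1 else 0)" for u
    unfolding t_def by (rule trace_pauli_local_proj_square[OF w])
  \<comment> \<open>Incompatible labels are invisible to the setting, and labels reaching outside
    the support of \<open>Ob\<close> do not occur in it.\<close>
  have zero: "t u * \<alpha> u = 0" if "u \<notin> I" for u
  proof (cases "compatible w u")
    case True
    then obtain q where "acts_trivially_on q Ob" "u q \<noteq> (False, False)"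
      using \<open>u \<notin> I\<close> by (auto simp: I_def S_def)
    then show ?thesis by (simp add: \<alpha>_def trace_pauli_outside_support)
  next
    case False
    then show ?thesis using t[of u] by simp
  qed
  have "Re (shadow_form ?l (local_proj w b) Ob) = (\<Sum>u\<in>UNIV. t u * \<alpha> u / ?l u)"
  proof -
    have "Re (trace (pauli u ** local_proj w b) * trace (pauli u ** Ob) / (2 ^ CARD('q) * ?l u))
        = t u * \<alpha> u / ?l u" for u
    proof -
      have "trace (pauli u ** local_proj w b) = of_real (t u)"
        "trace (pauli u ** Ob) = of_real (2 ^ CARD('q) * \<alpha> u)"
        using hermitian_trace_mult_real[OF hermitian_pauli hermitian_local_proj, of u w b]
          hermitian_trace_mult_real[OF hermitian_pauli Ob, of u]
        by (simp_all add: t_def \<alpha>_def)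
      then have "trace (pauli u ** local_proj w b) * trace (pauli u ** Ob) / (2 ^ CARD('q) * ?l u)
          = of_real (t u * \<alpha> u / ?l u)" by simp
      then show ?thesis by (simp only: Re_complex_of_real)
    qed
    then show ?thesis unfolding shadow_form_def Re_sum by (simp only:)
  qed
  also have "\<dots> = (\<Sum>u\<in>I. t u * \<alpha> u / ?l u)"
    by (rule sum.mono_neutral_right) (auto simp: zero)
  \<comment> \<open>The weight \<open>1 / ?l u\<close> is split evenly: the first factor then
    produces the power of 4, and the second keeps one inverse eigenvalue, which averaging over the
    settings will cancel.\<close>
  also have "\<dots> = (\<Sum>u\<in>I. (t u / sqrt (?l u)) * (\<alpha> u / sqrt (?l u)))"
    by (intro sum.cong refl) simp
  finally have "(Re (shadow_form ?l (local_proj w b) Ob))\<^sup>2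
      \<le> (\<Sum>u\<in>I. (t u / sqrt (?l u))\<^sup>2) * (\<Sum>u\<in>I. (\<alpha> u / sqrt (?l u))\<^sup>2)"
    by (simp only: Cauchy_Schwarz_ineq_sum)
  also have "(\<Sum>u\<in>I. (t u / sqrt (?l u))\<^sup>2) = (\<Sum>u\<in>I. 1 / ?l u)"
    by (intro sum.cong refl) (simp add: power_divide t I_def)
  also have "\<dots> = 4 ^ supp_size Ob"
    unfolding I_def using sum_compatible_supported[OF w, of S] by (simp add: S_def supp_size_def)
  also have "(\<Sum>u\<in>I. (\<alpha> u / sqrt (?l u))\<^sup>2) = (\<Sum>u\<in>I. if compatible w u then (\<alpha> u)\<^sup>2 / ?l u else 0)"
    by (intro sum.cong refl) (simp add: power_divide I_def)
  also have "4 ^ supp_size Ob * \<dots> \<le> 4 ^ supp_size Ob * (\<Sum>u\<in>UNIV. if compatible w u then (\<alpha> u)\<^sup>2 / ?l u else 0)"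
    by (intro mult_left_mono sum_mono2) auto
  finally show ?thesis unfolding \<alpha>_def .
qed

text \<open>By Parseval in the Pauli basis the left side is the normalized trace of the square of
  \<open>Ob\<close>, an average of squared column norms.\<close>

lemma sum_pauli_coefficients:
  fixes Ob :: "('q::finite \<Rightarrow> bool) op"
  assumes Ob: "hermitian Ob"
  shows "(\<Sum>u\<in>UNIV. (Re (trace (pauli u ** Ob)) / 2 ^ CARD('q))\<^sup>2) \<le> (opnorm Ob)\<^sup>2"
proof -
  have "trace (pauli u ** Ob) * trace (pauli u ** Ob) = of_real ((Re (trace (pauli u ** Ob)))\<^sup>2)" for u
    using hermitian_trace_mult_real[OF hermitian_pauli Ob, of u]
    by (simp add: power2_eq_square)
  then have "complex_of_real (\<Sum>u\<in>UNIV. (Re (trace (pauli u ** Ob)))\<^sup>2) = 2 ^ CARD('q) * trace (Ob ** Ob)"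
    unfolding trace_pauli_expansion[symmetric] by simp
  then have "(\<Sum>u\<in>UNIV. (Re (trace (pauli u ** Ob)))\<^sup>2) = Re (2 ^ CARD('q) * trace (Ob ** Ob))"
    by (metis Re_complex_of_real)
  also have "\<dots> = 2 ^ CARD('q) * Re (trace (Ob ** Ob))"
  proof -
    have "Re (complex_of_real (2 ^ CARD('q)) * trace (Ob ** Ob)) = 2 ^ CARD('q) * Re (trace (Ob ** Ob))"
      by (simp only: times_complex.sel Re_complex_of_real Im_complex_of_real)
    then show ?thesis by simp
  qed
  also have "\<dots> \<le> 2 ^ CARD('q) * (2 ^ CARD('q) * (opnorm Ob)\<^sup>2)"
    using trace_cadj_mult_le[of Ob] Ob by (simp add: hermitian_def card_fun)
  finally have "(\<Sum>u\<in>UNIV. (Re (trace (pauli u ** Ob)))\<^sup>2) \<le> (opnorm Ob)\<^sup>2 * (2 ^ CARD('q))\<^sup>2"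
    by (simp add: power2_eq_square mult_ac)
  then show ?thesis by (simp add: power_divide pos_divide_le_eq flip: sum_divide_distrib)
qed

lemma sum_trace_local_proj:
  assumes "w \<in> settings"
  shows "(\<Sum>b\<in>UNIV. trace (local_proj w b ** \<sigma>)) = trace \<sigma>"
proof -
  let ?U = "qubit_tensor (\<lambda>q. rotation (w q))"
  have "(\<Sum>b\<in>UNIV. trace (local_proj w b ** \<sigma>)) = trace (?U ** \<sigma> ** cadj ?U)"
    unfolding ketbra_local[symmetric] trace_ketbra_cadj_ket by (simp add: trace_def)
  then show ?thesis using trace_unitary_conj[OF unitary_local[OF assms]] by simp
qed

lemma psd_trace_local_proj:
  assumes "psd \<sigma>"
  shows "Re (trace (local_proj w b ** \<sigma>)) \<ge> 0"
  using psd_conj_diagonal[OF assms]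
  unfolding ketbra_local[symmetric] trace_ketbra_cadj_ket by (simp add: complex_nonneg_Reals_iff)

text \<open>The bound for a fixed setting does not depend on the outcome, so the outcome
  probabilities sum to 1 and the state disappears. Summing over the settings cancels the inverse
  eigenvalue, because the eigenvalue is the share of compatible settings.\<close>

lemma local_pauli_variance:
  fixes \<sigma> Ob :: "('q::finite \<Rightarrow> bool) op"
  assumes \<sigma>: "psd \<sigma>" "trace \<sigma> = 1" and Ob: "hermitian Ob"
  shows "avg local_pauli_ensemble
      (\<lambda>\<psi>. Re (trace (\<psi> ** \<sigma>)) * (Re (shadow_form local_pauli_eigenvalue \<psi> Ob))\<^sup>2)
    \<le> 4 ^ supp_size Ob * (opnorm Ob)\<^sup>2"
proof -
  let ?l = local_pauli_eigenvalue and ?c = "\<lambda>u. (Re (trace (pauli u ** Ob)) / 2 ^ CARD('q))\<^sup>2"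
  let ?h = "\<lambda>w. 4 ^ supp_size Ob * (\<Sum>u\<in>UNIV. if compatible w u then ?c u / ?l u else 0)"
  have "(\<Sum>w\<in>settings. \<Sum>b\<in>UNIV. Re (trace (local_proj w b ** \<sigma>)) * (Re (shadow_form ?l (local_proj w b) Ob))\<^sup>2)
      \<le> (\<Sum>w\<in>settings. \<Sum>b\<in>UNIV. Re (trace (local_proj w b ** \<sigma>)) * ?h w)"
    by (intro sum_mono mult_left_mono local_shadow_form_square Ob psd_trace_local_proj \<sigma>)
  also have "\<dots> = (\<Sum>w\<in>settings. ?h w)"
  proof (intro sum.cong refl)
    fix w :: "'q \<Rightarrow> bool \<times> bool" assume "w \<in> settings"
    from sum_trace_local_proj[OF this, of \<sigma>] have "(\<Sum>b\<in>UNIV. Re (trace (local_proj w b ** \<sigma>))) = 1"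
      unfolding \<sigma>(2) by (simp flip: Re_sum)
    then show "(\<Sum>b\<in>UNIV. Re (trace (local_proj w b ** \<sigma>)) * ?h w) = ?h w"
      by (simp flip: sum_distrib_right)
  qed
  also have "\<dots> = 4 ^ supp_size Ob * (\<Sum>u\<in>UNIV. \<Sum>w\<in>settings. if compatible w u then ?c u / ?l u else 0)"
    unfolding sum_distrib_left[symmetric] by (subst sum.swap) (rule refl)
  also have "(\<Sum>u\<in>UNIV. \<Sum>w\<in>settings. if compatible w u then ?c u / ?l u else 0)
      = (\<Sum>u\<in>UNIV. 3 ^ CARD('q) * ?c u)"
  proof (intro sum.cong refl)
    fix u :: "'q pauli"
    have "(\<Sum>w\<in>settings. if compatible w u then ?c u / ?l u else 0)
        = real (card {w \<in> settings. compatible w u}) * (?c u / ?l u)"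
      by (simp add: sum.If_cases settings_props Int_def)
    then show "(\<Sum>w\<in>settings. if compatible w u then ?c u / ?l u else 0) = 3 ^ CARD('q) * ?c u"
      unfolding card_compatible using local_pauli_eigenvalue_pos[of u] by simp
  qed
  also have "4 ^ supp_size Ob * (\<Sum>u\<in>UNIV. 3 ^ CARD('q) * ?c u)
      \<le> 4 ^ supp_size Ob * (3 ^ CARD('q) * (opnorm Ob)\<^sup>2)"
    unfolding sum_distrib_left[symmetric] using sum_pauli_coefficients[OF Ob] by simp
  finally have "(\<Sum>w\<in>settings. \<Sum>b\<in>UNIV. Re (trace (local_proj w b ** \<sigma>)) * (Re (shadow_form ?l (local_proj w b) Ob))\<^sup>2)
      \<le> 3 ^ CARD('q) * (4 ^ supp_size Ob * (opnorm Ob)\<^sup>2)" by (simp add: mult_ac)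
  then show ?thesis unfolding avg_local_pauli by (simp add: pos_divide_le_eq mult_ac)
qed

section \<open>Median of means\<close>

text \<open>Each order statistic that enters the median has at least half of the entries on either
  side, itself included, so if it were off, at least half of the entries would be bad.\<close>

lemma median_close:
  assumes xs: "xs \<noteq> []"
    and bad: "2 * length (filter (\<lambda>x. \<not> \<bar>x - m\<bar> \<le> e) xs) < length xs"
  shows "\<bar>median xs - m\<bar> \<le> e"
proof -
  define s k where "s = sort xs" and "k = length xs"
  have k: "length s = k" "sorted s" "k > 0" using xs by (auto simp: s_def k_def)
  have bad': "2 * card {i. i < k \<and> \<not> \<bar>s ! i - m\<bar> \<le> e} < k"
  proof -
    have "length (filter (\<lambda>x. \<not> \<bar>x - m\<bar> \<le> e) s) = length (filter (\<lambda>x. \<not> \<bar>x - m\<bar> \<le> e) xs)"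
      unfolding s_def by (metis filter_sort length_sort)
    then show ?thesis using bad k by (simp add: length_filter_conv_card k_def)
  qed
  \<comment> \<open>The indices up to \<open>i\<close> number \<open>i + 1\<close>, and the
    condition makes them at least half of all.\<close>
  have lower: "m - e \<le> s ! i" if i: "i < k" "k \<le> 2 * (i + 1)" for i
  proof (rule ccontr)
    assume "\<not> m - e \<le> s ! i"
    then have "{..i} \<subseteq> {i. i < k \<and> \<not> \<bar>s ! i - m\<bar> \<le> e}"
      using i k sorted_nth_mono[of s] by (fastforce simp: abs_le_iff)
    then have "card {..i} \<le> card {i. i < k \<and> \<not> \<bar>s ! i - m\<bar> \<le> e}" by (intro card_mono) auto
    then show False using bad' i by simp
  qed
  \<comment> \<open>Here the \<open>k - i\<close> indices from \<open>i\<close> on are at least half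
    of all.\<close>
  have upper: "s ! i \<le> m + e" if i: "i < k" "2 * i \<le> k" for i
  proof (rule ccontr)
    assume "\<not> s ! i \<le> m + e"
    then have "{i..<k} \<subseteq> {i. i < k \<and> \<not> \<bar>s ! i - m\<bar> \<le> e}"
      using i k sorted_nth_mono[of s] by (fastforce simp: abs_le_iff)
    then have "card {i..<k} \<le> card {i. i < k \<and> \<not> \<bar>s ! i - m\<bar> \<le> e}" by (intro card_mono) auto
    then show False using bad' i by simp
  qed
  show ?thesis
  proof (cases "odd k")
    case True
    then have "median xs = s ! (k div 2)" by (simp add: median_def s_def k_def Let_def)
    moreover have "m - e \<le> s ! (k div 2)" "s ! (k div 2) \<le> m + e"
      using k(3) True by (auto intro!: lower upper)
    ultimately show ?thesis by (simp add: abs_le_iff)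
  next
    case False
    then have "median xs = (s ! (k div 2 - 1) + s ! (k div 2)) / 2"
      by (simp add: median_def s_def k_def Let_def)
    moreover have "k \<ge> 2" using k(3) False by (cases "k = 1") auto
    then have "m - e \<le> s ! (k div 2)" "s ! (k div 2) \<le> m + e"
        "m - e \<le> s ! (k div 2 - 1)" "s ! (k div 2 - 1) \<le> m + e"
      using False by (auto intro!: lower upper elim!: evenE)
    ultimately show ?thesis by (simp add: abs_le_iff)
  qed
qed

section \<open>Deviation bounds for finitely supported product distributions\<close>

lemma expectation_pair_pmf_finite:
  fixes f :: "'a \<times> 'b \<Rightarrow> 'c::{banach, second_countable_topology}"
  assumes "finite (set_pmf p)" "finite (set_pmf r)"
  shows "measure_pmf.expectation (pair_pmf p r) f
    = measure_pmf.expectation p (\<lambda>x. measure_pmf.expectation r (\<lambda>y. f (x, y)))"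
proof -
  have "measure_pmf.expectation (pair_pmf p r) f
      = (\<Sum>x\<in>set_pmf p. pmf p x *\<^sub>R (\<Sum>y\<in>set_pmf r. pmf r y *\<^sub>R f (x, y)))"
    using assms by (subst integral_measure_pmf[of "set_pmf p \<times> set_pmf r"])
      (auto simp: sum.cartesian_product' pmf_pair scaleR_sum_right)
  then show ?thesis using assms by (simp add: integral_measure_pmf)
qed

lemma finite_set_pmf_Pi:
  "finite A \<Longrightarrow> finite (set_pmf p) \<Longrightarrow> finite (set_pmf (Pi_pmf A d (\<lambda>_. p)))"
  by (simp add: set_Pi_pmf finite_PiE_dflt)

lemma expectation_Pi_pmf_insert:
  fixes f :: "('a \<Rightarrow> 'b) \<Rightarrow> real"
  assumes "finite A" "x \<notin> A" "finite (set_pmf p)"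
  shows "measure_pmf.expectation (Pi_pmf (insert x A) d (\<lambda>_. p)) f
    = measure_pmf.expectation p (\<lambda>y. measure_pmf.expectation (Pi_pmf A d (\<lambda>_. p)) (\<lambda>g. f (g(x := y))))"
  using assms
  by (simp add: Pi_pmf_insert expectation_pair_pmf_finite finite_set_pmf_Pi case_prod_unfold)

text \<open>The cross terms vanish by independence.\<close>

lemma variance_sum_Pi_pmf:
  fixes Y :: "'a \<Rightarrow> real"
  assumes "finite A" and fin: "finite (set_pmf p)" and mean: "measure_pmf.expectation p Y = 0"
  shows "measure_pmf.expectation (Pi_pmf A d (\<lambda>_. p)) (\<lambda>z. (\<Sum>i\<in>A. Y (z i))\<^sup>2)
      = card A * measure_pmf.expectation p (\<lambda>y. (Y y)\<^sup>2)"
  using \<open>finite A\<close>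
proof (induction A)
  case (insert x A)
  let ?P = "Pi_pmf A d (\<lambda>_. p)"
  note fin' [simp] = fin finite_set_pmf_Pi[OF insert(1) fin]
  have int [simp]: "integrable (measure_pmf p) f" "integrable (measure_pmf ?P) g" for f g :: "_ \<Rightarrow> real"
    by (auto intro: integrable_measure_pmf_finite)
  have upd: "(\<Sum>i\<in>A. Y (if i = x then y else g i)) = (\<Sum>i\<in>A. Y (g i))" for g y
    using insert(2) by (intro sum.cong) auto
  have "measure_pmf.expectation (Pi_pmf (insert x A) d (\<lambda>_. p)) (\<lambda>z. (\<Sum>i\<in>insert x A. Y (z i))\<^sup>2)
      = measure_pmf.expectation p (\<lambda>y. measure_pmf.expectation ?P (\<lambda>g. (Y y + (\<Sum>i\<in>A. Y (g i)))\<^sup>2))"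
    using insert(1,2) fin by (simp add: expectation_Pi_pmf_insert upd)
  also have "\<dots> = measure_pmf.expectation p (\<lambda>y. (Y y)\<^sup>2
      + 2 * Y y * measure_pmf.expectation ?P (\<lambda>g. \<Sum>i\<in>A. Y (g i))
      + measure_pmf.expectation ?P (\<lambda>g. (\<Sum>i\<in>A. Y (g i))\<^sup>2))"
    by (simp add: power2_sum mult.assoc)
  also have "\<dots> = measure_pmf.expectation p (\<lambda>y. (Y y)\<^sup>2)
      + measure_pmf.expectation ?P (\<lambda>g. (\<Sum>i\<in>A. Y (g i))\<^sup>2)"
    by (simp add: mean)
  finally show ?case using insert by (simp add: algebra_simps)
qed simp

lemma expectation_centered_square:
  fixes X :: "'a \<Rightarrow> real"
  assumes "finite (set_pmf p)" and \<mu>: "\<mu> = measure_pmf.expectation p X"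
  shows "measure_pmf.expectation p (\<lambda>x. (X x - \<mu>)\<^sup>2)
    = measure_pmf.expectation p (\<lambda>x. (X x)\<^sup>2) - \<mu>\<^sup>2"
proof -
  have [simp]: "integrable (measure_pmf p) f" for f :: "_ \<Rightarrow> real"
    using assms by (auto intro: integrable_measure_pmf_finite)
  have "measure_pmf.expectation p (\<lambda>x. (X x - \<mu>)\<^sup>2)
      = measure_pmf.expectation p (\<lambda>x. (X x)\<^sup>2) - 2 * measure_pmf.expectation p X * \<mu> + \<mu>\<^sup>2"
    by (simp add: power2_diff)
  then show ?thesis unfolding \<mu>[symmetric] by (simp add: power2_eq_square)
qed

text \<open>Chebyshev's inequality for a mean. The hypothesis concerns the raw second moment, which
  dominates the variance.\<close>

lemma prob_mean_deviation:
  fixes X :: "'a \<Rightarrow> real" and \<mu> \<epsilon> c :: real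
  assumes "finite A" "A \<noteq> {}" and fin: "finite (set_pmf p)" and \<mu>: "\<mu> = measure_pmf.expectation p X"
    and \<epsilon>: "\<epsilon> > 0" and second: "measure_pmf.expectation p (\<lambda>x. (X x)\<^sup>2) \<le> card A * \<epsilon>\<^sup>2 * c"
  shows "measure_pmf.prob (Pi_pmf A d (\<lambda>_. p)) {z. \<not> \<bar>(\<Sum>i\<in>A. X (z i)) / card A - \<mu>\<bar> \<le> \<epsilon>} \<le> c"
proof -
  let ?P = "Pi_pmf A d (\<lambda>_. p)"
  let ?S = "\<lambda>z. \<Sum>i\<in>A. X (z i) - \<mu>"
  note fin' [simp] = fin finite_set_pmf_Pi[OF \<open>finite A\<close> fin]
  have int [simp]: "integrable (measure_pmf p) f" "integrable (measure_pmf ?P) g" for f g :: "_ \<Rightarrow> real"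
    by (auto intro: integrable_measure_pmf_finite)
  have mean0: "measure_pmf.expectation p (\<lambda>x. X x - \<mu>) = 0" using \<mu> by simp
  have n: "real (card A) > 0" using assms by (simp add: card_gt_0_iff)
  have "measure_pmf.expectation p (\<lambda>x. (X x - \<mu>)\<^sup>2) = measure_pmf.expectation p (\<lambda>x. (X x)\<^sup>2) - \<mu>\<^sup>2"
    using fin \<mu> by (rule expectation_centered_square)
  then have var: "measure_pmf.expectation p (\<lambda>x. (X x - \<mu>)\<^sup>2) \<le> card A * \<epsilon>\<^sup>2 * c"
    using second zero_le_power2[of \<mu>] by linarith
  have "measure_pmf.prob ?P {z. \<not> \<bar>(\<Sum>i\<in>A. X (z i)) / card A - \<mu>\<bar> \<le> \<epsilon>}
      \<le> measure_pmf.prob ?P {z \<in> space (measure_pmf ?P). (real (card A) * \<epsilon>)\<^sup>2 \<le> (?S z)\<^sup>2}"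
  proof (intro measure_pmf.finite_measure_mono subsetI CollectI conjI)
    fix z assume "z \<in> {z. \<not> \<bar>(\<Sum>i\<in>A. X (z i)) / card A - \<mu>\<bar> \<le> \<epsilon>}"
    moreover have "(\<Sum>i\<in>A. X (z i)) / card A - \<mu> = ?S z / card A"
      using n by (simp add: sum_subtractf field_simps)
    ultimately have "card A * \<epsilon> \<le> \<bar>?S z\<bar>" using n by (simp add: field_simps)
    then show "(real (card A) * \<epsilon>)\<^sup>2 \<le> (?S z)\<^sup>2" 
      using power_mono[of "card A * \<epsilon>" "\<bar>?S z\<bar>" 2] n \<epsilon> by simp
  qed auto
  also have "\<dots> \<le> measure_pmf.expectation ?P (\<lambda>z. (?S z)\<^sup>2) / (card A * \<epsilon>)\<^sup>2"
    using n \<epsilon> by (intro integral_Markov_inequality_measure[where A = "{}"]) auto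
  also have "\<dots> = card A * measure_pmf.expectation p (\<lambda>x. (X x - \<mu>)\<^sup>2) / (card A * \<epsilon>)\<^sup>2"
    using variance_sum_Pi_pmf[OF \<open>finite A\<close> fin mean0, of d] by simp
  also have "\<dots> \<le> card A * (card A * \<epsilon>\<^sup>2 * c) / (card A * \<epsilon>)\<^sup>2"
    using n var by (intro divide_right_mono mult_left_mono) auto
  also have "\<dots> = c" using n \<epsilon> by (simp add: field_simps power2_eq_square)
  finally show ?thesis .
qed

text \<open>Disjoint blocks are independent, so the expectation factors one block at a time. The
  lower end of the interval supplies the nonnegativity needed to multiply the bounds.\<close>

lemma expectation_prod_blocks:
  fixes h :: "nat \<Rightarrow> (nat \<Rightarrow> 'a) \<Rightarrow> real"
  assumes fin: "finite (set_pmf p)"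
    and dep: "\<And>k z z'. (\<And>i. i \<in> {k * N..<(k + 1) * N} \<Longrightarrow> z i = z' i) \<Longrightarrow> h k z = h k z'"
    and bound: "\<And>k. 0 \<le> measure_pmf.expectation (Pi_pmf {k * N..<(k + 1) * N} d (\<lambda>_. p)) (h k)"
      "\<And>k. measure_pmf.expectation (Pi_pmf {k * N..<(k + 1) * N} d (\<lambda>_. p)) (h k) \<le> c"
  shows "measure_pmf.expectation (Pi_pmf {..<K * N} d (\<lambda>_. p)) (\<lambda>z. \<Prod>k<K. h k z) \<in> {0..c ^ K}"
proof (induction K)
  case (Suc K)
  let ?A = "{..<K * N}" and ?B = "{K * N..<(K + 1) * N}"
  let ?PA = "Pi_pmf ?A d (\<lambda>_. p)" and ?PB = "Pi_pmf ?B d (\<lambda>_. p)"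
  have AB: "{..<Suc K * N} = ?A \<union> ?B" by auto
  have "Pi_pmf {..<Suc K * N} d (\<lambda>_. p)
      = map_pmf (\<lambda>(f, g) x. if x \<in> ?A then f x else g x) (pair_pmf ?PA ?PB)"
    unfolding AB by (rule Pi_pmf_union) auto
  then have "measure_pmf.expectation (Pi_pmf {..<Suc K * N} d (\<lambda>_. p)) (\<lambda>z. \<Prod>k<Suc K. h k z)
      = measure_pmf.expectation ?PA (\<lambda>f. measure_pmf.expectation ?PB
          (\<lambda>g. \<Prod>k<Suc K. h k (\<lambda>x. if x \<in> ?A then f x else g x)))"
    by (simp add: expectation_pair_pmf_finite finite_set_pmf_Pi fin del: prod.lessThan_Suc)
  also have "\<dots> = measure_pmf.expectation ?PA (\<lambda>f. measure_pmf.expectation ?PB (\<lambda>g. (\<Prod>k<K. h k f) * h K g))"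
  proof -
    have "(\<Prod>k<Suc K. h k (\<lambda>x. if x \<in> ?A then f x else g x)) = (\<Prod>k<K. h k f) * h K g" for f g
    proof -
      \<comment> \<open>The factor of a block ignores all other coordinates, so the glued function
        can be replaced by one of its parts.\<close>
      have "h k (\<lambda>x. if x \<in> ?A then f x else g x) = h k f" if "k < K" for k
      proof (rule dep)
        fix i assume "i \<in> {k * N..<(k + 1) * N}"
        moreover have "(k + 1) * N \<le> K * N" using that by (intro mult_right_mono) auto
        ultimately show "(if i \<in> ?A then f i else g i) = f i" by auto
      qed
      moreover have "h K (\<lambda>x. if x \<in> ?A then f x else g x) = h K g" by (rule dep) auto
      ultimately show ?thesis by simp
    qed
    then show ?thesis by simp
  qed
  also have "\<dots> = measure_pmf.expectation ?PA (\<lambda>f. \<Prod>k<K. h k f) * measure_pmf.expectation ?PB (h K)"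
    by simp
  finally show ?case
    using Suc bound[of K] by (auto intro!: mult_nonneg_nonneg mult_mono simp: mult.commute[of c])
qed simp

lemma median_of_means_deviation:
  fixes X :: "'a \<Rightarrow> real" and \<mu> \<epsilon> :: real
  assumes fin: "finite (set_pmf p)" and \<mu>: "\<mu> = measure_pmf.expectation p X" and \<epsilon>: "\<epsilon> > 0"
    and K: "K > 0"
    and second: "measure_pmf.expectation p (\<lambda>x. (X x)\<^sup>2) \<le> N * \<epsilon>\<^sup>2 / 34"
  shows "measure_pmf.prob (Pi_pmf {..<N * K} d (\<lambda>_. p))
    {z. \<not> \<bar>median_of_means N K (\<lambda>i. X (z i)) - \<mu>\<bar> \<le> \<epsilon>} \<le> exp (- real K / 2)"
proof -
  define I where "I k = {k * N..<(k + 1) * N}" for k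
  define F where "F k = {z. \<not> \<bar>(\<Sum>i\<in>I k. X (z i)) / N - \<mu>\<bar> \<le> \<epsilon>}" for k
  let ?P = "Pi_pmf {..<K * N} d (\<lambda>_. p)"
  have card_I: "card (I k) = N" "finite (I k)" for k by (auto simp: I_def)
  have int [simp]: "integrable (measure_pmf p) f" for f :: "_ \<Rightarrow> real"
    using fin by (auto intro: integrable_measure_pmf_finite)
  have int' [simp]: "integrable (measure_pmf (Pi_pmf A d (\<lambda>_. p))) f" if "finite A" for A :: "nat set" and f :: "_ \<Rightarrow> real"
    using fin that by (auto intro!: integrable_measure_pmf_finite finite_set_pmf_Pi)
  have pF: "measure_pmf.prob (Pi_pmf (I k) d (\<lambda>_. p)) (F k) \<le> 1 / 34" for k
  proof (cases "N = 0")
    case True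
    \<comment> \<open>An empty batch has mean 0, since division by 0 yields 0. The hypothesis then
      forces the true mean to be 0 as well, so the batch does not fail.\<close>
    have "measure_pmf.expectation p (\<lambda>x. (X x - \<mu>)\<^sup>2) = measure_pmf.expectation p (\<lambda>x. (X x)\<^sup>2) - \<mu>\<^sup>2"
      using fin \<mu> by (rule expectation_centered_square)
    moreover have "0 \<le> measure_pmf.expectation p (\<lambda>x. (X x - \<mu>)\<^sup>2)" by simp
    ultimately have "\<mu>\<^sup>2 \<le> 0" using second True by (simp only: of_nat_0 mult_zero_left)
    then have "\<mu> = 0" by simp
    then have "F k = {}" using True \<epsilon> by (simp add: F_def)
    then show ?thesis by simp
  next
    case False
    then have ne: "I k \<noteq> {}" using card_I[of k] by auto
    have "measure_pmf.expectation p (\<lambda>x. (X x)\<^sup>2) \<le> card (I k) * \<epsilon>\<^sup>2 * (1 / 34)"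
      using second by (simp add: card_I)
    from prob_mean_deviation[OF card_I(2) ne fin \<mu> \<epsilon> this, of d] show ?thesis
      by (simp add: card_I F_def)
  qed
  \<comment> \<open>The weight 36 of a failing batch is a perfect square close to 33, the value of
    \<open>a\<close> that minimizes \<open>(33 + a) / (34 * sqrt a)\<close>.\<close>
  have fac: "(1 + 35 * indicat_real (F k) z) = (if z \<in> F k then 36 else 1)" for k z
    by simp
  have E: "measure_pmf.expectation (Pi_pmf (I k) d (\<lambda>_. p)) (\<lambda>z. 1 + 35 * indicat_real (F k) z)
      = 1 + 35 * measure_pmf.prob (Pi_pmf (I k) d (\<lambda>_. p)) (F k)" for k
    using card_I by simp
  have prod: "measure_pmf.expectation ?P (\<lambda>z. \<Prod>k<K. 1 + 35 * indicat_real (F k) z) \<in> {0..(69/34) ^ K}"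
  proof (rule expectation_prod_blocks[OF fin])
    fix k and z z' :: "nat \<Rightarrow> 'a" assume "\<And>i. i \<in> {k * N..<(k + 1) * N} \<Longrightarrow> z i = z' i"
    then have "(\<Sum>i\<in>I k. X (z i)) = (\<Sum>i\<in>I k. X (z' i))" by (intro sum.cong) (auto simp: I_def)
    then show "1 + 35 * indicat_real (F k) z = 1 + 35 * indicat_real (F k) z'"
      by (simp add: F_def indicator_def)
  next
    fix k
    show "0 \<le> measure_pmf.expectation (Pi_pmf {k * N..<(k + 1) * N} d (\<lambda>_. p)) (\<lambda>z. 1 + 35 * indicat_real (F k) z)"
      "measure_pmf.expectation (Pi_pmf {k * N..<(k + 1) * N} d (\<lambda>_. p)) (\<lambda>z. 1 + 35 * indicat_real (F k) z) \<le> 69/34"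
      using E[of k] pF[of k] by (auto simp: I_def)
  qed
  have "measure_pmf.prob ?P {z. \<not> \<bar>median_of_means N K (\<lambda>i. X (z i)) - \<mu>\<bar> \<le> \<epsilon>}
      \<le> measure_pmf.prob ?P {z \<in> space (measure_pmf ?P). 6 ^ K \<le> (\<Prod>k<K. 1 + 35 * indicat_real (F k) z)}"
  proof (intro measure_pmf.finite_measure_mono subsetI CollectI conjI)
    fix z assume "z \<in> {z. \<not> \<bar>median_of_means N K (\<lambda>i. X (z i)) - \<mu>\<bar> \<le> \<epsilon>}"
    then have "\<not> 2 * length (filter (\<lambda>x. \<not> \<bar>x - \<mu>\<bar> \<le> \<epsilon>)
        (map (\<lambda>k. (\<Sum>i\<in>{k * N..<(k + 1) * N}. X (z i)) / real N) [0..<K])) < K"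
      unfolding median_of_means_def
      using median_close[of "map (\<lambda>k. (\<Sum>i\<in>{k * N..<(k + 1) * N}. X (z i)) / real N) [0..<K]" \<mu> \<epsilon>] K
      by auto
    then have "K \<le> 2 * length (filter (\<lambda>x. \<not> \<bar>x - \<mu>\<bar> \<le> \<epsilon>)
        (map (\<lambda>k. (\<Sum>i\<in>{k * N..<(k + 1) * N}. X (z i)) / real N) [0..<K]))"
      by simp
    also have "\<dots> = 2 * card {k. k < K \<and> z \<in> F k}"
      by (simp add: length_filter_conv_card F_def I_def cong: conj_cong)
    finally have le: "K \<le> 2 * card {k. k < K \<and> z \<in> F k}" .
    have "(6::real) ^ K \<le> 6 ^ (2 * card {k. k < K \<and> z \<in> F k})"
      using le by (intro power_increasing) auto
    also have "\<dots> = 36 ^ card {k. k < K \<and> z \<in> F k}" by (simp add: power_mult)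
    also have "\<dots> = (\<Prod>k<K. 1 + 35 * indicat_real (F k) z)"
      unfolding fac by (simp add: prod.If_cases Int_def)
    finally show "6 ^ K \<le> (\<Prod>k<K. 1 + 35 * indicat_real (F k) z)" .
  qed auto
  also have "\<dots> \<le> measure_pmf.expectation ?P (\<lambda>z. \<Prod>k<K. 1 + 35 * indicat_real (F k) z) / 6 ^ K"
    by (intro integral_Markov_inequality_measure[where A = "{}"]) (auto intro!: prod_nonneg)
  also have "\<dots> \<le> (69/34) ^ K / 6 ^ K" using prod by (intro divide_right_mono) auto
  also have "\<dots> = (23/68) ^ K" by (simp flip: power_divide)
  \<comment> \<open>\<open>exp (- 1 / 2)\<close> is at least \<open>1 - 1 / 2\<close>, which exceeds
    \<open>23 / 68\<close>.\<close>
  also have "\<dots> \<le> exp (- 1 / 2) ^ K"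
    using exp_ge_add_one_self[of "- 1 / 2 :: real"] by (intro power_mono) auto
  also have "\<dots> = exp (- real K / 2)" by (simp flip: exp_of_nat_mult)
  finally show ?thesis by (simp add: mult.commute)
qed

section \<open>Inverting the measurement map of a product ensemble\<close>

lemma avg_product:
  fixes p :: "'a::finite op pmf" and r :: "'b::finite op pmf"
    and F :: "_ \<Rightarrow> 'x::{banach, second_countable_topology}"
  assumes p: "finite (set_pmf p)" and r: "finite (set_pmf r)"
  shows "avg (product_ensemble p r) F = avg p (\<lambda>\<psi>. avg r (\<lambda>\<phi>. F (optensor \<psi> \<phi>)))"
proof -
  have ket: "ketbra (cadj (optensor U V) *v ket (a, b))
      = optensor (ketbra (cadj U *v ket a)) (ketbra (cadj V *v ket b))" for U V a b
    by (simp add: vec_eq_iff cadj_ket_nth mult_ac)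
  have pairs: "(\<Sum>b\<in>UNIV. f b) = (\<Sum>a\<in>UNIV. \<Sum>b\<in>UNIV. f (a, b))" for f :: "'a \<times> 'b \<Rightarrow> 'x"
    using sum.cartesian_product'[of f UNIV UNIV] by simp
  have "avg (product_ensemble p r) F = measure_pmf.expectation (pair_pmf p r)
      (\<lambda>(U, V). \<Sum>b\<in>UNIV. F (ketbra (cadj (optensor U V) *v ket b)))"
    unfolding product_ensemble_def using p r by (subst avg_expectation) (simp_all add: case_prod_unfold)
  also have "\<dots> = (\<Sum>U\<in>set_pmf p. pmf p U *\<^sub>R (\<Sum>V\<in>set_pmf r. pmf r V *\<^sub>R
      (\<Sum>b\<in>UNIV. F (ketbra (cadj (optensor U V) *v ket b)))))"
    using p r by (simp add: expectation_pair_pmf_finite integral_measure_pmf)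
  also have "\<dots> = (\<Sum>U\<in>set_pmf p. pmf p U *\<^sub>R (\<Sum>V\<in>set_pmf r. \<Sum>a\<in>UNIV. pmf r V *\<^sub>R
      (\<Sum>b\<in>UNIV. F (optensor (ketbra (cadj U *v ket a)) (ketbra (cadj V *v ket b))))))"
    by (simp only: pairs ket scaleR_sum_right)
  \<comment> \<open>Exchanging the unitary of the second ensemble with the outcome of the first
    brings the inner sums into the form of \<open>avg r\<close>.\<close>
  also have "\<dots> = (\<Sum>U\<in>set_pmf p. pmf p U *\<^sub>R (\<Sum>a\<in>UNIV. \<Sum>V\<in>set_pmf r. pmf r V *\<^sub>R
      (\<Sum>b\<in>UNIV. F (optensor (ketbra (cadj U *v ket a)) (ketbra (cadj V *v ket b))))))"
    by (intro sum.cong refl arg_cong2[of _ _ _ _ scaleR] sum.swap)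
  finally show ?thesis unfolding avg_def .
qed

lemma trace_optensor: "trace (optensor A B) = trace A * trace B"
proof -
  have "trace (optensor A B) = (\<Sum>(i, k)\<in>UNIV \<times> UNIV. A $ i $ i * B $ k $ k)"
    unfolding trace_def by (simp add: case_prod_unfold)
  then show ?thesis unfolding sum.cartesian_product[symmetric] trace_def sum_product .
qed

lemma optensor_mult: "optensor A B ** optensor C D = optensor (A ** C) (B ** D)"
proof -
  have "(optensor A B ** optensor C D) $ p $ r = optensor (A ** C) (B ** D) $ p $ r" for p r
  proof -
    have "(optensor A B ** optensor C D) $ p $ r
        = (\<Sum>(i, k)\<in>UNIV \<times> UNIV. (A $ fst p $ i * C $ i $ fst r) * (B $ snd p $ k * D $ k $ snd r))"
      unfolding mult_nth by (simp add: case_prod_unfold mult_ac)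
    then show ?thesis
      unfolding sum.cartesian_product[symmetric] optensor_nth mult_nth sum_product .
  qed
  then show ?thesis by (simp add: vec_eq_iff)
qed

lemma linear_optensor: "linear (optensor A)" "linear (\<lambda>A. optensor A B)"
  by (intro linearI; simp add: vec_eq_iff algebra_simps scaleR_eq_cscale)+

lemma optensor_cscale:
  "optensor (cscale c A) B = cscale c (optensor A B)" "optensor A (cscale c B) = cscale c (optensor A B)"
  by (simp_all add: vec_eq_iff)

lemma finite_set_product_ensemble:
  "finite (set_pmf p) \<Longrightarrow> finite (set_pmf r) \<Longrightarrow> finite (set_pmf (product_ensemble p r))"
  by (simp add: product_ensemble_def)

lemma measurement_map_product:
  fixes p :: "'a::finite op pmf" and r :: "'b::finite op pmf"
  assumes p: "finite (set_pmf p)" and r: "finite (set_pmf r)"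
  shows "measurement_map (product_ensemble p r) (optensor A B)
    = optensor (measurement_map p A) (measurement_map r B)"
proof -
  have "optensor (avg p f) (avg r g) = avg p (\<lambda>\<psi>. avg r (\<lambda>\<phi>. optensor (f \<psi>) (g \<phi>)))"
    for f :: "'a op \<Rightarrow> 'a op" and g :: "'b op \<Rightarrow> 'b op"
  proof -
    have "optensor (avg p f) (avg r g) = avg p (\<lambda>\<psi>. optensor (f \<psi>) (avg r g))"
      by (rule avg_linear[OF linear_optensor(2)])
    then show ?thesis by (simp only: avg_linear[OF linear_optensor(1)])
  qed
  then show ?thesis
    unfolding measurement_map_avg[OF finite_set_product_ensemble[OF p r]] avg_product[OF p r]
      measurement_map_avg[OF p] measurement_map_avg[OF r]
    by (simp add: optensor_mult trace_optensor optensor_cscale mult.commute)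
qed

text \<open>Both sides average the product of the traces of \<open>A\<close> and \<open>B\<close>
  against the state.\<close>

lemma measurement_map_self_adjoint:
  assumes "finite (set_pmf p)"
  shows "trace (measurement_map p A ** B) = trace (A ** measurement_map p B)"
proof -
  have "trace (measurement_map p X ** Y) = avg p (\<lambda>\<psi>. trace (\<psi> ** X) * trace (\<psi> ** Y))" for X Y
    by (simp add: measurement_map_avg[OF assms] avg_linear[OF linear_trace_mult])
  from this[of A B] this[of B A] show ?thesis
    by (simp add: trace_mul_sym[of A] mult.commute)
qed

lemma op_eq_if_trace_optensor_eq:
  fixes A B :: "('a::finite \<times> 'b::finite) op"
  assumes "\<And>C D. trace (A ** optensor C D) = trace (B ** optensor C D)"
  shows "A = B"
proof -
  have "optensor (unit_op i j) (unit_op k l) = unit_op (i, k) (j, l)" for i j :: 'a and k l :: 'b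
    by (auto simp: vec_eq_iff unit_op_def)
  then have "trace (A ** unit_op (i, k) (j, l)) = trace (B ** unit_op (i, k) (j, l))" for i j k l
    using assms by metis
  then show ?thesis by (simp add: trace_mult_unit_op vec_eq_iff)
qed

text \<open>\<open>inv\<close> inverts only an injective map. All product operators lie in the
  range, so by self-adjointness two operators with equal images agree against every product
  operator, and these separate operators.\<close>

lemma inverse_measurement_map_product:
  assumes p: "pauli_diagonal p l" and r: "pauli_diagonal r m"
  shows "inverse_measurement_map (product_ensemble p r) (optensor A B)
    = optensor (shadow_inv l A) (shadow_inv m B)"
proof -
  let ?M = "measurement_map (product_ensemble p r)"
  have fin: "finite (set_pmf p)" "finite (set_pmf r)" using p r by (auto simp: pauli_diagonal_def)
  have M: "?M (optensor (shadow_inv l C) (shadow_inv m D)) = optensor C D" for C D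
    by (simp add: measurement_map_product fin measurement_map_shadow_inv[OF p] measurement_map_shadow_inv[OF r])
  have "inj ?M"
  proof (rule injI, rule op_eq_if_trace_optensor_eq)
    fix X Y C D assume eq: "?M X = ?M Y"
    have "trace (Z ** optensor C D) = trace (?M Z ** optensor (shadow_inv l C) (shadow_inv m D))" for Z
      by (simp only: measurement_map_self_adjoint[OF finite_set_product_ensemble[OF fin]] M)
    then show "trace (X ** optensor C D) = trace (Y ** optensor C D)" using eq by simp
  qed
  then show ?thesis unfolding inverse_measurement_map_def using M by (intro inv_f_eq)
qed

section \<open>The distribution of a single shadow\<close>

fun ensemble_eigenvalue :: "ensemble \<Rightarrow> 'q::finite pauli \<Rightarrow> real" where
  "ensemble_eigenvalue Local_Pauli = local_pauli_eigenvalue"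
| "ensemble_eigenvalue Global_Clifford = clifford_eigenvalue"

lemma ensemble_pauli_diagonal: "pauli_diagonal (ensemble_pmf e) (ensemble_eigenvalue e)"
  by (cases e) (simp_all add: local_pauli_diagonal clifford_pauli_diagonal)

lemma ensemble_variance:
  assumes "psd \<sigma>" "trace \<sigma> = 1" "hermitian Ob"
  shows "avg (ensemble_pmf e)
      (\<lambda>\<psi>. Re (trace (\<psi> ** \<sigma>)) * (Re (shadow_form (ensemble_eigenvalue e) \<psi> Ob))\<^sup>2) \<le> shadow_weight e Ob"
  using local_pauli_variance[OF assms] clifford_variance[OF assms] by (cases e) simp_all

lemma shadow_weight_nonneg: "0 \<le> shadow_weight e Ob"
  by (cases e) (simp_all add: opnorm_nonneg)

lemma finite_ensemble: "finite (set_pmf (ensemble_pmf e))"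
  and unitary_ensemble: "U \<in> set_pmf (ensemble_pmf e) \<Longrightarrow> unitary U"
  using ensemble_pauli_diagonal[of e] by (auto simp: pauli_diagonal_def)

text \<open>A one-dimensional ancilla reduces complete positivity to positivity.\<close>

lemma channel_psd:
  assumes E: "quantum_channel E" and "psd A"
  shows "psd (E A)"
proof -
  have "block_psd 1 (\<lambda>i j. A)" using \<open>psd A\<close> by (simp add: block_psd_def psd_def)
  then have "block_psd 1 (\<lambda>i j. E A)" using E by (simp add: quantum_channel_def completely_positive_def)
  then have "(\<Sum>a\<in>UNIV. \<Sum>b\<in>UNIV. cnj ((\<lambda>_. x) (0 :: nat) $ a) * E A $ a $ b * (\<lambda>_. x) (0 :: nat) $ b) \<in> \<real>\<^sub>\<ge>\<^sub>0" for x
    unfolding block_psd_def by (elim allE[of _ "\<lambda>_. x"]) simp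
  then show ?thesis by (simp add: psd_def)
qed

lemma channel_linear:
  assumes "quantum_channel E"
  shows "linear E"
  using assms by (intro linearI) (simp_all add: quantum_channel_def scaleR_eq_cscale)

text \<open>\<open>embed_pmf\<close> has the intended masses when they are nonnegative and sum to 1;
  for a channel output this comes from positivity and trace preservation.\<close>

lemma expectation_measure_basis:
  fixes \<sigma> :: "'a::finite op" and h :: "'a \<Rightarrow> real"
  assumes nonneg: "\<And>b. Re (\<sigma> $ b $ b) \<ge> 0" and sum: "trace \<sigma> = 1"
  shows "measure_pmf.expectation (measure_basis \<sigma>) h = (\<Sum>b\<in>UNIV. Re (\<sigma> $ b $ b) * h b)"
proof -
  have "(\<Sum>b\<in>UNIV. Re (\<sigma> $ b $ b)) = 1" using sum unfolding trace_def by (simp flip: Re_sum)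
  then have "(\<integral>\<^sup>+ b. ennreal (Re (\<sigma> $ b $ b)) \<partial>count_space UNIV) = 1"
    using nonneg by (simp add: nn_integral_count_space_finite sum_ennreal)
  then have "pmf (measure_basis \<sigma>) b = Re (\<sigma> $ b $ b)" for b
    unfolding measure_basis_def using nonneg by (intro pmf_embed_pmf) auto
  then show ?thesis by (subst integral_measure_pmf[of UNIV]) auto
qed

lemma expectation_bind_pmf_finite:
  fixes h :: "'b \<Rightarrow> real"
  assumes "finite (set_pmf p)" "\<And>x. x \<in> set_pmf p \<Longrightarrow> finite (set_pmf (f x))"
  shows "measure_pmf.expectation (p \<bind> f) h
    = (\<Sum>x\<in>set_pmf p. pmf p x *\<^sub>R measure_pmf.expectation (f x) h)"
  using assms by (intro pmf_expectation_bind) auto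

text \<open>The two kets are entrywise conjugates, and conjugating the ket transposes its projector.
  So the shadow holds the transpose of the prepared state.\<close>

lemma ketbra_transpose_ket:
  "ketbra (transpose U *v ket b) = transpose (ketbra (cadj U *v ket b))"
  by (simp add: vec_eq_iff transpose_def mult_ket_nth cadj_ket_nth)

lemma ketbra_vtensor: "ketbra (vtensor v w) = optensor (ketbra v) (ketbra w)"
  by (simp add: vec_eq_iff vtensor_def mult_ac)

lemma finite_process_shadow: "finite (set_pmf (process_shadow ein eout E))"
  unfolding process_shadow_def by (simp add: finite_ensemble)

text \<open>The whole experiment as two nested averages: the uniform input string supplies
  \<open>1 / 2 ^ n\<close>, and the Born rule supplies the weight of the output string.\<close>

lemma expectation_process_shadow:
  fixes E :: "('q::finite \<Rightarrow> bool) op \<Rightarrow> ('q \<Rightarrow> bool) op" and h :: "_ \<Rightarrow> real"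
  assumes E: "quantum_channel E"
  shows "measure_pmf.expectation (process_shadow ein eout E) h
    = avg (ensemble_pmf ein) (\<lambda>\<psi>. avg (ensemble_pmf eout) (\<lambda>\<phi>. Re (trace (\<phi> ** E \<psi>))
        * h (optensor (shadow_inv (ensemble_eigenvalue ein) (transpose \<psi>))
                      (shadow_inv (ensemble_eigenvalue eout) \<phi>)))) / 2 ^ CARD('q)"
proof -
  let ?in = "ensemble_pmf ein :: ('q \<Rightarrow> bool) op pmf" and ?out = "ensemble_pmf eout :: ('q \<Rightarrow> bool) op pmf"
  let ?Z = "\<lambda>\<psi> \<phi>. optensor (shadow_inv (ensemble_eigenvalue ein) (transpose \<psi>))
                      (shadow_inv (ensemble_eigenvalue eout) \<phi>)"
  let ?\<psi> = "\<lambda>U b :: 'q \<Rightarrow> bool. ketbra (cadj U *v ket b)"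
  define G where "G \<psi> = avg ?out (\<lambda>\<phi>. Re (trace (\<phi> ** E \<psi>)) * h (?Z \<psi> \<phi>))" for \<psi>
  define run where "run b_in U_in = ?out \<bind> (\<lambda>U_out.
      measure_basis (U_out ** E (?\<psi> U_in b_in) ** cadj U_out) \<bind> (\<lambda>b_out.
      return_pmf (inverse_measurement_map (product_ensemble ?in ?out)
           (ketbra (vtensor (transpose U_in *v ket b_in) (cadj U_out *v ket b_out))))))" for b_in U_in
  have fin_run: "finite (set_pmf (run b U))" for b U
    unfolding run_def by (simp add: finite_ensemble)
  have run: "measure_pmf.expectation (run b U) h = G (?\<psi> U b)" if U: "U \<in> set_pmf ?in" for b U
  proof -
    have "measure_pmf.expectation (run b U) h = (\<Sum>V\<in>set_pmf ?out. pmf ?out V *\<^sub>R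
        measure_pmf.expectation (measure_basis (V ** E (?\<psi> U b) ** cadj V)) (\<lambda>b'. h (?Z (?\<psi> U b) (?\<psi> V b'))))"
      unfolding run_def
      by (subst expectation_bind_pmf_finite)
        (simp_all add: finite_ensemble map_pmf_def[symmetric] ketbra_vtensor ketbra_transpose_ket
          inverse_measurement_map_product[OF ensemble_pauli_diagonal ensemble_pauli_diagonal]
          del: transpose_matrix_vector)
    also have "\<dots> = (\<Sum>V\<in>set_pmf ?out. pmf ?out V *\<^sub>R
        (\<Sum>b'\<in>UNIV. Re (trace (?\<psi> V b' ** E (?\<psi> U b))) * h (?Z (?\<psi> U b) (?\<psi> V b'))))"
    proof (intro sum.cong refl arg_cong2[of _ _ _ _ scaleR])
      fix V assume V: "V \<in> set_pmf ?out"
      have "trace (E (?\<psi> U b)) = 1"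
        using E trace_ketbra_unitary[OF unitary_ensemble[OF U]] by (simp add: quantum_channel_def)
      then have "trace (V ** E (?\<psi> U b) ** cadj V) = 1"
        by (simp add: trace_unitary_conj[OF unitary_ensemble[OF V]])
      moreover have "Re ((V ** E (?\<psi> U b) ** cadj V) $ b' $ b') \<ge> 0" for b'
        using psd_conj_diagonal[OF channel_psd[OF E psd_ketbra]] by (simp add: complex_nonneg_Reals_iff)
      ultimately show "measure_pmf.expectation (measure_basis (V ** E (?\<psi> U b) ** cadj V))
          (\<lambda>b'. h (?Z (?\<psi> U b) (?\<psi> V b')))
        = (\<Sum>b'\<in>UNIV. Re (trace (?\<psi> V b' ** E (?\<psi> U b))) * h (?Z (?\<psi> U b) (?\<psi> V b')))"
        by (subst expectation_measure_basis) (simp_all add: trace_ketbra_cadj_ket)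
    qed
    finally show ?thesis unfolding G_def avg_def .
  qed
  have "measure_pmf.expectation (process_shadow ein eout E) h
      = (\<Sum>b\<in>UNIV. (1 / 2 ^ CARD('q)) *\<^sub>R (\<Sum>U\<in>set_pmf ?in. pmf ?in U *\<^sub>R measure_pmf.expectation (run b U) h))"
  proof -
    have "process_shadow ein eout E = pmf_of_set UNIV \<bind> (\<lambda>b. ?in \<bind> run b)"
      unfolding process_shadow_def run_def by simp
    moreover have "measure_pmf.expectation (?in \<bind> run b) h
        = (\<Sum>U\<in>set_pmf ?in. pmf ?in U *\<^sub>R measure_pmf.expectation (run b U) h)" for b
      by (intro expectation_bind_pmf_finite) (simp_all add: finite_ensemble fin_run)
    moreover have "measure_pmf.expectation (pmf_of_set UNIV \<bind> (\<lambda>b. ?in \<bind> run b)) h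
        = (\<Sum>b\<in>set_pmf (pmf_of_set UNIV).
            pmf (pmf_of_set UNIV) b *\<^sub>R measure_pmf.expectation (?in \<bind> run b) h)"
      by (intro expectation_bind_pmf_finite) (simp_all add: finite_ensemble fin_run)
    ultimately show ?thesis by (simp add: card_fun)
  qed
  also have "\<dots> = (\<Sum>b\<in>UNIV. (1 / 2 ^ CARD('q)) *\<^sub>R (\<Sum>U\<in>set_pmf ?in. pmf ?in U *\<^sub>R G (?\<psi> U b)))"
    by (simp add: run)
  also have "\<dots> = avg ?in G / 2 ^ CARD('q)"
    unfolding avg_def scaleR_sum_right by (subst sum.swap) (simp add: sum_divide_distrib mult_ac)
  finally show ?thesis unfolding G_def .
qed

section \<open>Mean and second moment of the single-shot estimator\<close>

lemma Re_mult_Reals: "x \<in> \<real> \<Longrightarrow> Re (x * z) = Re x * Re z"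
  by (auto elim: Reals_cases)

text \<open>The transpositions of \<open>\<psi>\<close> and \<open>\<rho>\<close> cancel, and the
  input factor is real, so the real part of the product splits.\<close>

lemma single_shot_estimate_optensor:
  fixes \<rho> Ob :: "('q::finite \<Rightarrow> bool) op"
  assumes "hermitian \<psi>" "hermitian \<phi>" "hermitian \<rho>" "hermitian Ob"
  shows "single_shot_estimate \<rho> Ob (optensor (shadow_inv l (transpose \<psi>)) (shadow_inv m \<phi>))
    = 2 ^ CARD('q) * (Re (shadow_form l \<psi> \<rho>) * Re (shadow_form m \<phi> Ob))"
proof -
  have "Re (shadow_form l \<psi> \<rho> * z) = Re (shadow_form l \<psi> \<rho>) * Re z" for z
    using shadow_form_real[OF assms(1,3)] by (rule Re_mult_Reals)
  then show ?thesis
    by (simp add: single_shot_estimate_def optensor_mult trace_optensor trace_shadow_inv shadow_form_transpose)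
qed

text \<open>The reconstruction formula for \<open>\<rho>\<close>, under the linear functional that
  sends A to the trace of \<open>E A ** Ob\<close>.\<close>

lemma channel_trace_expansion:
  fixes E :: "('q::finite \<Rightarrow> bool) op \<Rightarrow> ('q \<Rightarrow> bool) op"
  assumes E: "quantum_channel E"
  shows "avg (ensemble_pmf e) (\<lambda>\<psi>. shadow_form (ensemble_eigenvalue e) \<psi> \<rho> * trace (E \<psi> ** Ob))
    = trace (E \<rho> ** Ob)"
proof -
  have lin: "linear (\<lambda>A. trace (E A ** Ob))"
    using linear_compose[OF channel_linear[OF E] linear_trace_mult] by (simp add: o_def)
  have "trace (E \<rho> ** Ob)
      = trace (E (avg (ensemble_pmf e) (\<lambda>\<psi>. cscale (shadow_form (ensemble_eigenvalue e) \<psi> \<rho>) \<psi>)) ** Ob)"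
    by (simp only: avg_shadow_form[OF ensemble_pauli_diagonal])
  also have "\<dots> = avg (ensemble_pmf e)
      (\<lambda>\<psi>. trace (E (cscale (shadow_form (ensemble_eigenvalue e) \<psi> \<rho>) \<psi>) ** Ob))"
    by (rule avg_linear[OF lin])
  finally show ?thesis using E by (simp add: quantum_channel_def)
qed

text \<open>Positivity speaks only of images of states, so \<open>\<rho>\<close> is expanded into
  pure states with real coefficients. Taking \<open>Local_Pauli\<close> for this is an arbitrary
  choice.\<close>

lemma trace_channel_real:
  fixes E :: "('q::finite \<Rightarrow> bool) op \<Rightarrow> ('q \<Rightarrow> bool) op"
  assumes E: "quantum_channel E" and "hermitian \<rho>" "hermitian Ob"
  shows "trace (E \<rho> ** Ob) \<in> \<real>"
proof -
  have "trace (E (ketbra v) ** Ob) \<in> \<real>" for v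
    using psd_trace_real[OF channel_psd[OF E psd_ketbra] \<open>hermitian Ob\<close>]
    by (simp only: trace_mul_sym[of _ Ob])
  then show ?thesis
    unfolding channel_trace_expansion[OF E, of Local_Pauli \<rho> Ob, symmetric] avg_def scaleR_conv_of_real
    by (intro sum_in_Reals Reals_mult shadow_form_real hermitian_ketbra \<open>hermitian \<rho>\<close>) auto
qed

text \<open>The inner average reconstructs \<open>Ob\<close> against the channel output and the
  outer one reconstructs \<open>\<rho>\<close>; the factor \<open>2 ^ n\<close> of the estimator
  cancels the probability of the input string.\<close>

lemma expectation_single_shot:
  fixes E :: "('q::finite \<Rightarrow> bool) op \<Rightarrow> ('q \<Rightarrow> bool) op"
  assumes E: "quantum_channel E" and \<rho>: "hermitian \<rho>" and Ob: "hermitian Ob"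
  shows "measure_pmf.expectation (process_shadow ein eout E) (single_shot_estimate \<rho> Ob)
    = Re (trace (E \<rho> ** Ob))"
proof -
  let ?in = "ensemble_pmf ein :: ('q \<Rightarrow> bool) op pmf" and ?out = "ensemble_pmf eout :: ('q \<Rightarrow> bool) op pmf"
  let ?f = "shadow_form (ensemble_eigenvalue ein)" and ?g = "shadow_form (ensemble_eigenvalue eout)"
  have out: "avg ?out (\<lambda>\<phi>. Re (trace (\<phi> ** \<sigma>)) * Re (?g \<phi> Ob)) = Re (trace (\<sigma> ** Ob))" for \<sigma>
  proof -
    have "Re (trace (\<sigma> ** Ob)) = Re (trace (avg ?out (\<lambda>\<phi>. cscale (?g \<phi> Ob) \<phi>) ** \<sigma>))"
      by (simp only: avg_shadow_form[OF ensemble_pauli_diagonal] trace_mul_sym[of Ob])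
    also have "\<dots> = avg ?out (\<lambda>\<phi>. Re (?g \<phi> Ob * trace (\<phi> ** \<sigma>)))"
      using bounded_linear.linear[OF bounded_linear_Re]
      by (simp add: avg_linear[OF linear_trace_mult] avg_linear[of Re])
    also have "\<dots> = avg ?out (\<lambda>\<phi>. Re (trace (\<phi> ** \<sigma>)) * Re (?g \<phi> Ob))"
      by (intro avg_cong) (simp only: Re_mult_Reals[OF shadow_form_real[OF hermitian_ketbra Ob]], rule mult.commute)
    finally show ?thesis ..
  qed
  have "measure_pmf.expectation (process_shadow ein eout E) (single_shot_estimate \<rho> Ob)
      = avg ?in (\<lambda>\<psi>. avg ?out (\<lambda>\<phi>. (2 ^ CARD('q) * Re (?f \<psi> \<rho>)) * (Re (trace (\<phi> ** E \<psi>)) * Re (?g \<phi> Ob))))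
          / 2 ^ CARD('q)"
    unfolding expectation_process_shadow[OF E]
    by (intro arg_cong2[of _ _ _ _ "(/)"] refl avg_cong)
      (simp only: single_shot_estimate_optensor[OF hermitian_ketbra hermitian_ketbra \<rho> Ob] mult_ac)
  also have "\<dots> = avg ?in (\<lambda>\<psi>. 2 ^ CARD('q) * (Re (?f \<psi> \<rho>) * Re (trace (E \<psi> ** Ob)))) / 2 ^ CARD('q)"
    by (simp only: avg_mult_left out mult.assoc)
  also have "\<dots> = avg ?in (\<lambda>\<psi>. Re (?f \<psi> \<rho>) * Re (trace (E \<psi> ** Ob)))"
    by (simp add: avg_mult_left)
  also have "\<dots> = avg ?in (\<lambda>\<psi>. Re (?f \<psi> \<rho> * trace (E \<psi> ** Ob)))"
    by (intro avg_cong) (simp only: Re_mult_Reals[OF shadow_form_real[OF hermitian_ketbra \<rho>]])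
  also have "\<dots> = Re (avg ?in (\<lambda>\<psi>. ?f \<psi> \<rho> * trace (E \<psi> ** Ob)))"
    by (rule avg_linear[symmetric]) (rule bounded_linear.linear[OF bounded_linear_Re])
  finally show ?thesis by (simp only: channel_trace_expansion[OF E])
qed

text \<open>Given the prepared state, the output side is a state shadow of the channel output and is
  bounded uniformly; this decouples the input side, where a uniform weight remains.\<close>

lemma second_moment_single_shot:
  fixes E :: "('q::finite \<Rightarrow> bool) op \<Rightarrow> ('q \<Rightarrow> bool) op"
  assumes E: "quantum_channel E" and \<rho>: "hermitian \<rho>" and Ob: "hermitian Ob"
  shows "measure_pmf.expectation (process_shadow ein eout E) (\<lambda>\<zeta>. (single_shot_estimate \<rho> Ob \<zeta>)\<^sup>2)
    \<le> 4 ^ CARD('q) * (shadow_weight ein \<rho> * shadow_weight eout Ob)"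
proof -
  let ?in = "ensemble_pmf ein :: ('q \<Rightarrow> bool) op pmf" and ?out = "ensemble_pmf eout :: ('q \<Rightarrow> bool) op pmf"
  let ?f = "shadow_form (ensemble_eigenvalue ein)" and ?g = "shadow_form (ensemble_eigenvalue eout)"
  let ?d = "2 ^ CARD('q) :: real"
  \<comment> \<open>The maximally mixed state gives every prepared state the weight
    \<open>1 / ?d\<close>, which brings the input average into the form of
    \<open>ensemble_variance\<close>.\<close>
  let ?mix = "cscale (complex_of_real (1 / ?d)) (mat 1) :: ('q \<Rightarrow> bool) op"
  have "measure_pmf.expectation (process_shadow ein eout E) (\<lambda>\<zeta>. (single_shot_estimate \<rho> Ob \<zeta>)\<^sup>2)
      = avg ?in (\<lambda>\<psi>. avg ?out (\<lambda>\<phi>. (?d * Re (?f \<psi> \<rho>))\<^sup>2 * (Re (trace (\<phi> ** E \<psi>)) * (Re (?g \<phi> Ob))\<^sup>2))) / ?d"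
    unfolding expectation_process_shadow[OF E]
    by (intro arg_cong2[of _ _ _ _ "(/)"] refl avg_cong)
      (simp only: single_shot_estimate_optensor[OF hermitian_ketbra hermitian_ketbra \<rho> Ob] power_mult_distrib mult_ac)
  also have "\<dots> \<le> avg ?in (\<lambda>\<psi>. (?d * Re (?f \<psi> \<rho>))\<^sup>2 * shadow_weight eout Ob) / ?d"
  proof (intro divide_right_mono avg_mono)
    fix U :: "('q \<Rightarrow> bool) op" and b assume U: "U \<in> set_pmf ?in"
    have "trace (E (ketbra (cadj U *v ket b))) = 1"
      using E trace_ketbra_unitary[OF unitary_ensemble[OF U]] by (simp add: quantum_channel_def)
    from ensemble_variance[OF channel_psd[OF E psd_ketbra] this Ob]
    show "avg ?out (\<lambda>\<phi>. (?d * Re (?f (ketbra (cadj U *v ket b)) \<rho>))\<^sup>2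
          * (Re (trace (\<phi> ** E (ketbra (cadj U *v ket b)))) * (Re (?g \<phi> Ob))\<^sup>2))
        \<le> (?d * Re (?f (ketbra (cadj U *v ket b)) \<rho>))\<^sup>2 * shadow_weight eout Ob"
      unfolding avg_mult_left by (intro mult_left_mono) auto
  qed simp
  \<comment> \<open>Two powers of \<open>?d\<close> come from the square; the third compensates the
    weight \<open>1 / ?d\<close>.\<close>
  also have "avg ?in (\<lambda>\<psi>. (?d * Re (?f \<psi> \<rho>))\<^sup>2 * shadow_weight eout Ob)
      = avg ?in (\<lambda>\<psi>. ?d ^ 3 * shadow_weight eout Ob * (Re (trace (\<psi> ** ?mix)) * (Re (?f \<psi> \<rho>))\<^sup>2))"
  proof (rule avg_cong)
    fix U :: "('q \<Rightarrow> bool) op" and b assume "U \<in> set_pmf ?in"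
    then have "Re (trace (ketbra (cadj U *v ket b) ** ?mix)) = 1 / ?d"
      using trace_ketbra_unitary[OF unitary_ensemble, of U ein b] by simp
    then show "(?d * Re (?f (ketbra (cadj U *v ket b)) \<rho>))\<^sup>2 * shadow_weight eout Ob
        = ?d ^ 3 * shadow_weight eout Ob
          * (Re (trace (ketbra (cadj U *v ket b) ** ?mix)) * (Re (?f (ketbra (cadj U *v ket b)) \<rho>))\<^sup>2)"
      by (simp only:) (simp add: power2_eq_square power3_eq_cube)
  qed
  also have "\<dots> = ?d ^ 3 * shadow_weight eout Ob * avg ?in (\<lambda>\<psi>. Re (trace (\<psi> ** ?mix)) * (Re (?f \<psi> \<rho>))\<^sup>2)"
    by (rule avg_mult_left)
  also have "\<dots> / ?d \<le> ?d ^ 3 * shadow_weight eout Ob * shadow_weight ein \<rho> / ?d"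
    using ensemble_variance[OF psd_scaled_mat1 _ \<rho>, of "1 / ?d" ein]
    by (intro divide_right_mono mult_left_mono) (simp_all add: shadow_weight_nonneg trace_I card_fun)
  also have "\<dots> = (?d * ?d) * (shadow_weight ein \<rho> * shadow_weight eout Ob)"
    by (simp add: power3_eq_cube)
  also have "?d * ?d = 4 ^ CARD('q)" by (simp flip: power_mult_distrib)
  finally show ?thesis .
qed

theorem theorem2:
  fixes E :: "('q::finite \<Rightarrow> bool) op \<Rightarrow> ('q \<Rightarrow> bool) op"
    and Ob \<rho> :: "nat \<Rightarrow> ('q \<Rightarrow> bool) op"
    and ein eout :: ensemble
    and M L N K :: nat
    and \<epsilon> \<delta> :: real
  assumes "quantum_channel E"
    and "M \<ge> 1" and "L \<ge> 1"
    and "\<And>j. j \<in> {1..M} \<Longrightarrow> hermitian (Ob j)"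
    and "\<And>k. k \<in> {1..L} \<Longrightarrow> hermitian (\<rho> k)"
    and "0 < \<epsilon>" and "\<epsilon> \<le> 1" and "0 < \<delta>" and "\<delta> \<le> 1"
    and "K = nat \<lceil>2 * ln (2 * real M * real L / \<delta>)\<rceil>"
    and "N = nat \<lceil>34 / \<epsilon>\<^sup>2 * 4 ^ CARD('q) *
               Max ((\<lambda>(j, l). shadow_weight ein (\<rho> l) * shadow_weight eout (Ob j)) ` ({1..M} \<times> {1..L}))\<rceil>"
  shows "measure_pmf.prob (process_shadows (N * K) ein eout E)
           {\<zeta>. \<forall>j\<in>{1..M}. \<forall>k\<in>{1..L}.
              cmod (trace (E (\<rho> k) ** Ob j)
                - complex_of_real (median_of_means N K (\<lambda>i. single_shot_estimate (\<rho> k) (Ob j) (\<zeta> i))))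
              \<le> \<epsilon>} \<ge> 1 - \<delta>"
proof -
  let ?P = "process_shadows (N * K) ein eout E"
  let ?I = "{1..M} \<times> {1..L}"
  let ?w = "\<lambda>(j, l). shadow_weight ein (\<rho> l) * shadow_weight eout (Ob j)"
  define bad where "bad = (\<lambda>(j, k). {\<zeta>. \<not> \<bar>median_of_means N K (\<lambda>i. single_shot_estimate (\<rho> k) (Ob j) (\<zeta> i))
      - Re (trace (E (\<rho> k) ** Ob j))\<bar> \<le> \<epsilon>})"
  define good where "good = {\<zeta>. \<forall>j\<in>{1..M}. \<forall>k\<in>{1..L}. cmod (trace (E (\<rho> k) ** Ob j)
      - complex_of_real (median_of_means N K (\<lambda>i. single_shot_estimate (\<rho> k) (Ob j) (\<zeta> i)))) \<le> \<epsilon>}"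
  have MxL_ge: "real M * real L \<ge> 1" using assms(2,3) mult_mono[of 1 "real M" 1 "real L"] by simp
  \<comment> \<open>Being at least 2, the argument has a positive logarithm, so there is at least
    one batch.\<close>
  have arg: "2 * real M * real L / \<delta> \<ge> 2"
  proof -
    have "2 * \<delta> \<le> 2 * (real M * real L)" using MxL_ge assms(9) by linarith
    then show ?thesis using assms(8) by (simp add: pos_le_divide_eq mult.assoc)
  qed
  have K: "real K \<ge> 2 * ln (2 * real M * real L / \<delta>)"
    unfolding assms(10) by (rule real_nat_ceiling_ge)
  have "ln (2 * real M * real L / \<delta>) > 0" using arg by (intro ln_gt_zero) linarith
  then have K_pos: "K > 0" using K by (intro gr0I) simp
  have exp_K: "exp (- real K / 2) \<le> \<delta> / (2 * real M * real L)"
  proof -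
    have "exp (- real K / 2) \<le> exp (- ln (2 * real M * real L / \<delta>))" using K by simp
    also have "\<dots> = \<delta> / (2 * real M * real L)" using arg by (simp add: exp_minus)
    finally show ?thesis .
  qed
  \<comment> \<open>The factor 2 inside the logarithm halves the budget of each pair, so the union
    bound over all pairs costs only \<open>\<delta> / 2\<close>.\<close>
  have prob_bad: "measure_pmf.prob ?P (bad jk) \<le> \<delta> / (2 * real M * real L)" if jk: "jk \<in> ?I" for jk
  proof -
    obtain j k where jk_eq: "jk = (j, k)" and jk': "j \<in> {1..M}" "k \<in> {1..L}" using jk by auto
    have herm: "hermitian (\<rho> k)" "hermitian (Ob j)" using assms(4,5) jk' by auto
    have "?w jk \<le> Max (?w ` ?I)" using jk by (intro Max_ge) auto
    then have "34 / \<epsilon>\<^sup>2 * 4 ^ CARD('q) * ?w jk \<le> 34 / \<epsilon>\<^sup>2 * 4 ^ CARD('q) * Max (?w ` ?I)"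
      by (intro mult_left_mono) auto
    also have "\<dots> \<le> real N" unfolding assms(11) by (rule real_nat_ceiling_ge)
    finally have "4 ^ CARD('q) * ?w jk \<le> N * \<epsilon>\<^sup>2 / 34"
      using assms(6) by (simp add: field_simps)
    then have "measure_pmf.expectation (process_shadow ein eout E)
        (\<lambda>\<zeta>. (single_shot_estimate (\<rho> k) (Ob j) \<zeta>)\<^sup>2) \<le> N * \<epsilon>\<^sup>2 / 34"
      using second_moment_single_shot[OF assms(1) herm, of ein eout] by (simp add: jk_eq)
    from median_of_means_deviation[OF finite_process_shadow
        expectation_single_shot[OF assms(1) herm, symmetric] assms(6) K_pos this, of undefined]
    show ?thesis using exp_K by (simp add: jk_eq bad_def process_shadows_def)
  qed
  have "UNIV - good \<subseteq> (\<Union>jk\<in>?I. bad jk)"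
  proof
    fix \<zeta> assume "\<zeta> \<in> UNIV - good"
    then obtain j k where jk: "j \<in> {1..M}" "k \<in> {1..L}" and dev: "\<not> cmod (trace (E (\<rho> k) ** Ob j)
        - complex_of_real (median_of_means N K (\<lambda>i. single_shot_estimate (\<rho> k) (Ob j) (\<zeta> i)))) \<le> \<epsilon>"
      unfolding good_def by blast
    \<comment> \<open>As the target is real, the complex distance is the real deviation that
      \<open>bad\<close> measures.\<close>
    have "Im (trace (E (\<rho> k) ** Ob j)) = 0"
      using trace_channel_real[OF assms(1) assms(5)[OF jk(2)] assms(4)[OF jk(1)]]
      by (simp add: complex_is_Real_iff)
    then have "trace (E (\<rho> k) ** Ob j) - complex_of_real x
        = complex_of_real (Re (trace (E (\<rho> k) ** Ob j)) - x)" for x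
      by (simp add: complex_eq_iff)
    then have "\<zeta> \<in> bad (j, k)" using dev by (simp only: norm_of_real) (simp add: bad_def abs_minus_commute)
    then show "\<zeta> \<in> (\<Union>jk\<in>?I. bad jk)" using jk by blast
  qed
  then have "measure_pmf.prob ?P (UNIV - good) \<le> measure_pmf.prob ?P (\<Union>jk\<in>?I. bad jk)"
    by (intro measure_pmf.finite_measure_mono) auto
  also have "\<dots> \<le> (\<Sum>jk\<in>?I. measure_pmf.prob ?P (bad jk))"
    by (intro measure_pmf.finite_measure_subadditive_finite) auto
  also have "\<dots> \<le> (\<Sum>jk\<in>?I. \<delta> / (2 * real M * real L))" by (intro sum_mono prob_bad)
  also have "\<dots> = real M * real L * (\<delta> / (2 * real M * real L))" by (simp add: card_cartesian_product)
  also have "\<dots> = \<delta> / 2" using MxL_ge by auto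
  also have "\<dots> \<le> \<delta>" using assms(8) by simp
  finally have "measure_pmf.prob ?P (UNIV - good) \<le> \<delta>" .
  moreover have "measure_pmf.prob ?P (UNIV - good) = 1 - measure_pmf.prob ?P good"
    using measure_pmf.prob_compl[of good ?P] by simp
  ultimately show ?thesis unfolding good_def[symmetric] by simp
qed

end
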